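(* Let $H$ be an infinite-dimensional separable real prehilbert space. Any unitary representation of the Clifford algebra $C(H)$ on a separable complex Hilbert space that admits an invariant real structure is unitarily equivalent to one in standard form.
   Context: A unitary representation of $C(H)$ is a representation on a complex Hilbert space with $\|h\cdot v\|=\|h\|\|v\|$ for $h\in H$; with an orthonormal basis of $H$ enumerated as $h_1,h_1',h_2,h_2',\dots$, it is given by mutually anticommuting unitary operators $J_1,J_1',J_2,J_2',\dots$ of square $-I$. An invariant real structure is a $\mathbb C$-antilinear norm-preserving operator $S$ with $S^2=I$ commuting with all of them. $X=\mathbb Z_2^{\infty}$ is the compact abelian group of sequences $x=(x_1,x_2,\dots)$ of $0$'s and $1$'s with componentwise addition mod $2$, the product topology and its Borel $\sigma$-algebra. $\delta^k\in X$ has a $1$ in position $k$ and $0$ elsewhere; $\Delta\subset X$ is the subgroup of sequences with finitely many $1$'s; $\check x=x+(1,1,\dots)$; $\check\nu(x)=\nu(\check x)$, $\check\mu(A)=\mu(\check A)$, $\check A=\{\check x:x\in A\}$. A representation of $C(H)$ in (real) standard form is constructed from the following data: a $\sigma$-finite positive Borel measure $\mu$ on $X$, quasi-invariant under $\Delta$ (for $\delta\in\Delta$, $A\mapsto\mu(A+\delta)$ is mutually absolutely continuous with $\mu$), with $\check\mu$ equivalent to $\mu$; a measurable family of nonzero separable real Hilbert spaces $U_x$ with $U_{x+\delta}=U_x=U_{\check x}$ for $\delta\in\Delta$ and almost all $x$; $V_x=\mathbb C\otimes U_x$, with $\nu(x)=\dim V_x$ measurable and $\check\nu=\nu$; bar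 denotes conjugation of $V_x$ with respect to $U_x$, and $\overline A(v)=\overline{A(\bar v)}$ for operators; a measurable family of unitary operators $c_k(x):V_x\to V_{x+\delta^k}=V_x$, $k\ge1$, with $c_k(x)^*=c_k(x+\delta^k)$, $c_k(x)c_l(x+\delta^k)=c_l(x)c_k(x+\delta^l)$ and $\overline{c_k(x)}=(-1)^kc_k(\check x)$ for all $k,l$ and almost all $x$. The representation is on $V=\int_X^\oplus V_x\,d\mu(x)$ with $$J_kf(x)=-i(-1)^{x_1+\dots+x_{k-1}}c_k(x)\sqrt{\tfrac{d\mu(x+\delta^k)}{d\mu(x)}}f(x+\delta^k),\quad J_k'f(x)=(-1)^{x_1+\dots+x_{k}}c_k(x)\sqrt{\tfrac{d\mu(x+\delta^k)}{d\mu(x)}}f(x+\delta^k),$$ and it has invariant real form $\{f\in V:\overline{f(x)}=\sqrt{d\check\mu(x)/d\mu(x)}\,f(\check x)\}$. Here $d\mu(x+\delta^k)/d\mu(x)$ is the Radon–Nikodym derivative of $A\mapsto\mu(A+\delta^k)$ with respect to $\mu$. *)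

theory Defs
  imports "HOL-Analysis.Analysis" "HOL-Library.Extended_Nat"
begin

section \<open>The Clifford algebra of a real prehilbert space\<close>

text \<open>\<open>C(H)\<close> is the unital associative real algebra generated by the vector space \<open>H\<close> subject to
  \<open>h * h = - \<parallel>h\<parallel>\<^sup>2 1\<close>.  It is constructed from its presentation: formal algebra terms over \<open>H\<close>
  modulo the congruence generated by the axioms of unital real algebras, the linearity of the
  inclusion of \<open>H\<close>, and the Clifford relation.  The term \<open>Scal r\<close> stands for \<open>r 1\<close>.\<close>

datatype 'h cliff_term =
    Gen 'h
  | Scal real
  | Plus "'h cliff_term" "'h cliff_term"
  | Times "'h cliff_term" "'h cliff_term"

inductive cliff_rel :: "'h::real_inner cliff_term \<Rightarrow> 'h cliff_term \<Rightarrow> bool" where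
  rel_refl: "cliff_rel a a"
| rel_sym: "cliff_rel a b \<Longrightarrow> cliff_rel b a"
| rel_trans: "cliff_rel a b \<Longrightarrow> cliff_rel b c \<Longrightarrow> cliff_rel a c"
| rel_plus_cong: "cliff_rel a b \<Longrightarrow> cliff_rel c d \<Longrightarrow> cliff_rel (Plus a c) (Plus b d)"
| rel_times_cong: "cliff_rel a b \<Longrightarrow> cliff_rel c d \<Longrightarrow> cliff_rel (Times a c) (Times b d)"
| rel_plus_assoc: "cliff_rel (Plus (Plus a b) c) (Plus a (Plus b c))"
| rel_plus_comm: "cliff_rel (Plus a b) (Plus b a)"
| rel_plus_zero: "cliff_rel (Plus (Scal 0) a) a"
| rel_times_assoc: "cliff_rel (Times (Times a b) c) (Times a (Times b c))"
| rel_times_zero: "cliff_rel (Times (Scal 0) a) (Scal 0)"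
| rel_times_one: "cliff_rel (Times (Scal 1) a) a"
| rel_scal_comm: "cliff_rel (Times (Scal r) a) (Times a (Scal r))"
| rel_distrib_left: "cliff_rel (Times a (Plus b c)) (Plus (Times a b) (Times a c))"
| rel_distrib_right: "cliff_rel (Times (Plus a b) c) (Plus (Times a c) (Times b c))"
| rel_scal_plus: "cliff_rel (Scal (r + s)) (Plus (Scal r) (Scal s))"
| rel_scal_times: "cliff_rel (Scal (r * s)) (Times (Scal r) (Scal s))"
| rel_gen_plus: "cliff_rel (Gen (h + k)) (Plus (Gen h) (Gen k))"
| rel_gen_scaleR: "cliff_rel (Gen (r *\<^sub>R h)) (Times (Scal r) (Gen h))"
| rel_clifford: "cliff_rel (Times (Gen h) (Gen h)) (Scal (- (inner h h)))"

quotient_type (overloaded) 'h clifford = "'h::real_inner cliff_term" / cliff_rel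
  by (intro equivpI reflpI sympI transpI) (blast intro: cliff_rel.intros)+

lift_definition gen :: "'h::real_inner \<Rightarrow> 'h clifford" is Gen .

instantiation clifford :: (real_inner) "{real_algebra, monoid_mult}"
begin

lift_definition zero_clifford :: "'a clifford" is "Scal 0" .
lift_definition one_clifford :: "'a clifford" is "Scal 1" .
lift_definition plus_clifford :: "'a clifford \<Rightarrow> 'a clifford \<Rightarrow> 'a clifford" is Plus
  by (rule cliff_rel.rel_plus_cong)
lift_definition times_clifford :: "'a clifford \<Rightarrow> 'a clifford \<Rightarrow> 'a clifford" is Times
  by (rule cliff_rel.rel_times_cong)
lift_definition scaleR_clifford :: "real \<Rightarrow> 'a clifford \<Rightarrow> 'a clifford" is "\<lambda>r. Times (Scal r)"
  by (rule cliff_rel.rel_times_cong[OF cliff_rel.rel_refl])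
lift_definition uminus_clifford :: "'a clifford \<Rightarrow> 'a clifford" is "Times (Scal (- 1))"
  by (rule cliff_rel.rel_times_cong[OF cliff_rel.rel_refl])
definition minus_clifford :: "'a clifford \<Rightarrow> 'a clifford \<Rightarrow> 'a clifford"
  where "minus_clifford a b = a + - b"

lemma cliff_scaleR_left: "cliff_rel (Times (Scal (r + s)) a) (Plus (Times (Scal r) a) (Times (Scal s) a))"
  by (meson cliff_rel.rel_distrib_right cliff_rel.rel_refl cliff_rel.rel_scal_plus cliff_rel.rel_times_cong cliff_rel.rel_trans)

lemma cliff_scaleR_scaleR: "cliff_rel (Times (Scal r) (Times (Scal s) a)) (Times (Scal (r * s)) a)"
  by (meson cliff_rel.rel_times_assoc cliff_rel.rel_refl cliff_rel.rel_scal_times cliff_rel.rel_times_cong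
      cliff_rel.rel_trans cliff_rel.rel_sym)

lemma cliff_uminus: "cliff_rel (Plus (Times (Scal (- 1)) a) a) (Scal 0)"
proof -
  have "cliff_rel (Plus (Times (Scal (- 1)) a) a) (Plus (Times (Scal (- 1)) a) (Times (Scal 1) a))"
    by (meson cliff_rel.intros)
  also have "cliff_rel \<dots> (Times (Scal (- 1 + 1)) a)"
    by (rule cliff_rel.rel_sym[OF cliff_scaleR_left])
  finally (cliff_rel.rel_trans) show ?thesis
    using cliff_rel.rel_times_zero[of a] by (auto intro: cliff_rel.rel_trans)
qed

instance
proof
  fix a b c :: "'a clifford" and r s :: real
  show "a + b + c = a + (b + c)" by transfer (rule cliff_rel.rel_plus_assoc)
  show "a + b = b + a" by transfer (rule cliff_rel.rel_plus_comm)
  show "0 + a = a" by transfer (rule cliff_rel.rel_plus_zero)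
  show "- a + a = 0" by transfer (rule cliff_uminus)
  show "a - b = a + - b" by (rule minus_clifford_def)
  show "a * b * c = a * (b * c)" by transfer (rule cliff_rel.rel_times_assoc)
  show "1 * a = a" by transfer (rule cliff_rel.rel_times_one)
  show "a * 1 = a"
    by transfer (meson cliff_rel.rel_scal_comm cliff_rel.rel_times_one cliff_rel.rel_trans cliff_rel.rel_sym)
  show "(a + b) * c = a * c + b * c" by transfer (rule cliff_rel.rel_distrib_right)
  show "a * (b + c) = a * b + a * c" by transfer (rule cliff_rel.rel_distrib_left)
  show "r *\<^sub>R (a + b) = r *\<^sub>R a + r *\<^sub>R b" by transfer (rule cliff_rel.rel_distrib_left)
  show "(r + s) *\<^sub>R a = r *\<^sub>R a + s *\<^sub>R a" by transfer (rule cliff_scaleR_left)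
  show "r *\<^sub>R s *\<^sub>R a = (r * s) *\<^sub>R a" by transfer (rule cliff_scaleR_scaleR)
  show "1 *\<^sub>R a = a" by transfer (rule cliff_rel.rel_times_one)
  show "r *\<^sub>R a * b = r *\<^sub>R (a * b)" by transfer (rule cliff_rel.rel_times_assoc)
  show "a * r *\<^sub>R b = r *\<^sub>R (a * b)"
    by transfer (meson cliff_rel.rel_scal_comm cliff_rel.rel_times_assoc cliff_rel.rel_times_cong
        cliff_rel.rel_refl cliff_rel.rel_trans cliff_rel.rel_sym)
qed

end

lemma gen_add: "gen (h + k) = gen h + gen k"
  by transfer (rule cliff_rel.rel_gen_plus)

lemma gen_scaleR: "gen (r *\<^sub>R h) = r *\<^sub>R gen h"
  by transfer (rule cliff_rel.rel_gen_scaleR)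

lemma gen_mult_self: "gen h * gen h = (- (inner h h)) *\<^sub>R 1"
  by transfer
    (metis cliff_rel.rel_clifford cliff_rel.rel_trans cliff_rel.rel_scal_times mult.right_neutral)


section \<open>Complex Hilbert spaces and their operators\<close>

text \<open>Inner products are linear in the first argument.\<close>

class complex_hilbert = real_inner + complete_space +
  fixes scaleC :: "complex \<Rightarrow> 'a \<Rightarrow> 'a"
    and cinner :: "'a \<Rightarrow> 'a \<Rightarrow> complex"
  assumes scaleC_add_right: "scaleC z (x + y) = scaleC z x + scaleC z y"
    and scaleC_add_left: "scaleC (z + w) x = scaleC z x + scaleC w x"
    and scaleC_scaleC: "scaleC z (scaleC w x) = scaleC (z * w) x"
    and scaleR_scaleC: "scaleR r x = scaleC (complex_of_real r) x"
    and cinner_add_left: "cinner (x + y) u = cinner x u + cinner y u"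
    and cinner_scaleC_left: "cinner (scaleC z x) y = z * cinner x y"
    and cinner_commute: "cinner x y = cnj (cinner y x)"
    and inner_eq_Re_cinner: "inner x y = Re (cinner x y)"

text \<open>A direct integral depends on a measure and consists of functions modulo almost everywhere
  equality, so it is not a type.  To treat it on the same footing as a Hilbert space given by a
  type, a complex Hilbert space is presented by representatives: a carrier together with the
  equality \<open>Eqv\<close> of the elements that they represent.\<close>

record 'a hilbert_model =
  Carr :: "'a set"
  Eqv :: "'a \<Rightarrow> 'a \<Rightarrow> bool"
  Add :: "'a \<Rightarrow> 'a \<Rightarrow> 'a"
  Scl :: "complex \<Rightarrow> 'a \<Rightarrow> 'a"
  Ip :: "'a \<Rightarrow> 'a \<Rightarrow> complex"

definition Nrm :: "'a hilbert_model \<Rightarrow> 'a \<Rightarrow> real" where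
  "Nrm M v = sqrt (Re (Ip M v v))"

definition hilbert_type :: "'v::complex_hilbert hilbert_model" where
  "hilbert_type = \<lparr>Carr = UNIV, Eqv = (=), Add = (+), Scl = scaleC, Ip = cinner\<rparr>"

text \<open>Additive maps with \<open>A (z v) = \<sigma> z A v\<close>: linear for \<open>\<sigma> = id\<close>, antilinear for \<open>\<sigma> = cnj\<close>.\<close>

definition semilinear_map ::
    "(complex \<Rightarrow> complex) \<Rightarrow> 'a hilbert_model \<Rightarrow> 'b hilbert_model \<Rightarrow> ('a \<Rightarrow> 'b) \<Rightarrow> bool" where
  "semilinear_map \<sigma> M N A \<longleftrightarrow>
     (\<forall>v\<in>Carr M. A v \<in> Carr N) \<and>
     (\<forall>v\<in>Carr M. \<forall>w\<in>Carr M. Eqv M v w \<longrightarrow> Eqv N (A v) (A w)) \<and>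
     (\<forall>v\<in>Carr M. \<forall>w\<in>Carr M. Eqv N (A (Add M v w)) (Add N (A v) (A w))) \<and>
     (\<forall>z. \<forall>v\<in>Carr M. Eqv N (A (Scl M z v)) (Scl N (\<sigma> z) (A v)))"

definition unitary_map :: "'a hilbert_model \<Rightarrow> 'b hilbert_model \<Rightarrow> ('a \<Rightarrow> 'b) \<Rightarrow> bool" where
  "unitary_map M N T \<longleftrightarrow>
     semilinear_map id M N T \<and>
     (\<forall>v\<in>Carr M. \<forall>w\<in>Carr M. Ip N (T v) (T w) = Ip M v w) \<and>
     (\<forall>u\<in>Carr N. \<exists>v\<in>Carr M. Eqv N (T v) u)"


section \<open>Unitary representations of the Clifford algebra\<close>

definition unitary_rep ::
    "'a hilbert_model \<Rightarrow> ('h::real_inner clifford \<Rightarrow> 'a \<Rightarrow> 'a) \<Rightarrow> bool" where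
  "unitary_rep M \<pi> \<longleftrightarrow>
     (\<forall>a. semilinear_map id M M (\<pi> a)) \<and>
     (\<forall>v\<in>Carr M. Eqv M (\<pi> 1 v) v) \<and>
     (\<forall>a b. \<forall>v\<in>Carr M. Eqv M (\<pi> (a * b) v) (\<pi> a (\<pi> b v))) \<and>
     (\<forall>a b. \<forall>v\<in>Carr M. Eqv M (\<pi> (a + b) v) (Add M (\<pi> a v) (\<pi> b v))) \<and>
     (\<forall>r a. \<forall>v\<in>Carr M. Eqv M (\<pi> (r *\<^sub>R a) v) (Scl M (complex_of_real r) (\<pi> a v))) \<and>
     (\<forall>h. \<forall>v\<in>Carr M. Nrm M (\<pi> (gen h) v) = norm h * Nrm M v)"

definition unitarily_equivalent ::
    "'a hilbert_model \<Rightarrow> ('h::real_inner clifford \<Rightarrow> 'a \<Rightarrow> 'a) \<Rightarrow>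
     'b hilbert_model \<Rightarrow> ('h clifford \<Rightarrow> 'b \<Rightarrow> 'b) \<Rightarrow> bool" where
  "unitarily_equivalent M \<pi> N \<rho> \<longleftrightarrow>
     (\<exists>T. unitary_map M N T \<and> (\<forall>a. \<forall>v\<in>Carr M. Eqv N (T (\<pi> a v)) (\<rho> a (T v))))"

text \<open>The enumeration \<open>e 0, e' 0, e 1, e' 1, \<dots>\<close> of an orthonormal basis of a prehilbert space.\<close>

definition enumerated_onb :: "(nat \<Rightarrow> 'h::real_inner) \<Rightarrow> (nat \<Rightarrow> 'h) \<Rightarrow> bool" where
  "enumerated_onb e e' \<longleftrightarrow>
     (\<forall>i j. inner (e i) (e j) = (if i = j then 1 else 0)) \<and>
     (\<forall>i j. inner (e' i) (e' j) = (if i = j then 1 else 0)) \<and>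
     (\<forall>i j. inner (e i) (e' j) = 0) \<and>
     closure (span (range e \<union> range e')) = UNIV"

definition invariant_real_structure ::
    "(nat \<Rightarrow> 'h::real_inner) \<Rightarrow> (nat \<Rightarrow> 'h) \<Rightarrow> 'a hilbert_model \<Rightarrow> ('h clifford \<Rightarrow> 'a \<Rightarrow> 'a) \<Rightarrow>
     ('a \<Rightarrow> 'a) \<Rightarrow> bool" where
  "invariant_real_structure e e' M \<pi> S \<longleftrightarrow>
     semilinear_map cnj M M S \<and>
     (\<forall>v\<in>Carr M. Nrm M (S v) = Nrm M v) \<and>
     (\<forall>v\<in>Carr M. Eqv M (S (S v)) v) \<and>
     (\<forall>k. \<forall>v\<in>Carr M. Eqv M (S (\<pi> (gen (e k)) v)) (\<pi> (gen (e k)) (S v))) \<and>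
     (\<forall>k. \<forall>v\<in>Carr M. Eqv M (S (\<pi> (gen (e' k)) v)) (\<pi> (gen (e' k)) (S v)))"


section \<open>The group of binary sequences and its measures\<close>

text \<open>Positions are numbered from \<open>0\<close>: what is usually written \<open>x\<^sub>k\<close>, \<open>\<delta>\<^sup>k\<close>, \<open>c\<^sub>k\<close>, \<open>J\<^sub>k\<close> with
  \<open>k \<ge> 1\<close> is here \<open>x (k - 1)\<close>, and so on.  The type \<open>nat \<Rightarrow> bool\<close> carries the product topology, and
  \<open>borel\<close> is the corresponding Borel algebra.\<close>

type_synonym binseq = "nat \<Rightarrow> bool"

definition add_seq :: "binseq \<Rightarrow> binseq \<Rightarrow> binseq" (infixl \<open>\<oplus>\<close> 65) where
  "x \<oplus> y = (\<lambda>j. x j \<noteq> y j)"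

definition delta :: "nat \<Rightarrow> binseq" where
  "delta k = (\<lambda>j. j = k)"

definition Delta :: "binseq set" where
  "Delta = {x. finite {j. x j}}"

definition flip :: "binseq \<Rightarrow> binseq" where
  "flip x = x \<oplus> (\<lambda>j. True)"

text \<open>Every element of the group is its own inverse, so these are \<open>A \<mapsto> \<mu> (A + d)\<close> and
  \<open>A \<mapsto> \<mu> (flip A)\<close>.\<close>

definition translate :: "binseq measure \<Rightarrow> binseq \<Rightarrow> binseq measure" where
  "translate \<mu> d = distr \<mu> borel (\<lambda>x. x \<oplus> d)"

definition flip_measure :: "binseq measure \<Rightarrow> binseq measure" where
  "flip_measure \<mu> = distr \<mu> borel flip"

definition equivalent_measures :: "'x measure \<Rightarrow> 'x measure \<Rightarrow> bool" where
  "equivalent_measures M N \<longleftrightarrow> absolutely_continuous M N \<and> absolutely_continuous N M"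

definition sqrt_RN :: "'x measure \<Rightarrow> 'x measure \<Rightarrow> 'x \<Rightarrow> real" where
  "sqrt_RN M N x = sqrt (enn2real (RN_deriv M N x))"


section \<open>Complexification\<close>

text \<open>The complexification of a real space \<open>U\<close> is \<open>U \<times> U\<close>, the pair \<open>(a, b)\<close> standing for
  \<open>a + \<i> b\<close>.  The norm of the product type is the norm of the complexification.\<close>

definition cx :: "'u set \<Rightarrow> ('u \<times> 'u) set" where
  "cx U = U \<times> U"

definition cx_scale :: "complex \<Rightarrow> 'u \<times> 'u \<Rightarrow> 'u::real_vector \<times> 'u" where
  "cx_scale z v = (Re z *\<^sub>R fst v - Im z *\<^sub>R snd v, Re z *\<^sub>R snd v + Im z *\<^sub>R fst v)"

definition cx_cnj :: "'u \<times> 'u \<Rightarrow> 'u::real_vector \<times> 'u" where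
  "cx_cnj v = (fst v, - snd v)"

definition cx_inner :: "'u::real_inner \<times> 'u \<Rightarrow> 'u \<times> 'u \<Rightarrow> complex" where
  "cx_inner v w = Complex (inner (fst v) (fst w) + inner (snd v) (snd w))
                          (inner (snd v) (fst w) - inner (fst v) (snd w))"

lemma norm_eq_cx_inner: "cx_inner v v = complex_of_real ((norm v)\<^sup>2)"
  by (cases v) (simp add: cx_inner_def complex_eq_iff inner_commute norm_Pair power2_norm_eq_inner)

interpretation cx: vector_space cx_scale
  by standard (auto simp: cx_scale_def algebra_simps)

definition cx_dim :: "('u::real_vector \<times> 'u) set \<Rightarrow> enat" where
  "cx_dim V = (if \<exists>B. finite B \<and> cx.span B = V then enat (cx.dim V) else \<infinity>)"

definition cx_unitary_on :: "('u::real_inner \<times> 'u) set \<Rightarrow> ('u \<times> 'u \<Rightarrow> 'u \<times> 'u) \<Rightarrow> bool" where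
  "cx_unitary_on V A \<longleftrightarrow>
     A ` V = V \<and>
     (\<forall>v\<in>V. \<forall>w\<in>V. A (v + w) = A v + A w) \<and>
     (\<forall>z. \<forall>v\<in>V. A (cx_scale z v) = cx_scale z (A v)) \<and>
     (\<forall>v\<in>V. \<forall>w\<in>V. cx_inner (A v) (A w) = cx_inner v w)"


section \<open>Measurable families and direct integrals\<close>

text \<open>A measurable family of separable real Hilbert spaces is realized inside one separable real
  Hilbert space \<open>'u\<close>: each member is a closed subspace, and there is a sequence of measurable
  sections that at each point spans a dense subspace of the member.  Up to isomorphism every
  measurable field of separable Hilbert spaces is of this form, and then its measurable sections
  are the measurable \<open>'u\<close>-valued functions with values in the family.  In particular
  \<open>U (x \<oplus> d) = U x\<close> is an equality of Hilbert spaces, and translating a measurable section gives a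
  measurable section.\<close>

definition measurable_hilbert_family ::
    "binseq measure \<Rightarrow>
     (binseq \<Rightarrow> 'u::{real_inner, complete_space, second_countable_topology} set) \<Rightarrow> bool" where
  "measurable_hilbert_family \<mu> U \<longleftrightarrow>
     (\<forall>x. subspace (U x) \<and> closed (U x)) \<and>
     (\<exists>s. (\<forall>n. s n \<in> borel_measurable \<mu>) \<and>
          (\<forall>x. closure (span (range (\<lambda>n::nat. s n x))) = U x))"

definition measurable_operator_family ::
    "binseq measure \<Rightarrow> (binseq \<Rightarrow> 'u::real_inner set) \<Rightarrow>
     (binseq \<Rightarrow> 'u \<times> 'u \<Rightarrow> 'u \<times> 'u) \<Rightarrow> bool" where
  "measurable_operator_family \<mu> U A \<longleftrightarrow>
     (\<forall>f\<in>borel_measurable \<mu>. (\<forall>x. f x \<in> cx (U x)) \<longrightarrow> (\<lambda>x. A x (f x)) \<in> borel_measurable \<mu>)"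

definition direct_integral ::
    "binseq measure \<Rightarrow> (binseq \<Rightarrow> 'u::real_inner set) \<Rightarrow> (binseq \<Rightarrow> 'u \<times> 'u) hilbert_model" where
  "direct_integral \<mu> U =
     \<lparr>Carr = {f \<in> borel_measurable \<mu>.
               (AE x in \<mu>. f x \<in> cx (U x)) \<and> integrable \<mu> (\<lambda>x. (norm (f x))\<^sup>2)},
      Eqv = (\<lambda>f g. AE x in \<mu>. f x = g x),
      Add = (\<lambda>f g x. f x + g x),
      Scl = (\<lambda>z f x. cx_scale z (f x)),
      Ip = (\<lambda>f g. \<integral>x. cx_inner (f x) (g x) \<partial>\<mu>)\<rparr>"


section \<open>Representations in standard form\<close>

locale standard_form_data =
  fixes \<mu> :: "binseq measure"
    and U :: "binseq \<Rightarrow> 'u::{real_inner, complete_space, second_countable_topology} set"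
    and c :: "nat \<Rightarrow> binseq \<Rightarrow> 'u \<times> 'u \<Rightarrow> 'u \<times> 'u"
  assumes sets_mu: "sets \<mu> = sets borel"
    and sigma_finite: "sigma_finite_measure \<mu>"
    and quasi_invariant: "\<And>d. d \<in> Delta \<Longrightarrow> equivalent_measures (translate \<mu> d) \<mu>"
    and flip_equivalent: "equivalent_measures (flip_measure \<mu>) \<mu>"
    and family: "measurable_hilbert_family \<mu> U"
    and nonzero: "\<And>x. U x \<noteq> {0}"
    and U_translate: "\<And>d. d \<in> Delta \<Longrightarrow> AE x in \<mu>. U (x \<oplus> d) = U x"
    and U_flip: "AE x in \<mu>. U (flip x) = U x"
    and dim_measurable: "(\<lambda>x. cx_dim (cx (U x))) \<in> measurable \<mu> (count_space UNIV)"
    and dim_flip: "\<And>x. cx_dim (cx (U (flip x))) = cx_dim (cx (U x))"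
    and c_measurable: "\<And>k. measurable_operator_family \<mu> U (c k)"
    and c_unitary: "\<And>k x. cx_unitary_on (cx (U x)) (c k x)"
    and c_adjoint: "\<And>k. AE x in \<mu>. \<forall>v\<in>cx (U x). \<forall>w\<in>cx (U x).
          cx_inner (c k x v) w = cx_inner v (c k (x \<oplus> delta k) w)"
    and c_commute: "\<And>k l. AE x in \<mu>. \<forall>v\<in>cx (U x).
          c k x (c l (x \<oplus> delta k) v) = c l x (c k (x \<oplus> delta l) v)"
    \<comment> \<open>The exponent is \<open>Suc k\<close> because positions are numbered from \<open>0\<close>.\<close>
    and c_conj: "\<And>k. AE x in \<mu>. \<forall>v\<in>cx (U x).
          cx_cnj (c k x (cx_cnj v)) = cx_scale ((- 1) ^ Suc k) (c k (flip x) v)"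

definition J_std ::
    "binseq measure \<Rightarrow> (nat \<Rightarrow> binseq \<Rightarrow> 'u \<times> 'u \<Rightarrow> 'u \<times> 'u) \<Rightarrow> nat \<Rightarrow>
     (binseq \<Rightarrow> 'u \<times> 'u) \<Rightarrow> binseq \<Rightarrow> 'u::real_vector \<times> 'u" where
  "J_std \<mu> c k f x =
     cx_scale (- \<i> * (- 1) ^ (\<Sum>j<k. of_bool (x j)))
       (c k x (sqrt_RN \<mu> (translate \<mu> (delta k)) x *\<^sub>R f (x \<oplus> delta k)))"

definition J'_std ::
    "binseq measure \<Rightarrow> (nat \<Rightarrow> binseq \<Rightarrow> 'u \<times> 'u \<Rightarrow> 'u \<times> 'u) \<Rightarrow> nat \<Rightarrow>
     (binseq \<Rightarrow> 'u \<times> 'u) \<Rightarrow> binseq \<Rightarrow> 'u::real_vector \<times> 'u" where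
  "J'_std \<mu> c k f x =
     cx_scale ((- 1) ^ (\<Sum>j\<le>k. of_bool (x j)))
       (c k x (sqrt_RN \<mu> (translate \<mu> (delta k)) x *\<^sub>R f (x \<oplus> delta k)))"

text \<open>The antilinear involution whose fixed vectors form the standard real form
  \<open>{f. cx_cnj (f x) = sqrt_RN \<mu> (flip_measure \<mu>) x *\<^sub>R f (flip x) almost everywhere}\<close>.\<close>

definition S_std :: "binseq measure \<Rightarrow> (binseq \<Rightarrow> 'u \<times> 'u) \<Rightarrow> binseq \<Rightarrow> 'u::real_vector \<times> 'u" where
  "S_std \<mu> f x = cx_cnj (sqrt_RN \<mu> (flip_measure \<mu>) x *\<^sub>R f (flip x))"

definition in_standard_form ::
    "(nat \<Rightarrow> 'h::real_inner) \<Rightarrow> (nat \<Rightarrow> 'h) \<Rightarrow> binseq measure \<Rightarrow>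
     (binseq \<Rightarrow> 'u::{real_inner, complete_space, second_countable_topology} set) \<Rightarrow>
     (nat \<Rightarrow> binseq \<Rightarrow> 'u \<times> 'u \<Rightarrow> 'u \<times> 'u) \<Rightarrow>
     ('h clifford \<Rightarrow> (binseq \<Rightarrow> 'u \<times> 'u) \<Rightarrow> (binseq \<Rightarrow> 'u \<times> 'u)) \<Rightarrow> bool" where
  "in_standard_form e e' \<mu> U c \<rho> \<longleftrightarrow>
     standard_form_data \<mu> U c \<and>
     unitary_rep (direct_integral \<mu> U) \<rho> \<and>
     (\<forall>k. \<forall>f\<in>Carr (direct_integral \<mu> U). AE x in \<mu>. \<rho> (gen (e k)) f x = J_std \<mu> c k f x) \<and>
     (\<forall>k. \<forall>f\<in>Carr (direct_integral \<mu> U). AE x in \<mu>. \<rho> (gen (e' k)) f x = J'_std \<mu> c k f x) \<and>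
     invariant_real_structure e e' (direct_integral \<mu> U) \<rho> (S_std \<mu>)"


section \<open>The real Hilbert space of square summable sequences\<close>

typedef ell2 = "{x :: nat \<Rightarrow> real. summable (\<lambda>n. (x n)\<^sup>2)}"
  morphisms seq_of Abs_ell2
  by (rule exI[of _ "\<lambda>_. 0"]) simp

setup_lifting type_definition_ell2

lemma summable_ell2_mult:
  fixes x y :: "nat \<Rightarrow> real"
  assumes "summable (\<lambda>n. (x n)\<^sup>2)" "summable (\<lambda>n. (y n)\<^sup>2)"
  shows "summable (\<lambda>n. x n * y n)"
proof (rule summable_comparison_test_ev)
  show "summable (\<lambda>n. (x n)\<^sup>2 + (y n)\<^sup>2)" using assms by (rule summable_add)
  have "\<bar>a * b\<bar> \<le> a\<^sup>2 + b\<^sup>2" for a b :: real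
  proof -
    have "0 \<le> (\<bar>a\<bar> - \<bar>b\<bar>)\<^sup>2" by simp
    then have "2 * (\<bar>a\<bar> * \<bar>b\<bar>) \<le> a\<^sup>2 + b\<^sup>2" by (simp add: power2_diff)
    moreover have "0 \<le> \<bar>a\<bar> * \<bar>b\<bar>" by simp
    ultimately show ?thesis by (simp only: abs_mult)
  qed
  then show "\<forall>\<^sub>F n in sequentially. norm (x n * y n) \<le> (x n)\<^sup>2 + (y n)\<^sup>2" by simp
qed

lemma summable_ell2_add:
  fixes x y :: "nat \<Rightarrow> real"
  assumes "summable (\<lambda>n. (x n)\<^sup>2)" "summable (\<lambda>n. (y n)\<^sup>2)"
  shows "summable (\<lambda>n. (x n + y n)\<^sup>2)"
  using summable_add[OF summable_add[OF assms] summable_mult[OF summable_ell2_mult[OF assms], of 2]]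
  by (simp add: power2_sum algebra_simps)

instantiation ell2 :: real_vector
begin

lift_definition zero_ell2 :: ell2 is "\<lambda>_. 0" by simp
lift_definition plus_ell2 :: "ell2 \<Rightarrow> ell2 \<Rightarrow> ell2" is "\<lambda>x y n. x n + y n"
  by (rule summable_ell2_add)
lift_definition uminus_ell2 :: "ell2 \<Rightarrow> ell2" is "\<lambda>x n. - x n" by simp
definition minus_ell2 :: "ell2 \<Rightarrow> ell2 \<Rightarrow> ell2" where "minus_ell2 x y = x + - y"
lift_definition scaleR_ell2 :: "real \<Rightarrow> ell2 \<Rightarrow> ell2" is "\<lambda>r x n. r * x n"
  by (simp add: power_mult_distrib summable_mult)

instance
proof
  fix x y z :: ell2 and r s :: real
  show "x + y + z = x + (y + z)" by transfer (simp add: algebra_simps)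
  show "x + y = y + x" by transfer (simp add: algebra_simps)
  show "0 + x = x" by transfer simp
  show "- x + x = 0" by transfer simp
  show "x - y = x + - y" by (rule minus_ell2_def)
  show "r *\<^sub>R (x + y) = r *\<^sub>R x + r *\<^sub>R y" by transfer (simp add: algebra_simps)
  show "(r + s) *\<^sub>R x = r *\<^sub>R x + s *\<^sub>R x" by transfer (simp add: algebra_simps)
  show "r *\<^sub>R s *\<^sub>R x = (r * s) *\<^sub>R x" by transfer (simp add: algebra_simps)
  show "1 *\<^sub>R x = x" by transfer simp
qed

end

instantiation ell2 :: real_inner
begin

lift_definition inner_ell2 :: "ell2 \<Rightarrow> ell2 \<Rightarrow> real" is "\<lambda>x y. \<Sum>n. x n * y n" .
definition norm_ell2 :: "ell2 \<Rightarrow> real" where "norm_ell2 x = sqrt (inner x x)"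
definition sgn_ell2 :: "ell2 \<Rightarrow> ell2" where "sgn_ell2 x = x /\<^sub>R norm x"
definition dist_ell2 :: "ell2 \<Rightarrow> ell2 \<Rightarrow> real" where "dist_ell2 x y = norm (x - y)"
definition uniformity_ell2 :: "(ell2 \<times> ell2) filter"
  where "uniformity_ell2 = (INF e\<in>{0 <..}. principal {(x, y). dist x y < e})"
definition open_ell2 :: "ell2 set \<Rightarrow> bool"
  where "open_ell2 S = (\<forall>x\<in>S. \<forall>\<^sub>F (x', y) in uniformity. x' = x \<longrightarrow> y \<in> S)"

instance
proof
  fix x y z :: ell2 and r s :: real
  show "sgn x = x /\<^sub>R norm x" by (rule sgn_ell2_def)
  show "dist x y = norm (x - y)" by (rule dist_ell2_def)
  show "inner x y = inner y x" by transfer (simp add: mult.commute)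
  show "inner (x + y) z = inner x z + inner y z"
    by transfer (simp only: distrib_right suminf_add summable_ell2_mult)
  show "inner (r *\<^sub>R x) y = r * inner x y"
    by transfer (simp only: mult.assoc suminf_mult summable_ell2_mult)
  have inner_self: "inner x x = (\<Sum>n. (seq_of x n)\<^sup>2)"
    unfolding inner_ell2.rep_eq power2_eq_square ..
  have summable: "summable (\<lambda>n. (seq_of x n)\<^sup>2)" using seq_of by simp
  show "0 \<le> inner x x"
    unfolding inner_self by (rule suminf_nonneg[OF summable]) (rule zero_le_power2)
  have "inner x x = 0 \<longleftrightarrow> (\<forall>n. (seq_of x n)\<^sup>2 = 0)"
    unfolding inner_self by (rule suminf_eq_zero_iff[OF summable]) (rule zero_le_power2)
  also have "\<dots> \<longleftrightarrow> x = 0"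
    by (simp add: zero_ell2.rep_eq fun_eq_iff flip: seq_of_inject)
  finally show "inner x x = 0 \<longleftrightarrow> x = 0" .
  show "norm x = sqrt (inner x x)" by (rule norm_ell2_def)
qed (simp_all add: uniformity_ell2_def open_ell2_def)

end

lemma summable_seq_of: "summable (\<lambda>n. (seq_of x n)\<^sup>2)"
  using seq_of by simp

lemma seq_of_diff: "seq_of (x - y) n = seq_of x n - seq_of y n"
  unfolding minus_ell2_def plus_ell2.rep_eq uminus_ell2.rep_eq by simp

lemma norm_ell2_sq: "(norm (x :: ell2))\<^sup>2 = (\<Sum>n. (seq_of x n)\<^sup>2)"
  by (subst power2_norm_eq_inner) (simp only: inner_ell2.rep_eq power2_eq_square)

lemma sum_le_norm_ell2: "(\<Sum>n<N. (seq_of x n)\<^sup>2) \<le> (norm x)\<^sup>2"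
  unfolding norm_ell2_sq by (rule sum_le_suminf) (auto intro: summable_seq_of)

lemma abs_seq_of_le: "\<bar>seq_of x n\<bar> \<le> norm x"
proof -
  have "(seq_of x n)\<^sup>2 \<le> (\<Sum>k<Suc n. (seq_of x k)\<^sup>2)" by (rule member_le_sum) auto
  also have "\<dots> \<le> (norm x)\<^sup>2" by (rule sum_le_norm_ell2)
  finally show ?thesis by (simp only: flip: abs_le_square_iff) simp
qed

lemma ell2_bounded_partial_sums:
  fixes f :: "nat \<Rightarrow> real"
  assumes "\<And>N. (\<Sum>n<N. (f n)\<^sup>2) \<le> e\<^sup>2" "0 \<le> e"
  obtains x where "seq_of x = f" "norm x \<le> e"
proof -
  have sm: "summable (\<lambda>n. (f n)\<^sup>2)"
    by (rule bounded_imp_summable[of _ "e\<^sup>2"]) (use assms(1)[of "Suc _"] in \<open>auto simp: lessThan_Suc_atMost\<close>)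
  then have f: "seq_of (Abs_ell2 f) = f" by (simp add: Abs_ell2_inverse)
  have "(norm (Abs_ell2 f))\<^sup>2 \<le> e\<^sup>2"
    unfolding norm_ell2_sq f by (rule suminf_le_const[OF sm assms(1)])
  then show thesis using that[OF f] assms(2) by (simp add: power2_le_iff_abs_le)
qed

instance ell2 :: complete_space
proof
  fix X :: "nat \<Rightarrow> ell2"
  assume X: "Cauchy X"
  have "Cauchy (\<lambda>m. seq_of (X m) n)" for n
  proof (rule metric_CauchyI)
    fix e :: real assume "0 < e"
    then obtain M where M: "\<forall>m\<ge>M. \<forall>k\<ge>M. dist (X m) (X k) < e"
      using X unfolding Cauchy_def by blast
    have "dist (seq_of (X m) n) (seq_of (X k) n) \<le> dist (X m) (X k)" for m k
      using abs_seq_of_le[of "X m - X k" n] by (simp add: seq_of_diff dist_norm)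
    then show "\<exists>M. \<forall>m\<ge>M. \<forall>k\<ge>M. dist (seq_of (X m) n) (seq_of (X k) n) < e"
      using M by (meson le_less_trans)
  qed
  then have "\<exists>l. (\<lambda>m. seq_of (X m) n) \<longlonglongrightarrow> l" for n
    by (simp add: Cauchy_convergent_iff convergent_def)
  then obtain L where L: "\<And>n. (\<lambda>m. seq_of (X m) n) \<longlonglongrightarrow> L n" by metis
  have *: "\<exists>M. \<forall>m\<ge>M. \<exists>d. seq_of d = (\<lambda>n. seq_of (X m) n - L n) \<and> norm d \<le> e" if e: "0 < e" for e :: real
  proof -
    obtain M where M: "\<forall>m\<ge>M. \<forall>k\<ge>M. dist (X m) (X k) < e"
      using X e unfolding Cauchy_def by blast
    have "\<exists>d. seq_of d = (\<lambda>n. seq_of (X m) n - L n) \<and> norm d \<le> e" if m: "M \<le> m" for m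
    proof -
      have "(\<Sum>n<N. (seq_of (X m) n - L n)\<^sup>2) \<le> e\<^sup>2" for N
      proof (rule LIMSEQ_le_const2)
        show "(\<lambda>k. \<Sum>n<N. (seq_of (X m) n - seq_of (X k) n)\<^sup>2) \<longlonglongrightarrow> (\<Sum>n<N. (seq_of (X m) n - L n)\<^sup>2)"
          by (intro tendsto_intros L)
        have "(\<Sum>n<N. (seq_of (X m) n - seq_of (X k) n)\<^sup>2) \<le> e\<^sup>2" if "M \<le> k" for k
        proof -
          have "(\<Sum>n<N. (seq_of (X m) n - seq_of (X k) n)\<^sup>2) \<le> (norm (X m - X k))\<^sup>2"
            using sum_le_norm_ell2[of "X m - X k" N] by (simp add: seq_of_diff)
          also have "\<dots> \<le> e\<^sup>2"
            using M m that by (intro power_mono) (auto simp: dist_norm intro: less_imp_le)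
          finally show ?thesis .
        qed
        then show "\<exists>K. \<forall>k\<ge>K. (\<Sum>n<N. (seq_of (X m) n - seq_of (X k) n)\<^sup>2) \<le> e\<^sup>2" by blast
      qed
      then show ?thesis using e by (metis ell2_bounded_partial_sums less_imp_le)
    qed
    then show ?thesis by blast
  qed
  obtain m d where d: "seq_of d = (\<lambda>n. seq_of (X m) n - L n)"
    using *[of 1] by auto
  define l where "l = X m - d"
  have l: "seq_of l = L" by (simp add: l_def seq_of_diff d fun_eq_iff)
  have "X \<longlonglongrightarrow> l"
  proof (rule metric_LIMSEQ_I)
    fix e :: real assume "0 < e"
    then obtain M where M: "\<forall>m\<ge>M. \<exists>d. seq_of d = (\<lambda>n. seq_of (X m) n - L n) \<and> norm d \<le> e / 2"
      using *[of "e / 2"] by auto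
    have "dist (X m) l < e" if "M \<le> m" for m
    proof -
      obtain d where d: "seq_of d = (\<lambda>n. seq_of (X m) n - L n)" "norm d \<le> e / 2"
        using M \<open>M \<le> m\<close> by blast
      have "seq_of (X m - l) = seq_of d" by (simp add: seq_of_diff l d(1) fun_eq_iff)
      then have "X m - l = d" by (simp add: seq_of_inject)
      then show ?thesis using d(2) \<open>0 < e\<close> by (simp add: dist_norm)
    qed
    then show "\<exists>M. \<forall>m\<ge>M. dist (X m) l < e" by blast
  qed
  then show "convergent X" by (auto simp: convergent_def)
qed

lift_definition ell2_of_list :: "rat list \<Rightarrow> ell2"
  is "\<lambda>qs n. if n < length qs then real_of_rat (qs ! n) else 0"
  by (rule summable_finite[of "{..<length _}"]) auto

lemma ell2_of_list_dense:
  assumes "0 < e"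
  shows "\<exists>qs. dist x (ell2_of_list qs) < e"
proof -
  have e: "0 < e\<^sup>2 / 2" using assms by simp
  obtain N where N: "norm (\<Sum>n. (seq_of x (n + N))\<^sup>2) < e\<^sup>2 / 2"
    using suminf_exist_split[OF e summable_seq_of[of x]] by auto
  define r where "r = sqrt (e\<^sup>2 / (2 * (real N + 1)))"
  have r: "0 < r" "r\<^sup>2 = e\<^sup>2 / (2 * (real N + 1))" using assms by (auto simp: r_def)
  have "\<exists>q. \<bar>seq_of x n - real_of_rat q\<bar> < r" for n
  proof -
    obtain q where "seq_of x n - r < real_of_rat q" "real_of_rat q < seq_of x n + r"
      using of_rat_dense[of "seq_of x n - r" "seq_of x n + r"] r(1) by auto
    then show ?thesis by (intro exI[of _ q]) (simp add: abs_less_iff)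
  qed
  then obtain q where q: "\<And>n. \<bar>seq_of x n - real_of_rat (q n)\<bar> < r" by metis
  define y where "y = ell2_of_list (map q [0..<N])"
  have y: "seq_of y n = (if n < N then real_of_rat (q n) else 0)" for n
    by (simp add: y_def ell2_of_list.rep_eq)
  have "(\<Sum>n<N. (seq_of (x - y) n)\<^sup>2) \<le> (\<Sum>n<N. r\<^sup>2)"
  proof (rule sum_mono)
    fix n assume "n \<in> {..<N}"
    then have "\<bar>seq_of (x - y) n\<bar> \<le> \<bar>r\<bar>" using q[of n] r(1) by (simp add: seq_of_diff y)
    then show "(seq_of (x - y) n)\<^sup>2 \<le> r\<^sup>2" by (simp add: abs_le_square_iff)
  qed
  also have "\<dots> = real N * (e\<^sup>2 / (2 * (real N + 1)))" by (simp add: r(2))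
  also have "\<dots> \<le> e\<^sup>2 / 2" by (simp add: field_simps)
  finally have A: "(\<Sum>n<N. (seq_of (x - y) n)\<^sup>2) \<le> e\<^sup>2 / 2" .
  have "(norm (x - y))\<^sup>2 = (\<Sum>n. (seq_of (x - y) (n + N))\<^sup>2) + (\<Sum>n<N. (seq_of (x - y) n)\<^sup>2)"
    unfolding norm_ell2_sq by (rule suminf_split_initial_segment[OF summable_seq_of])
  also have "(\<Sum>n. (seq_of (x - y) (n + N))\<^sup>2) = (\<Sum>n. (seq_of x (n + N))\<^sup>2)"
    by (simp add: seq_of_diff y)
  finally have "(norm (x - y))\<^sup>2 < e\<^sup>2" using A N by simp
  then have "dist x y < e" using assms by (simp add: dist_norm power2_less_imp_less)
  then show ?thesis unfolding y_def by blast
qed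

instance ell2 :: second_countable_topology
proof
  let ?B = "(\<lambda>(qs, n). ball (ell2_of_list qs) (1 / real (Suc n))) ` (UNIV :: (rat list \<times> nat) set)"
  have "topological_basis ?B"
  proof (rule topological_basisI)
    fix S and x :: ell2
    assume "open S" "x \<in> S"
    then obtain e where e: "0 < e" "ball x e \<subseteq> S" by (auto simp: open_contains_ball)
    from e(1) have "0 < e / 2" by simp
    then obtain n where n: "1 / real (Suc n) < e / 2" by (rule nat_approx_posE)
    obtain qs where qs: "dist x (ell2_of_list qs) < 1 / real (Suc n)"
      using ell2_of_list_dense[of "1 / real (Suc n)" x] by auto
    have "ball (ell2_of_list qs) (1 / real (Suc n)) \<subseteq> ball x e"
    proof
      fix y assume "y \<in> ball (ell2_of_list qs) (1 / real (Suc n))"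
      then show "y \<in> ball x e"
        using qs n dist_triangle[of x y "ell2_of_list qs"]
        unfolding mem_ball by linarith
    qed
    then show "\<exists>B'\<in>?B. x \<in> B' \<and> B' \<subseteq> S"
      using qs e(2)
      by (intro bexI[of _ "ball (ell2_of_list qs) (1 / real (Suc n))"] conjI image_eqI[of _ _ "(qs, n)"])
        (simp_all add: dist_commute subset_trans)
  qed (auto simp only: open_ball)
  then show "\<exists>B :: ell2 set set. countable B \<and> open = generate_topology B"
    by (intro exI[of _ ?B] conjI topological_basis_imp_subbasis countable_image countableI_type)
qed

end

theory Submission
  imports Defs
begin

text \<open>The operators \<open>N\<^sub>k = - i J\<^sub>k J'\<^sub>k\<close> are commuting symmetries, and their joint spectrum is the
  group of binary sequences.  \<open>J\<^sub>k\<close> anticommutes with \<open>N\<^sub>k\<close> and commutes with the other \<open>N\<^sub>l\<close>, so on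
  the spectrum it acts as translation by \<open>\<delta>\<^sup>k\<close>, while the antilinear \<open>S\<close> anticommutes with every
  \<open>N\<^sub>k\<close> and acts as the flip.  All spectral information is kept in scalar form: every vector \<open>v\<close> has a
  spectral measure, and the real bilinear form of the densities of these measures with respect to a
  fixed one replaces the projection valued measure.

  Gram--Schmidt inside the real form \<open>{v. S v = v}\<close> gives vectors \<open>u\<^sub>n\<close> with \<open>S u\<^sub>n = u\<^sub>n\<close> whose
  cyclic subspaces are orthogonal and span the space.  The coefficients of \<open>v\<close> with respect to the
  \<open>u\<^sub>n\<close>, taken pointwise on the spectrum and renumbered so that the indices with nonzero density
  become \<open>0, 1, \<dots>\<close>, form the transform \<open>T v\<close>.  As the \<open>u\<^sub>n\<close> are \<open>S\<close>-invariant, \<open>T\<close> turns \<open>S\<close> into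
  conjugation followed by the flip, with no cocycle left to remove, and the measure is flip-invariant.
  Comparing densities shows that \<open>J\<^sub>k\<close> becomes a pointwise isometry followed by translation; the
  Clifford relations then say exactly that these isometries satisfy the identities of the \<open>c\<^sub>k\<close>.\<close>

section \<open>Closed subspaces and orthogonal series\<close>

text \<open>The standard form asks for identities of operators on whole fibers, while each fact
  about the spectrum holds only off a null set and uncountably many null sets cannot be discarded.
  So fiber operators are compared on countably many vectors \<open>W j\<close> whose transforms are
  basis fields, and identities spread by linearity and continuity; parameters run over rationals or
  finite bit lists.

  The space is treated as a real Hilbert space with the extra operator \<i>. The cyclic vectors
  \<open>u n\<close> and their multiples by \<i> form one real orthogonal system, and the two real
  coefficients of a vector are exactly the pair that represents an element of the complexification.

  Equality of fibers along orbits is not automatic, as \<open>J k\<close> does not respect the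
  system \<open>u n\<close>. It is reduced to dimensions and derived from orthonormal families whose
  size is the multiplicity at the translated point.

  The operator \<open>c k\<close> is \<i> times a sign times the isometry \<open>B k\<close>. These
  constants cancel those in \<open>J_std\<close> and also turn square \<open>- 1\<close> into
  \<open>1\<close>, anticommutation into commutation, and produce the sign in the conjugation
  identity.\<close>

instance complex_hilbert \<subseteq> banach ..

instance ell2 :: banach ..

text \<open>The representing vector minimizes \<open>\<phi> v = (norm v)\<^sup>2 - 2 * F v\<close>:
  the parallelogram law makes minimizing sequences Cauchy, and the first variation at the minimum
  gives \<open>F v = inner v u\<close>. Both orthogonal projections and the surjectivity of the
  transform rest on it.\<close>

lemma riesz_on_closed_subspace:
  fixes F :: "'v::{real_inner,complete_space} \<Rightarrow> real"
  assumes M: "subspace M" "closed M" and F: "linear F" and C: "\<And>v. v \<in> M \<Longrightarrow> \<bar>F v\<bar> \<le> C * norm v"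
  obtains u where "u \<in> M" "\<And>v. v \<in> M \<Longrightarrow> F v = inner v u"
proof -
  define \<phi> where "\<phi> v = (norm v)\<^sup>2 - 2 * F v" for v
  define m where "m = Inf (\<phi> ` M)"
  have Fadd: "F (a + b) = F a + F b" and Fdiff: "F (a - b) = F a - F b" and Fsc: "F (r *\<^sub>R a) = r * F a" for a b r
    using F by (simp_all add: linear_add linear_diff linear_scale)
  have low: "- C\<^sup>2 \<le> \<phi> v" if "v \<in> M" for v
  proof -
    have "0 \<le> (norm v - C)\<^sup>2" by simp
    then show ?thesis using C[OF that] by (simp add: \<phi>_def power2_diff abs_le_iff algebra_simps)
  qed
  have bdd: "bdd_below (\<phi> ` M)" using low by (auto intro!: bdd_belowI[of _ "- C\<^sup>2"])
  have ne: "\<phi> ` M \<noteq> {}" using subspace_0[OF M(1)] by blast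
  have m_le: "m \<le> \<phi> v" if "v \<in> M" for v
    unfolding m_def using that bdd by (intro cInf_lower) auto
  have "\<exists>v\<in>M. \<phi> v < m + 1 / real (Suc n)" for n
  proof -
    have "Inf (\<phi> ` M) < m + 1 / real (Suc n)" by (simp add: m_def)
    from cInf_lessD[OF ne this] show ?thesis by auto
  qed
  then obtain V where V: "\<And>n. V n \<in> M" "\<And>n. \<phi> (V n) < m + 1 / real (Suc n)" by metis
  have dist_sq: "(norm (V n - V k))\<^sup>2 \<le> 2 * (1 / real (Suc n)) + 2 * (1 / real (Suc k))" for n k
  proof -
    \<comment> \<open>The midpoint lies in \<open>M\<close>, so its value is at least
      \<open>m\<close>; the parallelogram law turns this into a bound on the distance of
      \<open>V n\<close> and \<open>V k\<close>.\<close>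
    define h where "h = (1/2) *\<^sub>R (V n + V k)"
    have "h \<in> M" unfolding h_def using V(1) M(1) by (simp add: subspace_add subspace_scale)
    then have "4 * m \<le> 4 * \<phi> h" using m_le by simp
    moreover have "4 * \<phi> h = (norm (V n + V k))\<^sup>2 - 4 * (F (V n) + F (V k))"
    proof -
      have "norm h = norm (V n + V k) / 2" "F h = (F (V n) + F (V k)) / 2"
        by (simp_all add: h_def Fsc Fadd del: scaleR_add_right)
      then show ?thesis by (simp only: \<phi>_def power_divide) (simp add: field_simps)
    qed
    moreover have "(norm (V n - V k))\<^sup>2 + (norm (V n + V k))\<^sup>2 = 2 * (norm (V n))\<^sup>2 + 2 * (norm (V k))\<^sup>2"
      by (simp add: power2_norm_eq_inner inner_add inner_diff inner_commute)
    moreover have "\<phi> (V n) < m + 1 / real (Suc n)" "\<phi> (V k) < m + 1 / real (Suc k)" using V(2) by auto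
    moreover have "\<phi> (V n) = (norm (V n))\<^sup>2 - 2 * F (V n)" "\<phi> (V k) = (norm (V k))\<^sup>2 - 2 * F (V k)"
      by (simp_all add: \<phi>_def)
    ultimately show ?thesis by argo
  qed
  have "Cauchy V"
  proof (rule metric_CauchyI)
    fix e :: real assume e: "0 < e"
    then have "0 < e\<^sup>2 / 4" by simp
    then obtain N where N: "1 / real (Suc N) < e\<^sup>2 / 4" by (rule nat_approx_posE)
    have "dist (V n) (V k) < e" if "N \<le> n" "N \<le> k" for n k
    proof -
      have "1 / real (Suc n) \<le> 1 / real (Suc N)" "1 / real (Suc k) \<le> 1 / real (Suc N)"
        using that by (auto intro!: divide_left_mono)
      then have "(norm (V n - V k))\<^sup>2 < e\<^sup>2" using dist_sq[of n k] N by linarith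
      then show ?thesis using e by (simp add: dist_norm power2_less_imp_less)
    qed
    then show "\<exists>N. \<forall>n\<ge>N. \<forall>k\<ge>N. dist (V n) (V k) < e" by blast
  qed
  then obtain u where u: "V \<longlonglongrightarrow> u" by (auto simp: Cauchy_convergent_iff convergent_def)
  have uM: "u \<in> M" using closed_sequentially[OF M(2) V(1) u] .
  have "(\<lambda>n. F (V n) - F u) \<longlonglongrightarrow> 0"
  proof (rule Lim_null_comparison)
    show "\<forall>\<^sub>F n in sequentially. norm (F (V n) - F u) \<le> C * norm (V n - u)"
      using C[of "V _ - u"] V(1) uM M(1) by (simp add: Fdiff subspace_diff)
    have "(\<lambda>n. C * norm (V n - u)) \<longlonglongrightarrow> C * norm (u - u)" by (intro tendsto_intros u)
    then show "(\<lambda>n. C * norm (V n - u)) \<longlonglongrightarrow> 0" by simp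
  qed
  then have "(\<lambda>n. F (V n)) \<longlonglongrightarrow> F u" by (rule LIM_zero_cancel)
  then have "(\<lambda>n. \<phi> (V n)) \<longlonglongrightarrow> \<phi> u" unfolding \<phi>_def by (intro tendsto_intros u)
  moreover have "(\<lambda>n. m + 1 / real (Suc n)) \<longlonglongrightarrow> m + 0"
    by (intro tendsto_intros LIMSEQ_Suc lim_1_over_n)
  ultimately have "\<phi> u \<le> m + 0" using V(2) by (intro LIMSEQ_le) (auto intro: less_imp_le)
  then have min: "\<phi> u \<le> \<phi> v" if "v \<in> M" for v using m_le[OF that] by simp
  have "F v = inner v u" if v: "v \<in> M" for v
  proof (rule ccontr)
    assume "F v \<noteq> inner v u"
    define a where "a = inner v u - F v"
    \<comment> \<open>The optimal step would divide by \<open>(norm v)\<^sup>2\<close>; the added 1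
      avoids the case \<open>v = 0\<close> and still yields a strictly negative change.\<close>
    define r where "r = (norm v)\<^sup>2 + 1"
    define t where "t = - a / r"
    have a: "a \<noteq> 0" using \<open>F v \<noteq> inner v u\<close> by (simp add: a_def)
    have r: "0 < r" by (simp add: r_def add_nonneg_pos)
    have "\<phi> u \<le> \<phi> (u + t *\<^sub>R v)" using uM v M(1) by (intro min subspace_add subspace_scale)
    moreover have "(norm (u + t *\<^sub>R v))\<^sup>2 = (norm u)\<^sup>2 + 2 * t * inner v u + t\<^sup>2 * (norm v)\<^sup>2"
      by (simp add: power2_norm_eq_inner inner_add inner_commute power2_eq_square[of t] algebra_simps)
    ultimately have "0 \<le> 2 * t * a + t\<^sup>2 * (norm v)\<^sup>2"
      by (simp add: \<phi>_def a_def Fadd Fsc algebra_simps)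
    also have "\<dots> = - ((a / r)\<^sup>2 * (r + 1))"
      using r by (simp add: t_def r_def[symmetric] field_simps power2_eq_square) (simp add: r_def power2_eq_square algebra_simps)
    also have "\<dots> < 0" using a r by simp
    finally show False by simp
  qed
  then show thesis using uM that by blast
qed

lemma closed_subspace_projection:
  fixes d :: "'v::{real_inner,complete_space}"
  assumes "subspace M" "closed M"
  obtains p where "p \<in> M" "\<And>v. v \<in> M \<Longrightarrow> inner v (d - p) = 0"
proof -
  have "linear (\<lambda>v. inner v d)" by (simp add: bounded_linear.linear bounded_linear_inner_left)
  moreover have "\<bar>inner v d\<bar> \<le> norm d * norm v" for v
    using Cauchy_Schwarz_ineq2[of v d] by (simp add: mult.commute)
  ultimately obtain u where "u \<in> M" "\<And>v. v \<in> M \<Longrightarrow> inner v d = inner v u"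
    using riesz_on_closed_subspace[OF assms] by metis
  then show thesis using that by (simp add: inner_diff_right)
qed

lemma orthogonal_series:
  fixes f :: "nat \<Rightarrow> 'b::{real_inner,banach}"
  assumes orth: "\<And>i j. i \<noteq> j \<Longrightarrow> inner (f i) (f j) = 0" and sm: "summable (\<lambda>i. (norm (f i))\<^sup>2)"
  shows "summable f" "(norm (suminf f))\<^sup>2 = (\<Sum>i. (norm (f i))\<^sup>2)"
proof -
  have pyth: "(norm (sum f I))\<^sup>2 = (\<Sum>i\<in>I. (norm (f i))\<^sup>2)" if "finite I" for I
    using that by (intro norm_sum_Pythagorean) (auto simp: pairwise_def orthogonal_def orth)
  show f: "summable f"
    unfolding summable_Cauchy
  proof (intro allI impI)
    fix e :: real assume e: "0 < e"
    then have "0 < e\<^sup>2" by simp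
    then obtain N where N: "\<forall>m\<ge>N. \<forall>n. norm (\<Sum>i\<in>{m..<n}. (norm (f i))\<^sup>2) < e\<^sup>2"
      using sm unfolding summable_Cauchy by blast
    have "norm (sum f {m..<n}) < e" if "N \<le> m" for m n
    proof -
      have "(norm (sum f {m..<n}))\<^sup>2 < e\<^sup>2"
        using N that by (metis pyth finite_atLeastLessThan real_norm_def abs_of_nonneg zero_le_power2)
      then show ?thesis using e by (simp add: power2_less_imp_less)
    qed
    then show "\<exists>N. \<forall>m\<ge>N. \<forall>n. norm (sum f {m..<n}) < e" by blast
  qed
  have "(\<lambda>n. (norm (sum f {..<n}))\<^sup>2) \<longlonglongrightarrow> (norm (suminf f))\<^sup>2"
    by (intro tendsto_intros summable_LIMSEQ f)
  moreover have "(\<lambda>n. (norm (sum f {..<n}))\<^sup>2) \<longlonglongrightarrow> (\<Sum>i. (norm (f i))\<^sup>2)"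
    using summable_LIMSEQ[OF sm] by (simp add: pyth)
  ultimately show "(norm (suminf f))\<^sup>2 = (\<Sum>i. (norm (f i))\<^sup>2)" by (rule LIMSEQ_unique)
qed

text \<open>Rational \<open>t\<close> are used because the inequality will hold off a null set for
  each single \<open>t\<close>, and only countably many such sets may be united. Density of the
  rationals restores all real \<open>t\<close>.\<close>

lemma quadratic_nonneg_discriminant:
  fixes a b c :: real
  assumes pos: "\<And>t. t \<in> \<rat> \<Longrightarrow> 0 \<le> a + 2 * t * b + t\<^sup>2 * c"
  shows "b\<^sup>2 \<le> a * c"
proof -
  have "closed {t. 0 \<le> a + 2 * t * b + t\<^sup>2 * c}"
    by (intro closed_Collect_le continuous_intros)
  then have "closure \<rat> \<subseteq> {t. 0 \<le> a + 2 * t * b + t\<^sup>2 * c}"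
    by (intro closure_minimal) (use pos in auto)
  then have pos: "0 \<le> a + 2 * t * b + t\<^sup>2 * c" for t by (auto simp: Rats_closure_real)
  show ?thesis
  proof (cases "c = 0")
    case True
    have "b = 0"
    proof (rule ccontr)
      assume "b \<noteq> 0"
      then show False using pos[of "- (a + 1) / (2 * b)"] True by (simp add: field_simps)
    qed
    then show ?thesis using True by simp
  next
    case False
    have "0 < c"
    proof (rule ccontr)
      assume "\<not> 0 < c"
      then have c: "c < 0" using False by simp
      \<comment> \<open>For negative \<open>c\<close> the quadratic term outweighs the rest at this
        \<open>t\<close>; \<open>1 \<le> t\<close> lets \<open>t * \<bar>a\<bar>\<close> absorb the
        constant term.\<close>
      define t where "t = max 1 ((\<bar>a\<bar> + 2 * \<bar>b\<bar> + 1) / - c)"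
      have t: "1 \<le> t" "(\<bar>a\<bar> + 2 * \<bar>b\<bar> + 1) / - c \<le> t" by (auto simp: t_def)
      then have "\<bar>a\<bar> + 2 * \<bar>b\<bar> + 1 \<le> t * - c" using c by (subst (asm) pos_divide_le_eq) auto
      then have "t * (\<bar>a\<bar> + 2 * \<bar>b\<bar> + 1) \<le> t * (t * - c)" using t(1) by (intro mult_left_mono) auto
      then have "t * \<bar>a\<bar> + 2 * (t * \<bar>b\<bar>) + t \<le> - (t\<^sup>2 * c)" by (simp add: algebra_simps power2_eq_square)
      moreover have "1 * \<bar>a\<bar> \<le> t * \<bar>a\<bar>" using t(1) by (intro mult_right_mono) auto
      moreover have "t * b \<le> t * \<bar>b\<bar>" using t(1) by (intro mult_left_mono) auto
      ultimately show False using pos[of t] t(1) abs_ge_self[of a] by linarith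
    qed
    then show ?thesis using pos[of "- b / c"] by (simp add: field_simps power2_eq_square)
  qed
qed

section \<open>Measures on the space of binary sequences\<close>

text \<open>Second countability of the factor lets Borel measurability of maps into binary sequences
  be checked on coordinates.\<close>

instance bool :: second_countable_topology
proof
  have "open = generate_topology (UNIV :: bool set set)"
    by (intro ext iffI) (auto intro: generate_topology.Basis open_discrete)
  then show "\<exists>B :: bool set set. countable B \<and> open = generate_topology B"
    by (intro exI[of _ UNIV]) auto
qed

section \<open>Cylinder sets as generators of the Borel algebra\<close>

definition cyl :: "binseq \<Rightarrow> nat \<Rightarrow> binseq set" where
  "cyl x n = {y. \<forall>i<n. y i = x i}"

lemma borel_coord [measurable]: "(\<lambda>y :: binseq. y i) \<in> borel_measurable borel"
  by (intro borel_measurable_continuous_onI continuous_on_coordinatewise_then_product continuous_on_product_coordinates)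

lemma measurable_bool_borel: "measurable M (borel :: bool measure) = measurable M (count_space UNIV)"
  by (rule measurable_cong_sets) (auto simp: borel_open open_discrete)

lemma pred_coord [measurable]: "Measurable.pred borel (\<lambda>y :: binseq. y i)"
  using borel_coord unfolding measurable_bool_borel .

lemma measurable_binseqI:
  assumes "\<And>i. Measurable.pred M (\<lambda>y. f y i)"
  shows "f \<in> measurable M (borel :: binseq measure)"
  by (rule measurable_coordinatewise_then_product) (use assms in \<open>simp add: measurable_bool_borel\<close>)

lemma cyl_borel [measurable]: "cyl x n \<in> sets borel"
  unfolding cyl_def by measurable

text \<open>The empty set is included because incompatible cylinders are disjoint, and the family
  has to be stable under intersection.\<close>

definition cylinders :: "binseq set set" where
  "cylinders = insert {} (range (\<lambda>(x, n). cyl x n))"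

lemma cylinders_Int_stable: "Int_stable cylinders"
proof (rule Int_stableI)
  have *: "cyl x n \<inter> cyl y m \<in> cylinders" if "n \<le> m" for x y n m
  proof (cases "\<forall>i<n. y i = x i")
    case True
    then have "cyl x n \<inter> cyl y m = cyl y m" using that by (force simp: cyl_def)
    then show ?thesis by (auto simp: cylinders_def)
  next
    case False
    then have "cyl x n \<inter> cyl y m = {}" using that by (force simp: cyl_def)
    then show ?thesis by (auto simp: cylinders_def)
  qed
  fix a b assume "a \<in> cylinders" "b \<in> cylinders"
  then consider "a = {} \<or> b = {}" | x n y m where "a = cyl x n" "b = cyl y m"
    by (auto simp: cylinders_def)
  then show "a \<inter> b \<in> cylinders"
  proof cases
    case 1 then show ?thesis by (auto simp: cylinders_def)
  next
    case 2 then show ?thesis using *[of n m x y] *[of m n y x] by (cases "n \<le> m") (auto simp: Int_commute)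
  qed
qed

lemma sets_borel_eq_cylinders: "sets (borel :: binseq measure) = sigma_sets UNIV cylinders"
proof (rule antisym)
  show "sigma_sets UNIV cylinders \<subseteq> sets (borel :: binseq measure)"
  proof -
    have "cylinders \<subseteq> sets borel" by (auto simp: cylinders_def)
    from sets.sigma_sets_subset[OF this] show ?thesis by simp
  qed
  let ?S = "sigma UNIV cylinders"
  have S: "sets ?S = sigma_sets UNIV cylinders" "space ?S = UNIV" by (auto intro: sets_measure_of space_measure_of)
  have cylS: "cyl x n \<in> sets ?S" for x n unfolding S by (auto simp: cylinders_def)
  have "(\<lambda>y. y) \<in> measurable ?S (borel :: binseq measure)"
  proof (rule measurable_binseqI)
    fix i
    \<comment> \<open>The union runs over finite bit lists, a countable type; only the entries up to
      \<open>i\<close> matter for the cylinder.\<close>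
    have "{y \<in> space ?S. y i} = (\<Union>xs\<in>{xs. xs ! i}. cyl (\<lambda>j. xs ! j) (Suc i))" (is "_ = ?R")
    proof (rule antisym)
      show "?R \<subseteq> {y \<in> space ?S. y i}" by (auto simp: cyl_def S)
      show "{y \<in> space ?S. y i} \<subseteq> ?R"
      proof
        fix y assume "y \<in> {y \<in> space ?S. y i}"
        then have "y \<in> cyl (\<lambda>j. map y [0..<Suc i] ! j) (Suc i)" "map y [0..<Suc i] ! i"
          by (auto simp: cyl_def simp del: upt_Suc)
        then show "y \<in> ?R" by blast
      qed
    qed
    also have "\<dots> \<in> sets ?S" by (rule sets.countable_UN'') (auto intro: cylS simp del: sets_measure_of)
    finally show "Measurable.pred ?S (\<lambda>y. y i)" by (simp add: pred_def)
  qed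
  from measurable_sets[OF this] have "A \<in> sets ?S" if "A \<in> sets (borel :: binseq measure)" for A
    using that S(2) by (metis Int_UNIV_right vimage_ident)
  then show "sets (borel :: binseq measure) \<subseteq> sigma_sets UNIV cylinders" unfolding S by blast
qed

lemma cyl_0: "cyl x 0 = UNIV" by (simp add: cyl_def)

lemma measure_eqI_cyl:
  assumes "sets M = sets borel" "sets N = sets borel" "finite_measure M" "finite_measure N"
    and eq: "\<And>x n. measure M (cyl x n) = measure N (cyl x n)"
  shows "M = N"
proof (rule measure_eqI_generator_eq[OF cylinders_Int_stable, where \<Omega> = UNIV and A = "\<lambda>_. UNIV"])
  interpret M: finite_measure M by fact
  interpret N: finite_measure N by fact
  show "emeasure M X = emeasure N X" if "X \<in> cylinders" for X
    using that eq by (auto simp: cylinders_def M.emeasure_eq_measure N.emeasure_eq_measure)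
  show "emeasure M UNIV \<noteq> \<infinity>" by (simp add: M.emeasure_eq_measure)
  show "range (\<lambda>_. UNIV) \<subseteq> cylinders" by (auto simp: cylinders_def intro!: image_eqI[of _ _ "(_, 0)"] simp: cyl_0)
qed (use assms in \<open>auto simp: sets_borel_eq_cylinders\<close>)

text \<open>A Dynkin class argument extends equality of integrals from cylinders to Borel sets, and
  these integrals determine an integrable function. This device turns scalar identities between
  inner products into pointwise identities on the spectrum.\<close>

lemma AE_eq_cyl:
  fixes f g :: "binseq \<Rightarrow> real"
  assumes M: "sets M = sets borel" and fg: "integrable M f" "integrable M g"
    and eq: "\<And>x n. (LINT y:cyl x n|M. f y) = (LINT y:cyl x n|M. g y)"
  shows "AE y in M. f y = g y"
proof (rule density_unique_real[OF fg])
  note [measurable_cong] = M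
  have sM: "space M = UNIV" using sets_eq_imp_space_eq[OF M] by simp
  have si: "set_integrable M A h" if "A \<in> sets M" "integrable M h" for A and h :: "binseq \<Rightarrow> real"
    unfolding set_integrable_def using that by (rule integrable_mult_indicator)
  fix A assume "A \<in> sets M"
  then have "A \<in> sigma_sets UNIV cylinders" by (simp add: M sets_borel_eq_cylinders)
  from cylinders_Int_stable subset_UNIV[of cylinders, folded Pow_UNIV] this show "(LINT y:A|M. f y) = (LINT y:A|M. g y)"
  proof (induction rule: sigma_sets_induct_disjoint)
    case (basic A) then show ?case using eq by (auto simp: cylinders_def set_lebesgue_integral_def)
  next
    case empty then show ?case by (simp add: set_lebesgue_integral_def)
  next
    case (compl A)
    then have A: "A \<in> sets M" by (simp add: M sets_borel_eq_cylinders)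
    have UN: "(LINT y:UNIV|M. h y) = (LINT y:A|M. h y) + (LINT y:UNIV - A|M. h y)"
      if "integrable M h" for h :: "binseq \<Rightarrow> real"
    proof -
      have "(LINT y:A \<union> (UNIV - A)|M. h y) = (LINT y:A|M. h y) + (LINT y:UNIV - A|M. h y)"
        using that sM sets.compl_sets[OF A] by (intro set_integral_Un si A) auto
      then show ?thesis by simp
    qed
    show ?case using UN[OF fg(1)] UN[OF fg(2)] compl(2) eq[of undefined 0] by (simp add: cyl_0)
  next
    case (union A)
    then have A: "A i \<in> sets M" for i by (auto simp: M sets_borel_eq_cylinders)
    have U: "(\<Union>i. A i) \<in> sets M" using A by auto
    have "A i \<inter> A j = {}" if "i \<noteq> j" for i j using union(1) that by (auto simp: disjoint_family_on_def)
    then show ?case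
      using lebesgue_integral_countable_add[of A M f, OF A _ si[OF U fg(1)]]
        lebesgue_integral_countable_add[of A M g, OF A _ si[OF U fg(2)]] union(3) by simp
  qed
qed

section \<open>Measures with prescribed cylinder masses\<close>

primrec tree_bits :: "nat \<Rightarrow> (bool list \<Rightarrow> real) \<Rightarrow> real \<Rightarrow> bool" where
  "tree_bits 0 m t = (m [False] \<le> t)"
| "tree_bits (Suc n) m t =
     (if m [False] \<le> t then tree_bits n (\<lambda>l. m (True # l)) (t - m [False])
      else tree_bits n (\<lambda>l. m (False # l)) t)"

lemma tree_bits_measurable [measurable]: "Measurable.pred borel (tree_bits n m)"
proof (induction n arbitrary: m)
  case 0 then show ?case by simp
next
  case (Suc n)
  note Suc[measurable]
  show ?case by simp
qed

text \<open>\<open>tree_bits\<close> reads off the address of \<open>t\<close> when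
  \<open>[0, m [])\<close> is cut at \<open>m [False]\<close> and each piece is cut again in the
  same way. Every node of the tree thus owns a half-open interval of length its mass; the induction
  passes to the masses below the first bit.\<close>

lemma tree_bits_interval:
  assumes "\<And>l. 0 \<le> m l" "\<And>l. m l = m (l @ [False]) + m (l @ [True])"
  shows "\<exists>a. {t. 0 \<le> t \<and> t < m [] \<and> (\<forall>i<length xs. tree_bits i m t = xs ! i)} = {a..<a + m xs}"
  using assms
proof (induction xs arbitrary: m)
  case Nil
  show ?case by (intro exI[of _ 0]) auto
next
  case (Cons b xs)
  have m0: "m [] = m [False] + m [True]" using Cons.prems(2)[of "[]"] by simp
  have ge0: "0 \<le> m [False]" "0 \<le> m [True]" using Cons.prems(1) by auto
  let ?m = "\<lambda>l. m (b # l)"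
  obtain a where a: "{t. 0 \<le> t \<and> t < ?m [] \<and> (\<forall>i<length xs. tree_bits i ?m t = xs ! i)} = {a..<a + ?m xs}"
  proof -
    have "?m l = ?m (l @ [False]) + ?m (l @ [True])" for l using Cons.prems(2)[of "b # l"] by simp
    from Cons.IH[OF _ this] Cons.prems(1) that show thesis by blast
  qed
  have all: "(\<forall>i<length (b # xs). tree_bits i m t = (b # xs) ! i) \<longleftrightarrow>
      (m [False] \<le> t) = b \<and> (\<forall>i<length xs. tree_bits (Suc i) m t = xs ! i)" for t
    by (simp add: All_less_Suc2)
  show ?case
  proof (cases b)
    case False
    have "{t. 0 \<le> t \<and> t < m [] \<and> (\<forall>i<length (b # xs). tree_bits i m t = (b # xs) ! i)} = {a..<a + ?m xs}"
      unfolding a[symmetric] all using False ge0 m0 by auto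
    then show ?thesis by blast
  next
    case True
    have "{t. 0 \<le> t \<and> t < m [] \<and> (\<forall>i<length (b # xs). tree_bits i m t = (b # xs) ! i)} =
      {t. t - m [False] \<in> {a..<a + ?m xs}}"
      unfolding a[symmetric] all using True ge0 m0 by auto
    also have "\<dots> = {a + m [False]..<a + m [False] + ?m xs}" by auto
    finally show ?thesis by blast
  qed
qed

text \<open>The measure is the image of Lebesgue measure on \<open>[0, m [])\<close> under the
  address map.\<close>

lemma tree_measure:
  fixes m :: "bool list \<Rightarrow> real"
  assumes m: "\<And>l. 0 \<le> m l" "\<And>l. m l = m (l @ [False]) + m (l @ [True])"
  obtains M :: "binseq measure" where "sets M = sets borel" "finite_measure M"
    "\<And>x n. measure M (cyl x n) = m (map x [0..<n])"
proof -
  let ?L = "restrict_space lborel {0..<m []}"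
  let ?f = "\<lambda>t i. tree_bits i m t"
  have f: "?f \<in> measurable ?L borel"
    by (intro measurable_binseqI measurable_restrict_space1) simp
  let ?M = "distr ?L borel ?f"
  have em: "emeasure ?M (cyl x n) = m (map x [0..<n])" for x n
  proof -
    obtain a where a: "{t. 0 \<le> t \<and> t < m [] \<and> (\<forall>i<n. tree_bits i m t = map x [0..<n] ! i)} = {a..<a + m (map x [0..<n])}"
      using tree_bits_interval[OF m, of "map x [0..<n]"] by auto
    have "?f -` cyl x n \<inter> space ?L = {a..<a + m (map x [0..<n])}"
      unfolding a[symmetric] by (auto simp: cyl_def space_restrict_space)
    moreover have "{a..<a + m (map x [0..<n])} \<subseteq> {0..<m []}" unfolding a[symmetric] by auto
    ultimately show ?thesis
      using m(1) by (simp add: emeasure_distr[OF f] emeasure_restrict_space)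
  qed
  show thesis
  proof
    show "finite_measure ?M" using em[of _ 0] by (intro finite_measureI) (simp add: cyl_0)
    show "measure ?M (cyl x n) = m (map x [0..<n])" for x n
      using em[of x n] m(1) by (simp add: measure_def)
  qed simp
qed

section \<open>Joint spectral measures of commuting symmetries\<close>

text \<open>The coefficients may be negative, so uniqueness of measures does not apply directly; the
  signed combination is carried through the Dynkin induction itself.\<close>

lemma measure_comb_zero:
  fixes c :: "'i \<Rightarrow> real" and M :: "'i \<Rightarrow> binseq measure"
  assumes I: "finite I" and M: "\<And>i. i \<in> I \<Longrightarrow> sets (M i) = sets borel" "\<And>i. i \<in> I \<Longrightarrow> finite_measure (M i)"
    and eq: "\<And>x n. (\<Sum>i\<in>I. c i * measure (M i) (cyl x n)) = 0"
    and A: "A \<in> sets borel"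
  shows "(\<Sum>i\<in>I. c i * measure (M i) A) = 0"
proof -
  have sp: "space (M i) = UNIV" if "i \<in> I" for i using sets_eq_imp_space_eq[OF M(1)[OF that]] by simp
  have "A \<in> sigma_sets UNIV cylinders" using A by (simp add: sets_borel_eq_cylinders)
  from cylinders_Int_stable subset_UNIV[of cylinders, folded Pow_UNIV] this show ?thesis
  proof (induction rule: sigma_sets_induct_disjoint)
    case (basic A)
    then consider "A = {}" | x n where "A = cyl x n" by (auto simp: cylinders_def)
    then show ?case by cases (simp_all add: eq)
  next
    case empty show ?case by simp
  next
    case (compl A)
    then have A: "A \<in> sets borel" by (simp add: sets_borel_eq_cylinders)
    have "(\<Sum>i\<in>I. c i * measure (M i) (UNIV - A)) = (\<Sum>i\<in>I. c i * measure (M i) UNIV - c i * measure (M i) A)"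
    proof (rule sum.cong)
      fix i assume i: "i \<in> I"
      interpret finite_measure "M i" by (rule M(2)[OF i])
      show "c i * measure (M i) (UNIV - A) = c i * measure (M i) UNIV - c i * measure (M i) A"
        using finite_measure_compl[of A] A M(1)[OF i] sp[OF i] by (simp add: right_diff_distrib)
    qed simp
    also have "\<dots> = 0" using eq[of undefined 0] compl(2) by (simp add: sum_subtractf cyl_0)
    finally show ?case .
  next
    case (union A)
    then have A: "A i \<in> sets borel" for i by (auto simp: sets_borel_eq_cylinders)
    have "(\<lambda>n. measure (M i) (A n)) sums measure (M i) (\<Union>n. A n)" if i: "i \<in> I" for i
    proof -
      interpret finite_measure "M i" by (rule M(2)[OF i])
      show ?thesis using A M(1)[OF i] union(1) by (intro finite_measure_UNION) auto
    qed
    then have "(\<lambda>n. \<Sum>i\<in>I. c i * measure (M i) (A n)) sums (\<Sum>i\<in>I. c i * measure (M i) (\<Union>n. A n))"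
      by (intro sums_sum sums_mult)
    then have "(\<lambda>n. 0) sums (\<Sum>i\<in>I. c i * measure (M i) (\<Union>n. A n))" using union(3) by simp
    then show ?case using sums_unique2[OF sums_zero] by metis
  qed
qed

lemma linear_norm_preserving_inner:
  assumes "linear A" "\<And>v. norm (A v) = norm v"
  shows "inner (A v) (A w) = inner v w"
  by (simp add: dot_norm assms linear_add[OF assms(1), symmetric])

locale symmetries =
  fixes N :: "nat \<Rightarrow> 'v::{real_inner,banach} \<Rightarrow> 'v"
  assumes N_linear: "linear (N k)" and N_N [simp]: "N k (N k v) = v"
    and N_norm: "norm (N k v) = norm v" and N_comm: "N k (N l v) = N l (N k v)"
begin

lemma N_add: "N k (v + w) = N k v + N k w" by (rule linear_add[OF N_linear])
lemma N_diff: "N k (v - w) = N k v - N k w" by (rule linear_diff[OF N_linear])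
lemma N_scaleR: "N k (r *\<^sub>R v) = r *\<^sub>R N k v" by (rule linear_scale[OF N_linear])
lemma N_minus: "N k (- v) = - N k v" by (rule linear_neg[OF N_linear])

lemma N_selfadj: "inner (N k v) w = inner v (N k w)"
  using linear_norm_preserving_inner[OF N_linear N_norm, of k v "N k w"] by simp

section \<open>Eigenprojections and their products over prefixes\<close>

definition P :: "nat \<Rightarrow> bool \<Rightarrow> 'v \<Rightarrow> 'v" where
  "P k b v = (1/2) *\<^sub>R (v + (if b then - N k v else N k v))"

lemma P_linear: "linear (P k b)"
  by (rule linearI) (auto simp: P_def N_add N_scaleR algebra_simps)

lemma P_selfadj: "inner (P k b v) w = inner v (P k b w)"
  by (simp add: P_def inner_add N_selfadj)

lemma P_idem: "P k b (P k c v) = (if b = c then P k b v else 0)"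
proof -
  have "(1/4) *\<^sub>R x + (1/4) *\<^sub>R x = (1/2) *\<^sub>R x" "(1/4) *\<^sub>R x + ((1/4) *\<^sub>R x + y) = (1/2) *\<^sub>R x + y" for x y :: 'v
    by (simp_all flip: scaleR_left_distrib add.assoc)
  then show ?thesis
    by (cases b; cases c) (simp_all add: P_def N_add N_diff N_scaleR N_minus algebra_simps)
qed

lemma P_comm: "P k b (P l c v) = P l c (P k b v)"
  by (simp add: P_def N_add N_diff N_scaleR N_minus N_comm[of k l] algebra_simps)

lemma P_sum: "P k False v + P k True v = v"
proof -
  have "(1/2) *\<^sub>R v + (1/2) *\<^sub>R v = v" by (simp flip: scaleR_left_distrib)
  then show ?thesis by (simp add: P_def scaleR_diff_right scaleR_add_right)
qed

text \<open>The value \<open>True\<close> of a coordinate corresponds to the eigenvalue \<open>- 1\<close>.\<close>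

primrec Q :: "binseq \<Rightarrow> nat \<Rightarrow> 'v \<Rightarrow> 'v" where
  "Q x 0 v = v"
| "Q x (Suc n) v = P n (x n) (Q x n v)"

lemma Q_linear: "linear (Q x n)"
proof (induction n)
  case 0 show ?case by (simp add: linear_id[unfolded id_def])
next
  case (Suc n) show ?case using linear_compose[OF Suc P_linear[of n "x n"]] by (simp add: o_def)
qed

lemma Q_add: "Q x n (v + w) = Q x n v + Q x n w" by (rule linear_add[OF Q_linear])
lemma Q_diff: "Q x n (v - w) = Q x n v - Q x n w" by (rule linear_diff[OF Q_linear])
lemma Q_scaleR: "Q x n (r *\<^sub>R v) = r *\<^sub>R Q x n v" by (rule linear_scale[OF Q_linear])

lemma P_Q: "P k b (Q x n v) = Q x n (P k b v)"
  by (induction n) (auto simp: P_comm[of k])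

lemma Q_selfadj: "inner (Q x n v) w = inner v (Q x n w)"
  by (induction n arbitrary: v w) (auto simp: P_selfadj P_Q)

lemma Q_comm: "Q x n (Q y m v) = Q y m (Q x n v)"
  by (induction n) (auto simp: P_Q)

lemma Q_cong: "(\<And>i. i < n \<Longrightarrow> x i = y i) \<Longrightarrow> Q x n v = Q y n v"
  by (induction n) auto

text \<open>These projections multiply like indicator functions of cylinders: the longer prefix
  already contains every factor of a compatible shorter one, and a conflicting bit brings together
  two complementary eigenprojections.\<close>

lemma Q_Q: "n \<le> m \<Longrightarrow> Q x n (Q y m v) = (if y \<in> cyl x n then Q y m v else 0)"
proof (induction n)
  case 0 show ?case by (simp add: cyl_0)
next
  case (Suc n)
  have "P n b (Q y m v) = (if b = y n then Q y m v else 0)" for b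
  proof -
    have "Q y m v = Q y m (P n (y n) v)" using Suc.prems
    proof (induction m)
      case (Suc m)
      show ?case
      proof (cases "n = m")
        case True
        then show ?thesis by (simp add: P_Q P_idem)
      next
        case False
        then show ?thesis using Suc by (simp add: P_Q)
      qed
    qed simp
    then have "P n b (Q y m v) = Q y m (P n b (P n (y n) v))" by (metis P_Q)
    also have "\<dots> = (if b = y n then Q y m (P n (y n) v) else 0)" by (simp add: P_idem linear_0[OF Q_linear])
    finally show ?thesis using \<open>Q y m v = Q y m (P n (y n) v)\<close> by simp
  qed
  then show ?case using Suc by (auto simp: cyl_def less_Suc_eq linear_0[OF P_linear])
qed

lemma Q_idem [simp]: "Q x n (Q x n v) = Q x n v"
  by (simp add: Q_Q cyl_def)

lemma norm_Q_sq: "(norm (Q x n v))\<^sup>2 = inner (Q x n v) v"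
  using Q_selfadj[of x n "Q x n v" v] by (simp add: power2_norm_eq_inner)

lemma norm_Q_le: "norm (Q x n v) \<le> norm v"
proof -
  have "(norm (Q x n v))\<^sup>2 \<le> norm (Q x n v) * norm v" unfolding norm_Q_sq by (rule norm_cauchy_schwarz)
  then show ?thesis by (cases "norm (Q x n v) = 0") (simp_all add: power2_eq_square)
qed

section \<open>Spectral measures of vectors\<close>

lemma spec_ex: "\<exists>M. sets M = sets borel \<and> finite_measure M \<and> (\<forall>x n. measure M (cyl x n) = (norm (Q x n v))\<^sup>2)"
proof -
  \<comment> \<open>The masses are additive along the tree because the two eigenprojections of
    \<open>N k\<close> are complementary and orthogonal. Only the first \<open>length xs\<close>
    values of \<open>\<lambda>i. xs ! i\<close> enter.\<close>
  define m where "m xs = (norm (Q (\<lambda>i. xs ! i) (length xs) v))\<^sup>2" for xs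
  have "m l = m (l @ [False]) + m (l @ [True])" for l
  proof -
    have Ql: "Q (\<lambda>i. (l @ ys) ! i) (length l) v = Q (\<lambda>i. l ! i) (length l) v" for ys
      by (rule Q_cong) (simp add: nth_append)
    have "inner (P (length l) False u) u + inner (P (length l) True u) u = inner u u" for u
      using P_sum[of "length l" u] by (metis inner_add_left)
    moreover have "inner (P k b u) (P k b u) = inner (P k b u) u" for k b u
      using P_selfadj[of k b "P k b u" u] by (simp add: P_idem)
    ultimately show ?thesis by (simp add: m_def Ql power2_norm_eq_inner)
  qed
  moreover have "0 \<le> m l" for l by (simp add: m_def)
  ultimately have split: "\<And>l. m l = m (l @ [False]) + m (l @ [True])" and nonneg: "\<And>l. 0 \<le> m l" by blast+
  obtain M where M: "sets M = sets borel" "finite_measure M" "\<And>x n. measure M (cyl x n) = m (map x [0..<n])"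
    by (rule tree_measure[of m, OF nonneg split]) blast
  have "m (map x [0..<n]) = (norm (Q x n v))\<^sup>2" for x n
    unfolding m_def using Q_cong[of n "\<lambda>i. map x [0..<n] ! i" x v] by simp
  then show ?thesis using M by auto
qed

definition spec :: "'v \<Rightarrow> binseq measure" where
  "spec v = (SOME M. sets M = sets borel \<and> finite_measure M \<and> (\<forall>x n. measure M (cyl x n) = (norm (Q x n v))\<^sup>2))"

lemma spec: "sets (spec v) = sets borel" "finite_measure (spec v)"
    "measure (spec v) (cyl x n) = (norm (Q x n v))\<^sup>2"
  using someI_ex[OF spec_ex[of v]] unfolding spec_def by auto

lemma space_spec [simp]: "space (spec v) = UNIV"
  using sets_eq_imp_space_eq[OF spec(1)] by simp

lemma spec_eqI:
  assumes "sets M = sets borel" "finite_measure M" "\<And>x n. measure M (cyl x n) = (norm (Q x n v))\<^sup>2"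
  shows "spec v = M"
  using assms spec by (intro measure_eqI_cyl) auto

lemma spec_parallelogram:
  assumes "A \<in> sets borel"
  shows "measure (spec (v + w)) A + measure (spec (v - w)) A = 2 * measure (spec v) A + 2 * measure (spec w) A"
proof -
  have "(norm (Q x n (v + w)))\<^sup>2 + (norm (Q x n (v - w)))\<^sup>2 = 2 * (norm (Q x n v))\<^sup>2 + 2 * (norm (Q x n w))\<^sup>2" for x n
    by (simp add: Q_add Q_diff power2_norm_eq_inner inner_add inner_diff inner_commute)
  then have "(\<Sum>i<4. [1, 1, - 2, - 2] ! i * measure (spec ([v + w, v - w, v, w] ! i)) (cyl x n)) = 0" for x n
    using spec by (simp add: lessThan_nat_numeral lessThan_Suc algebra_simps)
  from measure_comb_zero[OF _ _ _ this assms]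
  have "(\<Sum>i<4. [1, 1, - 2, - 2] ! i * measure (spec ([v + w, v - w, v, w] ! i)) A) = 0" by (simp add: spec)
  then show ?thesis by (simp add: lessThan_nat_numeral lessThan_Suc algebra_simps)
qed

lemma spec_scaleR:
  assumes "A \<in> sets borel"
  shows "measure (spec (r *\<^sub>R v)) A = r\<^sup>2 * measure (spec v) A"
  using measure_comb_zero[of "{..<2}" "\<lambda>i. spec ([r *\<^sub>R v, v] ! i)" "\<lambda>i. [1, - r\<^sup>2] ! i" A] assms
  by (simp add: spec Q_scaleR power_mult_distrib lessThan_nat_numeral lessThan_Suc)

text \<open>The hypothesis says that \<open>w\<close> is orthogonal to the cyclic subspace of
  \<open>v\<close>, so the cross terms vanish on every cylinder.\<close>

lemma spec_orthogonal_add: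
  assumes "A \<in> sets borel" and orth: "\<And>x n. inner (Q x n v) w = 0"
  shows "measure (spec (v + w)) A = measure (spec v) A + measure (spec w) A"
proof -
  have "(norm (Q x n (v + w)))\<^sup>2 = (norm (Q x n v))\<^sup>2 + (norm (Q x n w))\<^sup>2" for x n
  proof -
    have "inner (Q x n v) (Q x n w) = inner (Q x n v) w" using Q_selfadj[of x n "Q x n v" w] by simp
    then show ?thesis using orth[of x n]
      by (simp add: Q_add power2_norm_eq_inner inner_add inner_commute[of "Q x n w" "Q x n v"])
  qed
  then show ?thesis
    using measure_comb_zero[of "{..<3}" "\<lambda>i. spec ([v + w, v, w] ! i)" "\<lambda>i. [1, - 1, - 1] ! i" A] assms(1)
    by (simp add: spec lessThan_nat_numeral lessThan_Suc)
qed

text \<open>These vectors form the kernel of the spectral projection of \<open>A\<close>, described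
  without constructing that projection. For closedness, the parallelogram identity bounds the
  measure at a limit by twice the squared distance to the sequence.\<close>

lemma spec_null_subspace:
  assumes A: "A \<in> sets borel"
  shows "subspace {v. measure (spec v) A = 0}" "closed {v. measure (spec v) A = 0}"
    "measure (spec v) A = 0 \<Longrightarrow> measure (spec (Q x n v)) A = 0"
proof -
  have add: "measure (spec (v + w)) A \<le> 2 * measure (spec v) A + 2 * measure (spec w) A" for v w
    using spec_parallelogram[OF A, of v w] measure_nonneg[of "spec (v - w)" A] by linarith
  have le: "measure (spec v) A \<le> (norm v)\<^sup>2" for v
  proof -
    interpret finite_measure "spec v" by (rule spec)
    have "measure (spec v) A \<le> measure (spec v) UNIV" using A by (intro finite_measure_mono) (auto simp: spec)
    then show ?thesis using spec(3)[of v undefined 0] by (simp add: cyl_0)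
  qed
  have nn: "measure (spec v) A \<le> 0 \<Longrightarrow> measure (spec v) A = 0" for v
    using measure_nonneg[of "spec v" A] by linarith
  show "subspace {v. measure (spec v) A = 0}"
  proof (rule subspaceI)
    show "0 \<in> {v. measure (spec v) A = 0}" using le[of 0] nn by simp
    show "v + w \<in> {v. measure (spec v) A = 0}" if "v \<in> {v. measure (spec v) A = 0}" "w \<in> {v. measure (spec v) A = 0}" for v w
      using add[of v w] that nn by simp
    show "c *\<^sub>R v \<in> {v. measure (spec v) A = 0}" if "v \<in> {v. measure (spec v) A = 0}" for v c
      using that by (simp add: spec_scaleR[OF A])
  qed
  show "closed {v. measure (spec v) A = 0}"
    unfolding closed_sequential_limits
  proof (intro allI impI, elim conjE)
    fix V l assume V: "\<forall>n. V n \<in> {v. measure (spec v) A = 0}" "V \<longlonglongrightarrow> l"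
    have "(\<lambda>n. 2 * (norm (l - V n))\<^sup>2) \<longlonglongrightarrow> 2 * (norm (l - l))\<^sup>2" by (intro tendsto_intros V)
    moreover have "measure (spec l) A \<le> 2 * (norm (l - V n))\<^sup>2" for n
      using add[of "V n" "l - V n"] le[of "l - V n"] V(1) by simp
    ultimately have "measure (spec l) A \<le> 2 * (norm (l - l))\<^sup>2"
      using LIMSEQ_le_const by blast
    then show "l \<in> {v. measure (spec v) A = 0}" using nn by simp
  qed
  show "measure (spec v) A = 0 \<Longrightarrow> measure (spec (Q x n v)) A = 0"
  proof -
    \<comment> \<open>The two parts of \<open>v\<close> generate orthogonal cyclic subspaces, so
      their spectral measures add up to that of \<open>v\<close>.\<close>
    have "inner (Q y m (Q x n v)) (v - Q x n v) = 0" for y m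
      by (subst Q_comm) (simp add: Q_selfadj[of x n] Q_diff)
    from spec_orthogonal_add[OF A this] have "measure (spec v) A = measure (spec (Q x n v)) A + measure (spec (v - Q x n v)) A"
      by simp
    then show "measure (spec v) A = 0 \<Longrightarrow> measure (spec (Q x n v)) A = 0"
      using measure_nonneg[of "spec (Q x n v)" A] measure_nonneg[of "spec (v - Q x n v)" A] by linarith
  qed
qed

end

section \<open>Spectral densities\<close>

lemma real_density_ex:
  assumes "finite_measure M" "finite_measure N" "sets N = sets M" "absolutely_continuous M N"
  shows "\<exists>D :: 'a \<Rightarrow> real. integrable M D \<and> (\<forall>x. 0 \<le> D x) \<and> (\<forall>A\<in>sets M. (LINT y:A|M. D y) = measure N A)"
proof -
  interpret M: finite_measure M by fact
  interpret N: finite_measure N by fact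
  obtain D where D: "D \<in> borel_measurable M" "AE x in M. RN_deriv M N x = ennreal (D x)" "\<And>x. 0 \<le> D x"
    using M.real_RN_deriv[OF assms(2,4,3)] by blast
  have "density M (\<lambda>x. ennreal (D x)) = density M (RN_deriv M N)"
    using D by (intro density_cong) auto
  also have "\<dots> = N" by (rule M.density_RN_deriv[OF assms(4,3)])
  finally have N: "N = density M (\<lambda>x. ennreal (D x))" by simp
  have em: "(\<integral>\<^sup>+x. ennreal (indicator A x * D x) \<partial>M) = emeasure N A" if "A \<in> sets M" for A
  proof -
    have "emeasure N A = (\<integral>\<^sup>+x. ennreal (D x) * indicator A x \<partial>M)"
      unfolding N using D(1) that by (intro emeasure_density) auto
    also have "\<dots> = (\<integral>\<^sup>+x. ennreal (indicator A x * D x) \<partial>M)"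
      by (intro nn_integral_cong) (auto simp: indicator_def)
    finally show ?thesis by simp
  qed
  have fin: "integrable M (\<lambda>x. indicator A x * D x)" if A: "A \<in> sets M" for A
    using em[OF A] D A N.emeasure_finite by (intro integrableI_nonneg) (auto simp: top.not_eq_extremum[symmetric])
  have "integrable M D" using fin[OF sets.top] by (rule Bochner_Integration.integrable_cong[THEN iffD1, rotated -1]) auto
  moreover have "(LINT y:A|M. D y) = measure N A" if A: "A \<in> sets M" for A
  proof -
    have "ennreal (\<integral>x. indicator A x * D x \<partial>M) = emeasure N A"
      unfolding em[OF A, symmetric] using fin[OF A] D(3) by (intro nn_integral_eq_integral[symmetric]) auto
    then have "enn2real (ennreal (\<integral>x. indicator A x * D x \<partial>M)) = measure N A" by (simp add: measure_def)
    moreover have "0 \<le> (\<integral>x. indicator A x * D x \<partial>M)" using D(3) by (intro integral_nonneg_AE) auto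
    ultimately show ?thesis by (simp add: set_lebesgue_integral_def)
  qed
  ultimately show ?thesis using D(3) by blast
qed

lemma set_integrable_of_integrable:
  fixes f :: "'a \<Rightarrow> real"
  shows "integrable M f \<Longrightarrow> A \<in> sets M \<Longrightarrow> set_integrable M A f"
  unfolding set_integrable_def by (rule integrable_mult_indicator)

locale spectral_densities = symmetries N for N :: "nat \<Rightarrow> 'v::{real_inner,banach} \<Rightarrow> 'v" +
  fixes e0 :: 'v
  assumes ac: "absolutely_continuous (spec e0) (spec v)"
begin

definition M :: "binseq measure" where "M = spec e0"

lemma sets_M [simp, measurable_cong]: "sets M = sets borel" by (simp add: M_def spec)
lemma space_M [simp]: "space M = UNIV" by (simp add: M_def)
lemma finite_M: "finite_measure M" by (simp add: M_def spec)

sublocale M: finite_measure M by (rule finite_M)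

lemma quadratic_density_ex:
  "\<exists>D. integrable M D \<and> (\<forall>x. 0 \<le> D x) \<and> (\<forall>A\<in>sets M. (LINT y:A|M. D y) = measure (spec v) A)"
  by (rule real_density_ex) (auto simp: spec finite_M ac M_def)

text \<open>Only quadratic densities come from measures; the bilinear one is their
  polarization.\<close>

lemma density_ex:
  "\<exists>f. integrable M f \<and> (\<forall>x n. (LINT y:cyl x n|M. f y) = inner (Q x n v) u)"
proof -
  obtain D1 where D1: "integrable M D1" "\<And>A. A \<in> sets M \<Longrightarrow> (LINT y:A|M. D1 y) = measure (spec (v + u)) A"
    using quadratic_density_ex[of "v + u"] by blast
  obtain D2 where D2: "integrable M D2" "\<And>A. A \<in> sets M \<Longrightarrow> (LINT y:A|M. D2 y) = measure (spec (v - u)) A"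
    using quadratic_density_ex[of "v - u"] by blast
  have "(LINT y:cyl x n|M. (1/4) * (D1 y - D2 y)) = inner (Q x n v) u" for x n
  proof -
    have "(LINT y:cyl x n|M. (1/4) * (D1 y - D2 y)) = (1/4) * ((norm (Q x n (v + u)))\<^sup>2 - (norm (Q x n (v - u)))\<^sup>2)"
      using D1 D2 by (simp add: set_integral_diff set_integrable_of_integrable spec)
    also have "\<dots> = inner (Q x n v) u"
      unfolding norm_Q_sq using Q_selfadj[of x n u v]
      by (simp add: Q_add Q_diff inner_add inner_diff inner_commute[of u])
    finally show ?thesis .
  qed
  moreover have "integrable M (\<lambda>y. (1/4) * (D1 y - D2 y))" using D1(1) D2(1) by simp
  ultimately show ?thesis by blast
qed

text \<open>This is the density of the signed measure \<open>A \<mapsto> inner (E A v) u\<close>,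
  where \<open>E\<close> is the projection valued measure that is never formed. The choice is
  determined up to a null set, so all identities between densities hold almost everywhere.\<close>

definition dens :: "'v \<Rightarrow> 'v \<Rightarrow> binseq \<Rightarrow> real" where
  "dens v u = (SOME f. integrable M f \<and> (\<forall>x n. (LINT y:cyl x n|M. f y) = inner (Q x n v) u))"

lemma dens_integrable [intro, simp]: "integrable M (dens v u)"
  and dens_LINT: "(LINT y:cyl x n|M. dens v u y) = inner (Q x n v) u"
  using someI_ex[OF density_ex[of v u]] unfolding dens_def by auto

lemma dens_measurable [measurable]: "dens v u \<in> borel_measurable borel"
  using borel_measurable_integrable[OF dens_integrable[of v u]] by simp

lemma dens_integral: "(\<integral>y. dens v u y \<partial>M) = inner v u"
  using dens_LINT[where n = 0] by (simp add: cyl_0 set_lebesgue_integral_def)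

lemma dens_eqI:
  assumes "integrable M f" "\<And>x n. (LINT y:cyl x n|M. f y) = inner (Q x n v) u"
  shows "AE y in M. dens v u y = f y"
  using assms by (intro AE_eq_cyl) (auto simp: dens_LINT)

lemma dens_cong:
  assumes "\<And>x n. inner (Q x n v) u = inner (Q x n v') u'"
  shows "AE y in M. dens v u y = dens v' u' y"
  using assms by (intro dens_eqI) (auto simp: dens_LINT)

lemma dens_orth:
  assumes "\<And>x n. inner (Q x n v) u = 0"
  shows "AE y in M. dens v u y = 0"
  using assms by (intro dens_eqI) auto

lemma dens_add: "AE y in M. dens (v + v') u y = dens v u y + dens v' u y"
  by (intro dens_eqI) (auto simp: set_integral_add set_integrable_of_integrable dens_LINT Q_add inner_add)

lemma dens_diff: "AE y in M. dens (v - v') u y = dens v u y - dens v' u y"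
  by (intro dens_eqI) (auto simp: set_integral_diff set_integrable_of_integrable dens_LINT Q_diff inner_diff)

lemma dens_scaleR: "AE y in M. dens (r *\<^sub>R v) u y = r * dens v u y"
  by (intro dens_eqI) (auto simp: dens_LINT Q_scaleR)

lemma dens_commute: "AE y in M. dens v u y = dens u v y"
  using Q_selfadj by (intro dens_cong) (metis inner_commute)

lemma dens_expand: "AE y in M. dens (v + r *\<^sub>R u) (v + r *\<^sub>R u) y = dens v v y + 2 * r * dens v u y + r\<^sup>2 * dens u u y"
proof (intro dens_eqI)
  show "(LINT y:cyl x n|M. dens v v y + 2 * r * dens v u y + r\<^sup>2 * dens u u y) =
     inner (Q x n (v + r *\<^sub>R u)) (v + r *\<^sub>R u)" for x n
    using Q_selfadj[of x n u v]
    by (simp add: set_integral_add set_integrable_of_integrable dens_LINT Q_add Q_scaleR inner_add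
        inner_commute[of u] power2_eq_square algebra_simps)
qed auto

lemma dens_self:
  shows "AE y in M. 0 \<le> dens v v y"
    and "A \<in> sets borel \<Longrightarrow> (LINT y:A|M. dens v v y) = measure (spec v) A"
proof -
  obtain D where D: "integrable M D" "\<And>x. 0 \<le> D x" "\<And>A. A \<in> sets M \<Longrightarrow> (LINT y:A|M. D y) = measure (spec v) A"
    using quadratic_density_ex[of v] by blast
  have *: "AE y in M. dens v v y = D y"
    using D by (intro dens_eqI) (auto simp: spec norm_Q_sq)
  then show "AE y in M. 0 \<le> dens v v y" by eventually_elim (use D in auto)
  show "(LINT y:A|M. dens v v y) = measure (spec v) A" if "A \<in> sets borel"
  proof -
    have "(LINT y:A|M. dens v v y) = (LINT y:A|M. D y)"
      unfolding set_lebesgue_integral_def using * D(1) that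
      by (intro integral_cong_AE) (auto simp: borel_measurable_integrable)
    then show ?thesis using D(3) that by simp
  qed
qed

text \<open>Two cylinders are nested or disjoint, and the product of their projections is
  correspondingly that of the finer one or zero.\<close>

lemma dens_Q: "AE y in M. dens (Q x n v) u y = indicator (cyl x n) y * dens v u y"
proof (intro dens_eqI)
  show "integrable M (\<lambda>y. indicator (cyl x n) y * dens v u y)"
    using integrable_mult_indicator[of "cyl x n" M "dens v u"] by simp
  fix z m
  have eq: "(LINT y:cyl z m|M. indicator (cyl x n) y * dens v u y) = (LINT y:cyl z m \<inter> cyl x n|M. dens v u y)"
    by (simp add: set_lebesgue_integral_def indicator_inter_arith mult.assoc)
  have *: "cyl a i \<inter> cyl b j = (if b \<in> cyl a i then cyl b j else {})" if "i \<le> j" for a b i j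
    using that by (auto simp: cyl_def)
  have Qxn: "Q x n (Q z m v) = Q z m (Q x n v)" by (rule Q_comm)
  show "(LINT y:cyl z m|M. indicator (cyl x n) y * dens v u y) = inner (Q z m (Q x n v)) u"
  proof (cases "n \<le> m")
    case True
    show ?thesis unfolding eq Qxn[symmetric] Int_commute[of "cyl z m"] using True
      by (simp add: * Q_Q dens_LINT set_lebesgue_integral_def[of _ "{}"])
  next
    case False
    then show ?thesis unfolding eq by (simp add: * Q_Q dens_LINT set_lebesgue_integral_def[of _ "{}"])
  qed
qed

section \<open>Pointwise Bessel inequality and Parseval identity\<close>

lemma bessel_finite:
  fixes y :: "nat \<Rightarrow> 'v"
  assumes orth: "\<And>i j. i \<noteq> j \<Longrightarrow> AE x in M. dens (y i) (y j) x = 0"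
  shows "AE x in M. 0 \<le> dens v v x - (\<Sum>i<n. (dens v (y i) x)\<^sup>2 / dens (y i) (y i) x)"
proof (induction n arbitrary: v)
  case 0 show ?case using dens_self(1) by simp
next
  case (Suc n)
  let ?B = "\<lambda>v x. dens v v x - (\<Sum>i<n. (dens v (y i) x)\<^sup>2 / dens (y i) (y i) x)"
  \<comment> \<open>The induction hypothesis is applied to \<open>v + t *\<^sub>R y n\<close>:
    orthogonality leaves the first \<open>n\<close> coefficients unchanged, so the Bessel defect
    becomes a quadratic in \<open>t\<close>, whose discriminant supplies the next term.\<close>
  have step: "AE x in M. 0 \<le> ?B v x + 2 * t * dens v (y n) x + t\<^sup>2 * dens (y n) (y n) x" for t
  proof -
    have "AE x in M. dens (v + t *\<^sub>R y n) (y i) x = dens v (y i) x" if "i < n" for i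
    proof -
      have "AE x in M. dens (y n) (y i) x = 0" using orth that by auto
      with dens_add[of v "t *\<^sub>R y n" "y i"] dens_scaleR[of t "y n" "y i"] show ?thesis
        by eventually_elim auto
    qed
    then have "AE x in M. \<forall>i\<in>{..<n}. dens (v + t *\<^sub>R y n) (y i) x = dens v (y i) x"
      by (intro AE_finite_allI) auto
    then show ?thesis using Suc[of "v + t *\<^sub>R y n"] dens_expand[of v t "y n"]
    proof eventually_elim
      case (elim x)
      have "(\<Sum>i<n. (dens (v + t *\<^sub>R y n) (y i) x)\<^sup>2 / dens (y i) (y i) x) =
        (\<Sum>i<n. (dens v (y i) x)\<^sup>2 / dens (y i) (y i) x)"
        by (rule sum.cong) (use elim(1) in auto)
      then show ?case using elim(2,3) by simp
    qed
  qed
  have "AE x in M. \<forall>t\<in>\<rat>. 0 \<le> ?B v x + 2 * t * dens v (y n) x + t\<^sup>2 * dens (y n) (y n) x"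
    using step by (subst AE_ball_countable) (auto intro: countable_rat)
  then show ?case using dens_self(1)[of "y n"] Suc[of v]
  proof eventually_elim
    case (elim x)
    have "(dens v (y n) x)\<^sup>2 \<le> ?B v x * dens (y n) (y n) x"
      using elim(1) by (intro quadratic_nonneg_discriminant) auto
    \<comment> \<open>Where the density of \<open>y n\<close> vanishes, the new term is a quotient
      by zero, hence 0.\<close>
    then show ?case using elim(2,3)
      by (cases "dens (y n) (y n) x = 0") (auto simp: field_simps)
  qed
qed

text \<open>The pointwise Parseval identity holds for the vectors of the orthogonal system and their
  images under the projections \<^const>\<open>Q\<close>; the set of vectors for which it holds is a closed subspace
  because the pointwise defect is a nonnegative quadratic form bounded by the density.\<close>

lemma parseval:
  fixes y :: "nat \<Rightarrow> 'v"
  assumes orth: "\<And>i j. i \<noteq> j \<Longrightarrow> AE x in M. dens (y i) (y j) x = 0"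
    and total: "\<And>Z. subspace Z \<Longrightarrow> closed Z \<Longrightarrow> (\<And>x n i. Q x n (y i) \<in> Z) \<Longrightarrow> Z = UNIV"
  shows "AE x in M. (\<lambda>i. (dens v (y i) x)\<^sup>2 / dens (y i) (y i) x) sums dens v v x"
proof -
  let ?a = "\<lambda>v i x. (dens v (y i) x)\<^sup>2 / dens (y i) (y i) x"
  define d where "d v x = dens v v x - (\<Sum>i. ?a v i x)" for v x
  have yy: "AE x in M. \<forall>i. 0 \<le> dens (y i) (y i) x" using dens_self(1) by (simp add: AE_all_countable)
  have bes: "AE x in M. summable (\<lambda>i. ?a v i x) \<and> 0 \<le> d v x \<and> d v x \<le> dens v v x" for v
  proof -
    have "AE x in M. \<forall>n. 0 \<le> dens v v x - (\<Sum>i<n. ?a v i x)"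
      using bessel_finite[OF orth] by (simp add: AE_all_countable)
    with yy show ?thesis
    proof eventually_elim
      case (elim x)
      have sm: "summable (\<lambda>i. ?a v i x)"
        by (rule bounded_imp_summable[of _ "dens v v x"])
          (use elim(1) elim(2)[rule_format, of "Suc _"] in \<open>auto simp: lessThan_Suc_atMost\<close>)
      moreover have "(\<Sum>i. ?a v i x) \<le> dens v v x"
        using elim(2) by (intro suminf_le_const[OF sm]) (simp add: field_simps)
      moreover have "0 \<le> (\<Sum>i. ?a v i x)" using elim(1) by (intro suminf_nonneg[OF sm]) auto
      ultimately show ?case by (simp add: d_def)
    qed
  qed
  \<comment> \<open>The defect satisfies the parallelogram law, and \<open>d (v - w) x\<close> is
    nonnegative.\<close>
  have add: "AE x in M. d (v + w) x \<le> 2 * d v x + 2 * d w x" for v w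
  proof -
    have A: "AE x in M. \<forall>i. dens (v + w) (y i) x = dens v (y i) x + dens w (y i) x"
      using dens_add by (simp add: AE_all_countable)
    have B: "AE x in M. \<forall>i. dens (v - w) (y i) x = dens v (y i) x - dens w (y i) x"
      using dens_diff by (simp add: AE_all_countable)
    show ?thesis using A B bes[of v] bes[of w] bes[of "v + w"] bes[of "v - w"] dens_expand[of v 1 w] dens_expand[of v "- 1" w]
    proof eventually_elim
      case (elim x)
      have "?a (v + w) i x + ?a (v - w) i x = 2 * ?a v i x + 2 * ?a w i x" for i
        using elim(1,2) by (simp add: add_divide_distrib[symmetric] power2_sum power2_diff)
      moreover have "(\<Sum>i. ?a (v + w) i x) + (\<Sum>i. ?a (v - w) i x) = (\<Sum>i. ?a (v + w) i x + ?a (v - w) i x)"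
        by (rule suminf_add) (use elim in blast)+
      ultimately have "(\<Sum>i. ?a (v + w) i x) + (\<Sum>i. ?a (v - w) i x) = (\<Sum>i. 2 * ?a v i x + 2 * ?a w i x)"
        by simp
      also have "\<dots> = (\<Sum>i. 2 * ?a v i x) + (\<Sum>i. 2 * ?a w i x)"
        by (rule suminf_add[symmetric]; rule summable_mult; use elim in blast)
      also have "(\<Sum>i. 2 * ?a v i x) = 2 * (\<Sum>i. ?a v i x)" by (rule suminf_mult) (use elim in blast)
      also have "(\<Sum>i. 2 * ?a w i x) = 2 * (\<Sum>i. ?a w i x)" by (rule suminf_mult) (use elim in blast)
      finally show ?case using elim by (simp add: d_def)
    qed
  qed
  have scale: "AE x in M. d (c *\<^sub>R v) x = c\<^sup>2 * d v x" for c v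
  proof -
    have A: "AE x in M. \<forall>i. dens (c *\<^sub>R v) (y i) x = c * dens v (y i) x"
      using dens_scaleR by (simp add: AE_all_countable)
    show ?thesis using A bes[of v] dens_scaleR[of c v "c *\<^sub>R v"] dens_commute[of v "c *\<^sub>R v"] dens_scaleR[of c v v]
    proof eventually_elim
      case (elim x)
      have "(\<Sum>i. ?a (c *\<^sub>R v) i x) = (\<Sum>i. c\<^sup>2 * ?a v i x)"
        using elim(1) by (simp add: power_mult_distrib)
      also have "\<dots> = c\<^sup>2 * (\<Sum>i. ?a v i x)" using elim by (intro suminf_mult) auto
      finally show ?case using elim by (simp add: d_def power2_eq_square algebra_simps)
    qed
  qed
  let ?Z = "{v. AE x in M. d v x = 0}"
  have d_meas [measurable]: "d v \<in> borel_measurable borel" for v unfolding d_def by measurable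
  have "subspace ?Z"
  proof (rule subspaceI)
    show "0 \<in> ?Z" using scale[of 0 0] by simp
    show "v + w \<in> ?Z" if "v \<in> ?Z" "w \<in> ?Z" for v w
      using that add[of v w] bes[of "v + w"] by (auto elim: eventually_elim2 intro: AE_mp)
    show "c *\<^sub>R v \<in> ?Z" if "v \<in> ?Z" for c v
      using that scale[of c v] by (auto elim: eventually_elim2)
  qed
  moreover have "closed ?Z"
    unfolding closed_sequential_limits
  proof (intro allI impI, elim conjE)
    fix V l assume V: "\<forall>n. V n \<in> ?Z" "V \<longlonglongrightarrow> l"
    have int: "integrable M (d l)"
    proof (rule Bochner_Integration.integrable_bound[OF dens_integrable[of l l]])
      show "AE x in M. norm (d l x) \<le> norm (dens l l x)" using bes[of l] by eventually_elim simp
    qed simp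
    have le: "(\<integral>x. d l x \<partial>M) \<le> 2 * (norm (l - V n))\<^sup>2" for n
    proof -
      have "AE x in M. d (V n) x = 0" using V(1) by simp
      then have "AE x in M. d l x \<le> 2 * dens (l - V n) (l - V n) x"
        using add[of "V n" "l - V n"] bes[of "l - V n"] by eventually_elim simp
      then have "(\<integral>x. d l x \<partial>M) \<le> (\<integral>x. 2 * dens (l - V n) (l - V n) x \<partial>M)"
        using int by (intro integral_mono_AE) auto
      then show ?thesis by (simp add: dens_integral power2_norm_eq_inner)
    qed
    have "(\<lambda>n. 2 * (norm (l - V n))\<^sup>2) \<longlonglongrightarrow> 2 * (norm (l - l))\<^sup>2" by (intro tendsto_intros V)
    then have "(\<integral>x. d l x \<partial>M) \<le> 2 * (norm (l - l))\<^sup>2" using le LIMSEQ_le_const by blast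
    moreover have nn: "AE x in M. 0 \<le> d l x" using bes[of l] by eventually_elim simp
    ultimately have "(\<integral>x. d l x \<partial>M) = 0" using integral_nonneg_AE[OF nn] by simp
    then show "l \<in> ?Z" using integral_nonneg_eq_0_iff_AE[OF int nn] by simp
  qed
  moreover have "Q x n (y j) \<in> ?Z" for x n j
  proof -
    have A: "AE z in M. \<forall>i. dens (Q x n (y j)) (y i) z = indicator (cyl x n) z * dens (y j) (y i) z"
      using dens_Q by (simp add: AE_all_countable)
    have "AE z in M. i \<noteq> j \<longrightarrow> dens (y j) (y i) z = 0" for i using orth[of j i] by (cases "i = j") auto
    then have B: "AE z in M. \<forall>i. i \<noteq> j \<longrightarrow> dens (y j) (y i) z = 0" by (simp add: AE_all_countable)
    have "AE z in M. d (Q x n (y j)) z = 0"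
      using A B dens_Q[of x n "y j" "Q x n (y j)"] dens_commute[of "y j" "Q x n (y j)"]
    proof eventually_elim
      case (elim z)
      \<comment> \<open>Only the coefficient with index \<open>j\<close> survives, and it exhausts
        the density; both vanish off the cylinder and where the density of \<open>y j\<close> is
        zero.\<close>
      have "(\<lambda>i. ?a (Q x n (y j)) i z) sums (?a (Q x n (y j)) j z)"
        using sums_If_finite_set[of "{j}" "\<lambda>i. ?a (Q x n (y j)) i z"] elim
        by (auto simp: if_distrib cong: if_cong elim!: sums_cong[THEN iffD1, rotated])
      then show ?case using elim by (auto simp: d_def sums_unique[symmetric] indicator_def power2_eq_square)
    qed
    then show ?thesis by simp
  qed
  ultimately have "?Z = UNIV" by (rule total)
  then have "AE x in M. d v x = 0" by blast
  with bes[of v] show ?thesis by eventually_elim (auto simp: d_def sums_iff)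
qed

end

section \<open>Real structures and cyclic vectors\<close>

lemma scaleC_i_i: "scaleC \<i> (scaleC \<i> v) = - (v :: 'v::complex_hilbert)"
proof -
  have "scaleC \<i> (scaleC \<i> v) = scaleC (complex_of_real (- 1)) v" by (simp add: scaleC_scaleC)
  then show ?thesis using scaleR_scaleC[of "- 1" v] by simp
qed

lemma linear_scaleC: "linear (scaleC z :: 'v::complex_hilbert \<Rightarrow> 'v)"
  by (rule linearI) (simp_all add: scaleC_add_right scaleR_scaleC scaleC_scaleC mult.commute)

lemma scaleC_decompose: "scaleC z v = Re z *\<^sub>R v + Im z *\<^sub>R scaleC \<i> (v :: 'v::complex_hilbert)"
  by (simp add: scaleR_scaleC scaleC_scaleC mult.commute flip: scaleC_add_left complex_eq)

lemma cinner_scaleC_right: "cinner v (scaleC z w) = cnj z * cinner v (w :: 'v::complex_hilbert)"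
  by (metis cinner_commute cinner_scaleC_left complex_cnj_mult)

lemma inner_scaleC_i: "inner (scaleC \<i> v) (scaleC \<i> w) = inner v (w :: 'v::complex_hilbert)"
  by (simp add: inner_eq_Re_cinner cinner_scaleC_left cinner_scaleC_right)

lemma inner_scaleC_i_left: "inner (scaleC \<i> v) w = - inner v (scaleC \<i> (w :: 'v::complex_hilbert))"
  by (simp add: inner_eq_Re_cinner cinner_scaleC_left cinner_scaleC_right)

lemma inner_scaleC_i_self: "inner v (scaleC \<i> (v :: 'v::complex_hilbert)) = 0"
  using inner_scaleC_i_left[of v v] by (simp add: inner_commute[of v "scaleC \<i> v"])

lemma norm_scaleC_i [simp]: "norm (scaleC \<i> v) = norm (v :: 'v::complex_hilbert)"
  by (simp add: norm_eq_sqrt_inner inner_scaleC_i)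

lemma cinner_eq: "cinner v w = Complex (inner v w) (inner v (scaleC \<i> (w :: 'v::complex_hilbert)))"
  by (simp add: complex_eq_iff inner_eq_Re_cinner cinner_scaleC_right)

section \<open>Closed linear spans\<close>

definition closed_span :: "'a::real_normed_vector set \<Rightarrow> 'a set" where
  "closed_span G = \<Inter>{Z. subspace Z \<and> closed Z \<and> G \<subseteq> Z}"

lemma subspace_closed_span: "subspace (closed_span G)"
  unfolding closed_span_def by (rule subspace_Inter) auto

lemma closed_closed_span: "closed (closed_span G)"
  unfolding closed_span_def by (rule closed_Inter) auto

lemma closed_span_superset: "G \<subseteq> closed_span G"
  unfolding closed_span_def by auto

lemma closed_span_minimal: "subspace Z \<Longrightarrow> closed Z \<Longrightarrow> G \<subseteq> Z \<Longrightarrow> closed_span G \<subseteq> Z"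
  unfolding closed_span_def by auto

lemma closed_span_mono: "G \<subseteq> H \<Longrightarrow> closed_span G \<subseteq> closed_span H"
  by (meson closed_closed_span closed_span_minimal closed_span_superset subset_trans subspace_closed_span)

text \<open>The preimage of the closed span is a closed subspace, so it is enough to look at the
  generators.\<close>

lemma closed_span_invariant:
  assumes A: "bounded_linear A" and G: "\<And>g. g \<in> G \<Longrightarrow> A g \<in> closed_span G" and v: "v \<in> closed_span G"
  shows "A v \<in> closed_span G"
proof -
  have "closed_span G \<subseteq> A -` closed_span G"
    using A G bounded_linear.linear[OF A]
    by (intro closed_span_minimal linear_subspace_vimage subspace_closed_span continuous_closed_vimage closed_closed_span)
      (auto intro: linear_continuous_at)
  then show ?thesis using v by auto
qed

section \<open>Symmetries anticommuting with a real structure\<close>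

locale real_spectral = symmetries N for N :: "nat \<Rightarrow> 'v::complex_hilbert \<Rightarrow> 'v" +
  fixes S :: "'v \<Rightarrow> 'v"
  assumes N_scaleC: "N k (scaleC z v) = scaleC z (N k v)"
    and S_add: "S (v + w) = S v + S w" and S_scaleC: "S (scaleC z v) = scaleC (cnj z) (S v)"
    and S_norm: "norm (S v) = norm v" and S_S [simp]: "S (S v) = v"
    and S_N: "S (N k v) = - N k (S v)"
    and separable: "\<exists>D :: 'v set. countable D \<and> closure D = UNIV"
begin

abbreviation I :: "'v \<Rightarrow> 'v" where "I \<equiv> scaleC \<i>"

lemma S_linear: "linear S"
  by (rule linearI) (simp_all add: S_add S_scaleC scaleR_scaleC)

lemma S_minus: "S (- v) = - S v" by (rule linear_neg[OF S_linear])
lemma S_diff: "S (v - w) = S v - S w" by (rule linear_diff[OF S_linear])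
lemma S_scaleR: "S (r *\<^sub>R v) = r *\<^sub>R S v" by (rule linear_scale[OF S_linear])

lemma S_inner: "inner (S v) (S w) = inner v w"
  by (rule linear_norm_preserving_inner[OF S_linear S_norm])

lemma S_I: "S (I v) = - I (S v)"
  using scaleC_decompose[of "- \<i>" "S v"] by (simp add: S_scaleC)

lemma I_add: "I (v + w) = I v + I w" by (rule linear_add[OF linear_scaleC])
lemma I_diff: "I (v - w) = I v - I w" by (rule linear_diff[OF linear_scaleC])
lemma I_scaleR: "I (r *\<^sub>R v) = r *\<^sub>R I v" by (rule linear_scale[OF linear_scaleC])
lemma I_minus: "I (- v) = - I v" by (rule linear_neg[OF linear_scaleC])

lemma P_I: "P k b (I v) = I (P k b v)"
  by (simp add: P_def N_scaleC I_add I_diff I_minus I_scaleR)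

lemma Q_I: "Q x n (I v) = I (Q x n v)"
  by (induction n) (auto simp: P_I)

lemma S_P: "S (P k b v) = P k (\<not> b) (S v)"
  by (simp add: P_def S_scaleR S_add S_diff S_minus S_N)

lemma S_Q: "S (Q x n v) = Q (flip x) n (S v)"
  by (induction n) (auto simp: S_P flip_def add_seq_def)

lemma flip_flip [simp]: "flip (flip x) = x"
  by (auto simp: flip_def add_seq_def)

lemma bounded_Q: "bounded_linear (Q x n)"
  using Q_linear norm_Q_le by (intro bounded_linear_intro[where K = 1]) (auto simp: Q_add Q_scaleR)

lemma bounded_I: "bounded_linear I"
  by (intro bounded_linear_intro[where K = 1]) (auto simp: I_add I_scaleR)

lemma bounded_S: "bounded_linear S"
  by (intro bounded_linear_intro[where K = 1]) (auto simp: S_add S_scaleR S_norm)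

lemma spec_I: "spec (I v) = spec v"
  by (rule spec_eqI) (auto simp: spec Q_I)

lemma real_dense_sequence:
  obtains d :: "nat \<Rightarrow> 'v" where "\<And>n. S (d n) = d n"
    "\<And>Z. subspace Z \<Longrightarrow> closed Z \<Longrightarrow> (\<And>n. d n \<in> Z) \<Longrightarrow> (\<And>n. I (d n) \<in> Z) \<Longrightarrow> Z = UNIV"
proof -
  obtain D :: "'v set" where D: "countable D" "closure D = UNIV" using separable by blast
  then have ne: "D \<noteq> {}" by auto
  define a where "a = from_nat_into D"
  \<comment> \<open>With \<open>a\<close> running through a dense sequence, \<open>a + S a\<close>
    and \<open>I (a - S a)\<close> are fixed by \<open>S\<close>, since \<open>S\<close>
    anticommutes with \<open>I\<close>; over the complex numbers they recover
    \<open>a\<close>.\<close>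
  define d where "d n = (if even n then a (n div 2) + S (a (n div 2)) else I (a (n div 2) - S (a (n div 2))))" for n
  show thesis
  proof
    show "S (d n) = d n" for n by (simp add: d_def S_add S_diff S_I I_diff)
    fix Z assume Z: "subspace Z" "closed Z" "\<And>n. d n \<in> Z" "\<And>n. I (d n) \<in> Z"
    have "a n \<in> Z" for n
    proof -
      have "a n = (1/2) *\<^sub>R (d (2 * n) - I (d (Suc (2 * n))))"
        by (simp add: d_def scaleC_i_i flip: scaleR_2)
      then show ?thesis using Z by (simp add: subspace_diff subspace_scale)
    qed
    then have "D \<subseteq> Z" unfolding a_def using D(1) ne by (metis from_nat_into_surj subsetI)
    then show "Z = UNIV" using D(2) closure_minimal[OF _ Z(2)] by auto
  qed
qed

text \<open>Gram--Schmidt for cyclic subspaces, carried out inside the real form \<open>{v. S v = v}\<close>.\<close>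

lemma cyclic_vectors_ex:
  obtains u :: "nat \<Rightarrow> 'v" where "\<And>n. S (u n) = u n"
    "\<And>n m x k. n \<noteq> m \<Longrightarrow> inner (Q x k (u n)) (u m) = 0"
    "\<And>n m x k. inner (Q x k (u n)) (I (u m)) = 0"
    "\<And>Z. subspace Z \<Longrightarrow> closed Z \<Longrightarrow> (\<And>x k n. Q x k (u n) \<in> Z) \<Longrightarrow> (\<And>x k n. Q x k (I (u n)) \<in> Z) \<Longrightarrow> Z = UNIV"
proof -
  obtain d :: "nat \<Rightarrow> 'v" where Sd: "\<And>n. S (d n) = d n"
    and d: "\<And>Z. subspace Z \<Longrightarrow> closed Z \<Longrightarrow> (\<And>n. d n \<in> Z) \<Longrightarrow> (\<And>n. I (d n) \<in> Z) \<Longrightarrow> Z = UNIV"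
    using real_dense_sequence by blast
  \<comment> \<open>\<open>C n\<close> is the least closed complex subspace that contains
    \<open>d 0\<close>, ..., \<open>d (n - 1)\<close> and is invariant under all projections
    \<open>Q\<close>. Products of projections create no new generators, by
    \<open>QQ\<close>.\<close>
  define G where "G n = {Q x k (d j) | x k j. j < n} \<union> {I (Q x k (d j)) | x k j. j < n}" for n
  define C where "C n = closed_span (G n)" for n
  note C = subspace_closed_span[of "G _", folded C_def] closed_closed_span[of "G _", folded C_def]
  have GC: "g \<in> C n" if "g \<in> G n" for g n using that closed_span_superset unfolding C_def by blast
  have C0: "0 \<in> C n" for n using C(1) by (rule subspace_0)
  have QQ: "Q y l (Q x k v) \<in> {Q x k v, Q y l v, 0}" for x y k l v
    using Q_Q[of l k y x v] Q_Q[of k l x y v] Q_comm[of x k y l v] by (cases "l \<le> k") auto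
  have GQ: "Q x k (d j) \<in> G n" "I (Q x k (d j)) \<in> G n" if "j < n" for x k j n
    using that by (auto simp: G_def)
  have QG: "Q y l g \<in> C n" if "g \<in> G n" for y l g n
  proof -
    from that obtain x k j where j: "j < n" and g: "g = Q x k (d j) \<or> g = I (Q x k (d j))" by (auto simp: G_def)
    from QQ[of y l x k "d j"] consider "Q y l (Q x k (d j)) = Q x k (d j)" | "Q y l (Q x k (d j)) = Q y l (d j)"
      | "Q y l (Q x k (d j)) = 0" by blast
    then have "Q y l (Q x k (d j)) \<in> C n \<and> I (Q y l (Q x k (d j))) \<in> C n"
      using GC GQ j C0 by cases (auto simp: linear_0[OF linear_scaleC])
    then show ?thesis using g by (auto simp: Q_I)
  qed
  have QC: "Q y l v \<in> C n" if "v \<in> C n" for y l v n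
    using closed_span_invariant[OF bounded_Q] QG that unfolding C_def by blast
  have "I g \<in> C n" if "g \<in> G n" for g n
    using that GC GQ C(1) by (auto simp: G_def scaleC_i_i intro!: subspace_neg)
  then have IC: "I v \<in> C n" if "v \<in> C n" for v n
    using closed_span_invariant[OF bounded_I] that unfolding C_def by blast
  have "S g \<in> C n" if "g \<in> G n" for g n
    using that GC GQ C(1) by (auto simp: G_def S_I S_Q Sd intro!: subspace_neg)
  then have SC: "S v \<in> C n" if "v \<in> C n" for v n
    using closed_span_invariant[OF bounded_S] that unfolding C_def by blast
  have Cmono: "C n \<subseteq> C m" if "n \<le> m" for n m
    unfolding C_def using that by (intro closed_span_mono) (force simp: G_def)
  have "\<exists>p. p \<in> C n \<and> (\<forall>v\<in>C n. inner v (d n - p) = 0)" for n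
    using closed_subspace_projection[OF C] by metis
  then obtain p where p: "\<And>n. p n \<in> C n" "\<And>n v. v \<in> C n \<Longrightarrow> inner v (d n - p n) = 0" by metis
  define u where "u n = d n - p n" for n
  have pu: "inner v (u n) = 0" if "v \<in> C n" for v n using p(2) that by (simp add: u_def)
  \<comment> \<open>\<open>S\<close> preserves \<open>C n\<close> and fixes \<open>d n\<close>, so
    \<open>S (p n)\<close> is again the orthogonal projection of \<open>d n\<close> onto
    \<open>C n\<close>; uniqueness of the projection gives equality.\<close>
  have Sp: "S (p n) = p n" for n
  proof -
    have *: "p n - S (p n) \<in> C n" using p(1) SC C(1) by (simp add: subspace_diff)
    have "inner v (d n - S (p n)) = 0" if "v \<in> C n" for v
      using p(2)[OF SC[OF that]] S_inner[of v "S (d n - p n)"] by (simp add: S_diff Sd)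
    then have "inner (p n - S (p n)) ((d n - S (p n)) - (d n - p n)) = 0"
      using * p(2) by (simp add: inner_diff_right)
    then show ?thesis by simp
  qed
  have dC: "d n \<in> C (Suc n)" for n using GC[OF GQ(1)[of n "Suc n" undefined 0]] by simp
  have uC: "u n \<in> C m" if "n < m" for n m
  proof -
    have "u n \<in> C (Suc n)" unfolding u_def using p(1)[of n] Cmono[of n "Suc n"] by (intro subspace_diff C(1) dC) auto
    then show ?thesis using Cmono[of "Suc n" m] that by auto
  qed
  show thesis
  proof
    show "S (u n) = u n" for n by (simp add: u_def S_diff Sd Sp)
    have 1: "inner (Q x k (u n)) (u m) = 0" "inner (Q x k (u n)) (I (u m)) = 0" if "n < m" for n m x k
      using pu[OF QC[OF uC[OF that]]] pu[OF IC[OF QC[OF uC[OF that]]], of x k]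
      by (simp_all add: inner_scaleC_i_left)
    show "inner (Q x k (u n)) (u m) = 0" if "n \<noteq> m" for n m x k
      using that 1(1)[of n m x k] 1(1)[of m n x k] Q_selfadj[of x k "u n" "u m"]
      by (cases "n < m") (auto simp: inner_commute[of "u n"])
    show "inner (Q x k (u n)) (I (u m)) = 0" for n m x k
    proof -
      consider "n < m" | "n = m" | "m < n" by linarith
      then show ?thesis
      proof cases
        \<comment> \<open>Moving one copy of the projection to the other side leaves
          \<open>inner w (I w)\<close> with \<open>w = Q x k (u n)\<close>, which is always
          0.\<close>
        case 2
        then show ?thesis using Q_selfadj[of x k "Q x k (u n)" "I (u n)"] by (simp add: Q_I inner_scaleC_i_self)
      next
        case 3
        have "inner (Q x k (u n)) (I (u m)) = inner (u n) (Q x k (I (u m)))" by (rule Q_selfadj)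
        also have "\<dots> = inner (I (Q x k (u m))) (u n)" by (simp add: Q_I inner_commute)
        also have "\<dots> = 0" using 1(2)[OF 3] by (simp add: inner_scaleC_i_left)
        finally show ?thesis .
      qed (rule 1)
    qed
    fix Z assume Z: "subspace Z" "closed Z" "\<And>x k n. Q x k (u n) \<in> Z" "\<And>x k n. Q x k (I (u n)) \<in> Z"
    \<comment> \<open>Each \<open>d n\<close> is recovered as \<open>u n + p n\<close>, where
      \<open>p n\<close> lies in the space \<open>C n\<close> already reached by the
      induction.\<close>
    have CZ: "C n \<subseteq> Z" for n
    proof (induction n)
      case 0
      show ?case unfolding C_def using Z by (intro closed_span_minimal) (auto simp: G_def)
    next
      case (Suc n)
      have "Q x k (d n) \<in> Z" "I (Q x k (d n)) \<in> Z" for x k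
      proof -
        have "Q x k (d n) = Q x k (u n) + Q x k (p n)" by (simp add: u_def Q_diff)
        moreover have "Q x k (p n) \<in> Z" "I (Q x k (p n)) \<in> Z" using QC IC p(1) Suc by blast+
        ultimately show "Q x k (d n) \<in> Z" "I (Q x k (d n)) \<in> Z"
          using Z(3)[of x k n] Z(4)[of x k n] Z(1) by (auto simp: I_add Q_I intro: subspace_add)
      qed
      moreover have "Q x k (d j) \<in> Z" "I (Q x k (d j)) \<in> Z" if "j < n" for x k j
        using GC GQ[OF that] Suc by blast+
      ultimately have "G (Suc n) \<subseteq> Z" by (auto simp: G_def less_Suc_eq)
      then show ?case unfolding C_def using Z by (intro closed_span_minimal) auto
    qed
    have "d n \<in> Z" "I (d n) \<in> Z" for n using dC[of n] IC[OF dC[of n]] CZ by blast+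
    then show "Z = UNIV" using d Z by blast
  qed
qed

end

section \<open>A vector dominating all spectral measures\<close>

locale cyclic_system = real_spectral N S for N :: "nat \<Rightarrow> 'v::complex_hilbert \<Rightarrow> 'v" and S +
  fixes u :: "nat \<Rightarrow> 'v" and e0 :: 'v
  assumes S_u: "S (u n) = u n" and S_e0: "S e0 = e0"
    and u_orth: "n \<noteq> m \<Longrightarrow> inner (Q x k (u n)) (u m) = 0"
    and u_orth_I: "inner (Q x k (u n)) (I (u m)) = 0"
    and u_total: "subspace Z \<Longrightarrow> closed Z \<Longrightarrow> (\<And>x k n. Q x k (u n) \<in> Z) \<Longrightarrow> (\<And>x k n. Q x k (I (u n)) \<in> Z) \<Longrightarrow> Z = UNIV"
    and e0_ac: "absolutely_continuous (spec e0) (spec v)"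

text \<open>A convergent combination of all cyclic vectors with positive weights dominates every
  spectral measure, and real weights keep it fixed by \<open>S\<close>.\<close>

lemma (in real_spectral) cyclic_system_ex: "\<exists>u e0. cyclic_system N S u e0"
proof -
  obtain u :: "nat \<Rightarrow> 'v" where u: "\<And>n. S (u n) = u n"
    "\<And>n m x k. n \<noteq> m \<Longrightarrow> inner (Q x k (u n)) (u m) = 0"
    "\<And>n m x k. inner (Q x k (u n)) (I (u m)) = 0"
    "\<And>Z. subspace Z \<Longrightarrow> closed Z \<Longrightarrow> (\<And>x k n. Q x k (u n) \<in> Z) \<Longrightarrow> (\<And>x k n. Q x k (I (u n)) \<in> Z) \<Longrightarrow> Z = UNIV"
    using cyclic_vectors_ex by blast
  \<comment> \<open>Positivity keeps every \<open>u n\<close> visible in \<open>e0\<close>; the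
    denominator makes the series converge whatever the norms are, and is nonzero even if
    \<open>u n = 0\<close>.\<close>
  define c where "c n = (1/2)^n / (1 + norm (u n))" for n
  have c: "0 < c n" for n by (simp add: c_def add_pos_nonneg)
  have sm: "summable (\<lambda>n. c n *\<^sub>R u n)"
  proof (rule summable_comparison_test)
    have "norm (c n *\<^sub>R u n) \<le> (1/2)^n" for n
      using c[of n] by (simp add: c_def divide_le_eq add_pos_nonneg mult_left_mono)
    then show "\<exists>N. \<forall>n\<ge>N. norm (c n *\<^sub>R u n) \<le> (1/2)^n" by blast
    show "summable (\<lambda>n. (1/2::real)^n)" by (simp add: summable_geometric)
  qed
  define e0 where "e0 = (\<Sum>n. c n *\<^sub>R u n)"
  have "S e0 = e0"
    unfolding e0_def bounded_linear.suminf[OF bounded_S sm] by (simp add: S_scaleR u)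
  moreover have "absolutely_continuous (spec e0) (spec v)" for v
    unfolding absolutely_continuous_def
  proof
    fix A assume "A \<in> null_sets (spec e0)"
    then have A: "A \<in> sets borel" "measure (spec e0) A = 0"
      by (auto simp: null_sets_def spec measure_def)
    have "measure (spec (u n)) A = 0" for n
    proof -
      \<comment> \<open>The component along \<open>u n\<close> splits off orthogonally, so its
        spectral measure is at most that of \<open>e0\<close>.\<close>
      have "inner (Q x k (c n *\<^sub>R u n)) (e0 - c n *\<^sub>R u n) = 0" for x k
      proof -
        have "(\<lambda>m. inner (Q x k (u n)) (c m *\<^sub>R u m)) sums inner (Q x k (u n)) e0"
          unfolding e0_def using sm by (intro bounded_linear.sums[OF bounded_linear_inner_right] summable_sums)
        moreover have "(\<lambda>m. inner (Q x k (u n)) (c m *\<^sub>R u m)) sums inner (Q x k (u n)) (c n *\<^sub>R u n)"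
          using sums_finite[of "{n}" "\<lambda>m. inner (Q x k (u n)) (c m *\<^sub>R u m)"] u(2)[of n _ x k] by simp
        ultimately have "inner (Q x k (u n)) e0 = inner (Q x k (u n)) (c n *\<^sub>R u n)" by (rule sums_unique2)
        then show ?thesis by (simp add: Q_scaleR inner_diff_right)
      qed
      from spec_orthogonal_add[OF A(1) this]
      have "measure (spec (c n *\<^sub>R u n)) A + measure (spec (e0 - c n *\<^sub>R u n)) A = 0" using A(2) by simp
      then have "measure (spec (c n *\<^sub>R u n)) A = 0"
        using measure_nonneg[of "spec (c n *\<^sub>R u n)" A] measure_nonneg[of "spec (e0 - c n *\<^sub>R u n)" A] by linarith
      then show ?thesis using c[of n] by (simp add: spec_scaleR[OF A(1)])
    qed
    \<comment> \<open>The vectors whose spectral measure ignores \<open>A\<close> form a closed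
      subspace that contains the total system.\<close>
    then have "{v. measure (spec v) A = 0} = UNIV"
      using spec_null_subspace[OF A(1)] by (intro u(4)) (auto simp: spec_I Q_I)
    then have v: "measure (spec v) A = 0" by blast
    interpret finite_measure "spec v" by (rule spec)
    show "A \<in> null_sets (spec v)" using A(1) v by (auto simp: null_sets_def spec emeasure_eq_measure)
  qed
  ultimately have "cyclic_system N S u e0" using u by unfold_locales auto
  then show ?thesis by blast
qed

section \<open>Fibers in the sequence space\<close>

lift_definition ebase :: "nat \<Rightarrow> ell2" is "\<lambda>j n. if n = j then 1 else 0"
  by (rule summable_finite[of "{_}"]) auto

lemma inner_ebase [simp]: "inner x (ebase j) = seq_of x j"
proof -
  have "(\<Sum>n. seq_of x n * (if n = j then 1 else 0)) = (\<Sum>n\<in>{j}. seq_of x n * (if n = j then 1 else 0))"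
    by (rule suminf_finite) auto
  then show ?thesis by (simp add: inner_ell2.rep_eq ebase.rep_eq)
qed

lemma seq_of_ebase: "seq_of (ebase i) j = (if i = j then 1 else 0)"
  by (simp add: ebase.rep_eq eq_commute)

lemma norm_ebase [simp]: "norm (ebase j) = 1"
  by (simp add: norm_eq_sqrt_inner seq_of_ebase)

lemma seq_of_add: "seq_of (x + y) n = seq_of x n + seq_of y n"
  by (simp add: plus_ell2.rep_eq)

lemma seq_of_scaleR: "seq_of (r *\<^sub>R x) n = r * seq_of x n"
  by (simp add: scaleR_ell2.rep_eq)

lemma seq_of_zero: "seq_of 0 n = 0"
  by (simp add: zero_ell2.rep_eq)

lemma ell2_eqI: "(\<And>n. seq_of x n = seq_of y n) \<Longrightarrow> x = y"
  by (simp add: fun_eq_iff flip: seq_of_inject)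

lemma bounded_linear_seq_of: "bounded_linear (\<lambda>x. seq_of x j)"
  using bounded_linear_inner_left[of "ebase j"] by simp

lemma ell2_sums: "(\<lambda>j. seq_of x j *\<^sub>R ebase j) sums x"
proof -
  let ?f = "\<lambda>j. seq_of x j *\<^sub>R ebase j"
  have sm: "summable ?f"
    by (rule orthogonal_series(1)) (auto simp: seq_of_ebase seq_of_scaleR summable_seq_of)
  have "seq_of (suminf ?f) i = seq_of x i" for i
  proof -
    have "(\<lambda>j. seq_of (?f j) i) sums seq_of (suminf ?f) i"
      using sm by (intro bounded_linear.sums[OF bounded_linear_seq_of] summable_sums)
    moreover have "(\<lambda>j. seq_of (?f j) i) sums seq_of x i"
      using sums_finite[of "{i}" "\<lambda>j. seq_of (?f j) i"] by (simp add: seq_of_scaleR seq_of_ebase)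
    ultimately show ?thesis by (rule sums_unique2)
  qed
  then have "suminf ?f = x" by (rule ell2_eqI)
  then show ?thesis using sm summable_sums by metis
qed

text \<open>A model of the Hilbert space of each countable dimension. Fibers of equal dimension are
  literally equal, so invariance of the family under translation reduces to that of the
  multiplicity.\<close>

definition fiber :: "enat \<Rightarrow> ell2 set" where
  "fiber \<nu> = {x. \<forall>j. \<nu> \<le> enat j \<longrightarrow> seq_of x j = 0}"

lemma subspace_fiber: "subspace (fiber \<nu>)"
  by (rule subspaceI) (auto simp: fiber_def seq_of_add seq_of_scaleR seq_of_zero)

lemma closed_fiber: "closed (fiber \<nu>)"
proof -
  have "fiber \<nu> = (\<Inter>j\<in>{j. \<nu> \<le> enat j}. {x. seq_of x j = 0})" by (auto simp: fiber_def)
  moreover have "closed {x. seq_of x j = 0}" for j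
    by (intro closed_Collect_eq continuous_intros linear_continuous_on bounded_linear_seq_of)
  ultimately show ?thesis by auto
qed

lemma ebase_fiber: "enat j < \<nu> \<Longrightarrow> ebase j \<in> fiber \<nu>"
  by (auto simp: fiber_def seq_of_ebase)

lemma fiber_eq_closure_span: "fiber \<nu> = closure (span (range (\<lambda>j. if enat j < \<nu> then ebase j else 0)))"
proof
  let ?b = "\<lambda>j. if enat j < \<nu> then ebase j else 0"
  show "closure (span (range ?b)) \<subseteq> fiber \<nu>"
    by (intro closure_minimal closed_fiber span_minimal subspace_fiber)
      (use ebase_fiber subspace_0[OF subspace_fiber] in force)
  show "fiber \<nu> \<subseteq> closure (span (range ?b))"
  proof
    fix x assume x: "x \<in> fiber \<nu>"
    have "(\<lambda>n. \<Sum>j<n. seq_of x j *\<^sub>R ebase j) \<longlonglongrightarrow> x" using ell2_sums[of x] by (simp add: sums_def)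
    moreover have "(\<Sum>j<n. seq_of x j *\<^sub>R ebase j) \<in> span (range ?b)" for n
    proof (intro span_sum)
      fix j
      have "seq_of x j *\<^sub>R ebase j = seq_of x j *\<^sub>R ?b j"
      proof (cases "enat j < \<nu>")
        case False
        then have "seq_of x j = 0" using x by (simp add: fiber_def)
        then show ?thesis by simp
      qed simp
      also have "\<dots> \<in> span (range ?b)" by (intro span_scale span_base rangeI)
      finally show "seq_of x j *\<^sub>R ebase j \<in> span (range ?b)" .
    qed
    ultimately show "x \<in> closure (span (range ?b))"
      by (intro closure_sequential[THEN iffD2] exI conjI allI)
  qed
qed

section \<open>Renumbering sets of indices\<close>

definition ecard :: "nat set \<Rightarrow> enat" where
  "ecard A = (if finite A then enat (card A) else \<infinity>)"

text \<open>The basis vector assigned to the index \<open>n\<close> when the elements of \<open>A\<close> are renumbered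
  increasingly as \<open>0, 1, \<dots>\<close>.\<close>

definition renumber :: "nat set \<Rightarrow> nat \<Rightarrow> ell2" where
  "renumber A n = (if n \<in> A then ebase (card (A \<inter> {..<n})) else 0)"

text \<open>Counting inside finite initial segments treats finite and infinite sets alike, and makes
  comparison of the multiplicity with \<open>j\<close> a measurable condition.\<close>

lemma ecard_less_iff: "enat j < ecard A \<longleftrightarrow> (\<exists>m. j < card (A \<inter> {..<m}))"
proof
  assume j: "enat j < ecard A"
  have "\<exists>B\<subseteq>A. finite B \<and> card B = Suc j"
  proof (cases "finite A")
    case True
    then have "Suc j \<le> card A" using j by (simp add: ecard_def Suc_le_eq)
    then show ?thesis by (meson obtain_subset_with_card_n)
  next
    case False
    then show ?thesis using infinite_arbitrarily_large[of A "Suc j"] by blast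
  qed
  then obtain B where B: "B \<subseteq> A" "finite B" "card B = Suc j" by blast
  obtain m where "B \<subseteq> {..<m}" using B(2) finite_nat_iff_bounded by blast
  then have "card B \<le> card (A \<inter> {..<m})" using B by (intro card_mono) auto
  then show "\<exists>m. j < card (A \<inter> {..<m})" using B(3) by (intro exI[of _ m]) simp
next
  assume "\<exists>m. j < card (A \<inter> {..<m})"
  then obtain m where m: "j < card (A \<inter> {..<m})" by blast
  show "enat j < ecard A"
  proof (cases "finite A")
    case True
    then have "card (A \<inter> {..<m}) \<le> card A" by (intro card_mono) auto
    then show ?thesis using m True by (simp add: ecard_def)
  qed (simp add: ecard_def)
qed

text \<open>The number of elements below \<open>m\<close> grows in steps of one, so it passes
  through every value below the cardinality.\<close>

lemma renumber_surj:
  assumes "enat j < ecard A"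
  shows "\<exists>n\<in>A. renumber A n = ebase j"
proof -
  obtain m where "j < card (A \<inter> {..<m})" using assms ecard_less_iff by blast
  then have "\<exists>n\<in>A. card (A \<inter> {..<n}) = j"
  proof (induction m)
    case (Suc m)
    show ?case
    proof (cases "m \<in> A")
      case True
      then have "A \<inter> {..<Suc m} = insert m (A \<inter> {..<m})" by auto
      then have "card (A \<inter> {..<Suc m}) = Suc (card (A \<inter> {..<m}))" by simp
      then have "j < card (A \<inter> {..<m}) \<or> card (A \<inter> {..<m}) = j" using Suc.prems by linarith
      then show ?thesis using Suc.IH True by blast
    next
      case False
      then have "A \<inter> {..<Suc m} = A \<inter> {..<m}" by (auto simp: less_Suc_eq)
      then show ?thesis using Suc.IH Suc.prems by argo
    qed
  qed simp
  then obtain n where n: "n \<in> A" "card (A \<inter> {..<n}) = j" by blast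
  then have "renumber A n = ebase j" by (simp add: renumber_def)
  then show ?thesis using n by blast
qed

lemma card_initial_less:
  fixes n m :: nat
  assumes "n \<in> A" "n < m"
  shows "card (A \<inter> {..<n}) < card (A \<inter> {..<m})"
proof (rule psubset_card_mono)
  have "A \<inter> {..<n} \<subseteq> A \<inter> {..<m}" using assms(2) by auto
  moreover have "n \<in> A \<inter> {..<m}" "n \<notin> A \<inter> {..<n}" using assms by simp_all
  ultimately show "A \<inter> {..<n} \<subset> A \<inter> {..<m}" by blast
qed simp

lemma renumber_fiber: "renumber A n \<in> fiber (ecard A)"
proof (cases "n \<in> A")
  case True
  then have "enat (card (A \<inter> {..<n})) < ecard A" using card_initial_less[of n A "Suc n"] ecard_less_iff by blast
  then show ?thesis using True by (simp add: renumber_def ebase_fiber)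
qed (simp add: renumber_def subspace_0[OF subspace_fiber])

lemma renumber_inner: "inner (renumber A n) (renumber A m) = (if n = m \<and> n \<in> A then 1 else 0)"
proof -
  have "card (A \<inter> {..<n}) \<noteq> card (A \<inter> {..<m})" if "n \<in> A" "m \<in> A" "n \<noteq> m"
    using that card_initial_less[of n A m] card_initial_less[of m A n] by (cases n m rule: linorder_cases) auto
  then show ?thesis by (auto simp: renumber_def seq_of_ebase seq_of_zero)
qed

lemma norm_renumber: "norm (renumber A n) = (if n \<in> A then 1 else 0)"
  by (simp add: renumber_def)

lemma fiber_eq_0:
  assumes "x \<in> fiber (ecard A)" "\<And>n. n \<in> A \<Longrightarrow> inner (renumber A n) x = 0"
  shows "x = 0"
proof (rule ell2_eqI)
  fix j
  show "seq_of x j = seq_of 0 j"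
  proof (cases "enat j < ecard A")
    case True
    then show ?thesis using renumber_surj[OF True] assms(2) by (metis inner_commute inner_ebase seq_of_zero)
  next
    case False
    then show ?thesis using assms(1) by (auto simp: fiber_def seq_of_zero not_less)
  qed
qed

lemma cx_scale_i: "cx_scale \<i> v = (- snd v, fst v)"
  by (simp add: cx_scale_def)

lemma cx_scale_decompose: "cx_scale z v = Re z *\<^sub>R v + Im z *\<^sub>R cx_scale \<i> v"
  by (simp add: cx_scale_def prod_eq_iff)

lemma cx_inner_eq: "cx_inner v w = Complex (inner v w) (inner v (cx_scale \<i> w))"
  by (simp add: cx_inner_def cx_scale_i inner_prod_def)

lemma subspace_cx_fiber: "subspace (cx (fiber \<nu>))"
  unfolding cx_def by (intro subspace_Times subspace_fiber)

lemma closed_cx_fiber: "closed (cx (fiber \<nu>))"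
  unfolding cx_def by (intro closed_Times closed_fiber)

section \<open>The spectral transform\<close>

lemma flip_measurable [measurable]: "flip \<in> measurable borel borel"
  by (rule measurable_binseqI) (simp add: flip_def add_seq_def)

lemma vimage_flip_cyl: "flip -` cyl x n = cyl (flip x) n"
  by (auto simp: cyl_def flip_def add_seq_def)

context cyclic_system
begin

sublocale spectral_densities N e0
  by unfold_locales (rule e0_ac)

text \<open>The flip carries the spectral measure of \<open>e0\<close> to that of
  \<open>S e0\<close>, and \<open>e0\<close> is fixed by \<open>S\<close>.\<close>

lemma distr_flip: "distr M borel flip = M"
proof -
  have "spec e0 = distr (spec e0) borel flip"
  proof (rule spec_eqI)
    interpret finite_measure "spec e0" by (rule spec)
    have m: "flip \<in> measurable (spec e0) borel" by (simp add: measurable_cong_sets[OF spec(1) refl])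
    show "finite_measure (distr (spec e0) borel flip)" by (rule finite_measure_distr[OF m])
    show "measure (distr (spec e0) borel flip) (cyl x n) = (norm (Q x n e0))\<^sup>2" for x n
      using S_Q[of x n e0] S_norm[of "Q x n e0"]
      by (simp add: measure_distr[OF m] vimage_flip_cyl spec S_e0)
  qed simp
  then show ?thesis by (simp add: M_def)
qed

lemma AE_flip: "AE x in M. R x \<Longrightarrow> AE x in M. R (flip x)"
  by (rule AE_distrD[of flip M borel R, unfolded distr_flip]) simp_all

lemma dens_S: "AE x in M. dens (S v) (S w) x = dens v w (flip x)"
proof (rule dens_eqI)
  show "integrable M (\<lambda>x. dens v w (flip x))"
    using integrable_distr[of flip M borel "dens v w"] by (simp add: distr_flip)
  fix x n
  have "(LINT y:cyl x n|M. dens v w (flip y)) = (\<integral>y. indicator (cyl (flip x) n) (flip y) * dens v w (flip y) \<partial>M)"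
    unfolding set_lebesgue_integral_def
    by (intro Bochner_Integration.integral_cong) (auto simp: indicator_def vimage_flip_cyl[symmetric])
  also have "\<dots> = (\<integral>y. indicator (cyl (flip x) n) y * dens v w y \<partial>distr M borel flip)"
    by (subst integral_distr) auto
  also have "\<dots> = inner (Q (flip x) n v) w"
    using dens_LINT[of "flip x" n v w] by (simp add: distr_flip set_lebesgue_integral_def)
  also have "\<dots> = inner (S (Q (flip x) n v)) (S w)" by (simp add: S_inner)
  finally show "(LINT y:cyl x n|M. dens v w (flip y)) = inner (Q x n (S v)) (S w)" by (simp add: S_Q)
qed

lemma dens_I_I: "AE x in M. dens (I v) (I w) x = dens v w x"
  by (rule dens_cong) (simp add: Q_I inner_scaleC_i)

lemma dens_I_left: "AE x in M. dens (I v) w x = - 1 * dens v (I w) x"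
proof (rule dens_eqI)
  show "(LINT y:cyl x n|M. - 1 * dens v (I w) y) = inner (Q x n (I v)) w" for x n
    unfolding set_integral_mult_right by (simp add: dens_LINT Q_I inner_scaleC_i_left)
qed simp

definition q :: "nat \<Rightarrow> binseq \<Rightarrow> real" where "q n = dens (u n) (u n)"

lemma q_measurable [measurable]: "q n \<in> borel_measurable borel"
  by (simp add: q_def)

text \<open>Over the reals, \<open>u n\<close> and \<open>I (u n)\<close> form one orthogonal
  system; interleaved they satisfy the hypotheses of \<open>parseval\<close>, and consecutive terms
  of the series are then grouped in pairs.\<close>

lemma parseval_pairs:
  "AE x in M. (\<lambda>n. (dens v (u n) x)\<^sup>2 / q n x + (dens v (I (u n)) x)\<^sup>2 / q n x) sums dens v v x"
proof -
  define y where "y i = (if even i then u (i div 2) else I (u (i div 2)))" for i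
  have "AE x in M. dens (y i) (y j) x = 0" if "i \<noteq> j" for i j
  proof (rule dens_orth)
    fix x n
    have "i div 2 \<noteq> j div 2" if "even i = even j" using \<open>i \<noteq> j\<close> that by (metis dvd_mult_div_cancel odd_two_times_div_two_succ)
    then show "inner (Q x n (y i)) (y j) = 0"
      using u_orth u_orth_I
      by (cases "even i"; cases "even j") (auto simp: y_def Q_I inner_scaleC_i_left scaleC_i_i)
  qed
  moreover have "Z = UNIV" if "subspace Z" "closed Z" "\<And>x n i. Q x n (y i) \<in> Z" for Z
  proof (rule u_total[OF that(1,2)])
    show "Q x k (u n) \<in> Z" "Q x k (I (u n)) \<in> Z" for x k n
      using that(3)[of x k "2 * n"] that(3)[of x k "Suc (2 * n)"] by (simp_all add: y_def)
  qed
  ultimately have *: "AE x in M. (\<lambda>i. (dens v (y i) x)\<^sup>2 / dens (y i) (y i) x) sums dens v v x"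
    by (rule parseval)
  have "AE x in M. \<forall>n. dens (I (u n)) (I (u n)) x = q n x"
    using dens_I_I by (simp add: AE_all_countable q_def)
  with * show ?thesis
  proof eventually_elim
    case (elim x)
    let ?f = "\<lambda>i. (dens v (y i) x)\<^sup>2 / dens (y i) (y i) x"
    have "(\<lambda>n. sum ?f {n * 2..<n * 2 + 2}) sums dens v v x" by (rule sums_group[OF elim(1)]) simp
    moreover have "sum ?f {n * 2..<n * 2 + 2} = (dens v (u n) x)\<^sup>2 / q n x + (dens v (I (u n)) x)\<^sup>2 / q n x" for n
    proof -
      have "{n * 2..<n * 2 + 2} = {2 * n, Suc (2 * n)}" by auto
      then show ?thesis using elim(2) by (simp add: y_def q_def)
    qed
    ultimately show ?case by simp
  qed
qed

text \<open>The indices of nonzero density, made flip-invariant by force and replaced by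
  \<open>{0}\<close> when there are none: the standard data need nonzero fibers and
  \<open>dim_flip\<close> at every point, while densities are controlled only almost
  everywhere.\<close>

definition idx :: "binseq \<Rightarrow> nat set" where
  "idx x = (let A = {n. 0 < q n x \<and> 0 < q n (flip x)} in if A = {} then {0} else A)"

definition mult :: "binseq \<Rightarrow> enat" where "mult x = ecard (idx x)"

definition good :: "binseq \<Rightarrow> bool" where
  "good x \<longleftrightarrow> (\<forall>n. 0 \<le> q n x) \<and> (\<forall>n. q n (flip x) = q n x) \<and> idx x = {n. 0 < q n x}"

lemma idx_flip: "idx (flip x) = idx x"
  unfolding idx_def flip_flip by (simp add: conj_commute)

lemma mult_flip: "mult (flip x) = mult x"
  by (simp add: mult_def idx_flip)

lemma mult_pos: "enat 0 < mult x"
proof -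
  have "idx x \<noteq> {}" by (simp add: idx_def Let_def)
  then show ?thesis by (auto simp: mult_def ecard_def card_gt_0_iff zero_enat_def[symmetric]) (simp add: zero_enat_def)
qed

lemma dens_e0: "AE x in M. dens e0 e0 x = 1"
proof (rule dens_eqI)
  show "(LINT y:cyl x n|M. 1) = inner (Q x n e0) e0" for x n
    unfolding norm_Q_sq[symmetric] spec(3)[symmetric] M_def[symmetric] by (simp add: set_lebesgue_integral_def)
qed simp

lemma AE_good: "AE x in M. good x"
proof -
  have "AE x in M. \<forall>n. 0 \<le> q n x" using dens_self(1) by (simp add: AE_all_countable q_def)
  moreover have "AE x in M. \<forall>n. q n (flip x) = q n x"
    using dens_S[of "u _" "u _"] by (simp add: AE_all_countable q_def S_u eq_commute)
  ultimately show ?thesis using dens_e0 parseval_pairs[of e0]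
  proof eventually_elim
    case (elim x)
    \<comment> \<open>Otherwise the Parseval series of \<open>e0\<close> is zero, although the
      density of \<open>e0\<close> with respect to its own spectral measure is 1.\<close>
    have "\<exists>n. 0 < q n x"
    proof (rule ccontr)
      assume "\<not> (\<exists>n. 0 < q n x)"
      then have "q n x = 0" for n using elim(1) by (metis order_less_le)
      then show False using elim(3,4) by (simp add: sums_iff)
    qed
    then show ?case using elim(1,2) by (auto simp: good_def idx_def)
  qed
qed

text \<open>Division by \<open>sqrt (q n x)\<close> normalizes the cyclic vectors pointwise, so this
  is an expansion in an orthonormal basis of the fiber.\<close>

definition section_of :: "(nat \<Rightarrow> real) \<Rightarrow> binseq \<Rightarrow> ell2" where
  "section_of a x = (\<Sum>n. (a n / sqrt (q n x)) *\<^sub>R renumber (idx x) n)"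

lemma section_of_summable:
  assumes x: "good x" and a: "summable (\<lambda>n. (a n)\<^sup>2 / q n x)"
  shows "(\<lambda>n. (a n / sqrt (q n x)) *\<^sub>R renumber (idx x) n) sums section_of a x"
    and "(norm (section_of a x))\<^sup>2 = (\<Sum>n. (a n)\<^sup>2 / q n x)"
    and "section_of a x \<in> fiber (mult x)"
proof -
  let ?f = "\<lambda>n. (a n / sqrt (q n x)) *\<^sub>R renumber (idx x) n"
  \<comment> \<open>For \<open>n\<close> outside \<open>idx x\<close> the density is 0 at a good
    point, and both sides vanish because division by zero gives 0.\<close>
  have nf: "(norm (?f n))\<^sup>2 = (a n)\<^sup>2 / q n x" for n
    using x by (auto simp: good_def norm_renumber power_divide power_mult_distrib not_less order_antisym)
  have o: "inner (?f i) (?f j) = 0" if "i \<noteq> j" for i j using that by (simp add: renumber_inner)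
  have sm: "summable (\<lambda>n. (norm (?f n))\<^sup>2)" unfolding nf by (rule a)
  have os: "summable ?f" "(norm (suminf ?f))\<^sup>2 = (\<Sum>n. (norm (?f n))\<^sup>2)"
    using orthogonal_series[of ?f] o sm by blast+
  show s: "?f sums section_of a x"
    unfolding section_of_def using os(1) by (rule summable_sums)
  show "(norm (section_of a x))\<^sup>2 = (\<Sum>n. (a n)\<^sup>2 / q n x)"
    unfolding section_of_def using os(2) by (simp only: nf)
  show "section_of a x \<in> fiber (mult x)"
  proof (rule closed_sequentially[OF closed_fiber])
    show "(\<lambda>n. \<Sum>i<n. ?f i) \<longlonglongrightarrow> section_of a x" using s by (simp add: sums_def)
    show "(\<Sum>i<n. ?f i) \<in> fiber (mult x)" for n
      unfolding mult_def by (intro subspace_sum subspace_scale subspace_fiber renumber_fiber)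
  qed
qed

section \<open>The transform and its compatibility with the structure\<close>

definition T :: "'v \<Rightarrow> binseq \<Rightarrow> ell2 \<times> ell2" where
  "T v x = (section_of (\<lambda>n. dens v (u n) x) x, section_of (\<lambda>n. dens v (I (u n)) x) x)"

lemma card_idx_measurable: "(\<lambda>x. card (idx x \<inter> {..<n})) \<in> measurable borel (count_space UNIV)"
  and idx_measurable [measurable]: "Measurable.pred borel (\<lambda>x. n \<in> idx x)"
proof -
  have "Measurable.pred borel (\<lambda>x. n \<in> idx x)" for n
  proof -
    have "n \<in> idx x \<longleftrightarrow> (if \<forall>m. \<not> (0 < q m x \<and> 0 < q m (flip x)) then n = 0 else 0 < q n x \<and> 0 < q n (flip x))" for x
      by (auto simp: idx_def Let_def)
    then show ?thesis by simp
  qed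
  note this[measurable]
  show "Measurable.pred borel (\<lambda>x. n \<in> idx x)" by measurable
  show "(\<lambda>x. card (idx x \<inter> {..<n})) \<in> measurable borel (count_space UNIV)"
  proof (induction n)
    case 0 show ?case by simp
  next
    case (Suc n)
    note Suc[measurable]
    have "card (idx x \<inter> {..<Suc n}) = (if n \<in> idx x then Suc (card (idx x \<inter> {..<n})) else card (idx x \<inter> {..<n}))" for x
      by (simp add: lessThan_Suc Int_insert_right)
    then show ?case by simp
  qed
qed

lemma renumber_measurable [measurable]: "(\<lambda>x. renumber (idx x) n) \<in> borel_measurable borel"
proof -
  have "(\<lambda>x. ebase (card (idx x \<inter> {..<n}))) \<in> borel_measurable borel"
    by (rule measurable_compose[OF card_idx_measurable]) simp
  then show ?thesis unfolding renumber_def by measurable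
qed

lemma mult_less_measurable [measurable]: "Measurable.pred borel (\<lambda>x. enat j < mult x)"
proof -
  note card_idx_measurable[measurable]
  have "Measurable.pred borel (\<lambda>x. \<exists>m. j < card (idx x \<inter> {..<m}))" by measurable
  then show ?thesis by (simp add: mult_def ecard_less_iff)
qed

lemma mult_measurable: "mult \<in> measurable borel (count_space UNIV)"
proof -
  have "{x. mult x = a} \<in> sets borel" for a
  proof (cases a)
    case (enat k)
    have "mult x = a \<longleftrightarrow> \<not> enat k < mult x \<and> (\<forall>j<k. enat j < mult x)" for x
    proof (cases "mult x")
      case (enat m)
      then show ?thesis using \<open>a = enat k\<close> by (auto simp: not_less) (meson le_neq_implies_less less_irrefl)
    qed (simp add: enat)
    then show ?thesis by simp
  next
    case infinity
    have "mult x = a \<longleftrightarrow> (\<forall>j. enat j < mult x)" for x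
      unfolding infinity by (cases "mult x") auto
    then show ?thesis by simp
  qed
  then show ?thesis by (auto simp: measurable_count_space_eq2_countable vimage_def)
qed

lemma T_measurable [measurable]: "T v \<in> borel_measurable borel"
  unfolding T_def[abs_def] section_of_def by measurable

lemma T_summable: "AE x in M. good x \<and> summable (\<lambda>n. (dens v (u n) x)\<^sup>2 / q n x) \<and> summable (\<lambda>n. (dens v (I (u n)) x)\<^sup>2 / q n x)"
  using AE_good parseval_pairs[of v]
proof eventually_elim
  case (elim x)
  then have nn: "0 \<le> (dens v (u n) x)\<^sup>2 / q n x" "0 \<le> (dens v (I (u n)) x)\<^sup>2 / q n x" for n by (auto simp: good_def)
  have "summable (\<lambda>n. (dens v (u n) x)\<^sup>2 / q n x + (dens v (I (u n)) x)\<^sup>2 / q n x)" using elim(2) by (simp add: sums_iff)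
  note sm = summable_comparison_test'[OF this, of 0]
  show ?case using elim(1) nn by (intro conjI sm) (auto simp: good_def)
qed

lemma T_norm: "AE x in M. (norm (T v x))\<^sup>2 = dens v v x"
  using T_summable[of v] parseval_pairs[of v]
proof eventually_elim
  case (elim x)
  have "(norm (T v x))\<^sup>2 = (\<Sum>n. (dens v (u n) x)\<^sup>2 / q n x) + (\<Sum>n. (dens v (I (u n)) x)\<^sup>2 / q n x)"
  proof -
    have "(norm (T v x))\<^sup>2 = (norm (fst (T v x)))\<^sup>2 + (norm (snd (T v x)))\<^sup>2"
      by (cases "T v x") (simp add: norm_Pair)
    then show ?thesis using elim(1) by (simp add: T_def section_of_summable)
  qed
  also have "\<dots> = (\<Sum>n. (dens v (u n) x)\<^sup>2 / q n x + (dens v (I (u n)) x)\<^sup>2 / q n x)"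
    by (rule suminf_add) (use elim(1) in blast)+
  also have "\<dots> = dens v v x" using elim(2) by (simp add: sums_iff)
  finally show ?case .
qed

lemma T_fiber: "AE x in M. T v x \<in> cx (fiber (mult x))"
  using T_summable[of v] by eventually_elim (simp add: T_def cx_def section_of_summable)

lemma section_of_add:
  assumes "good x" "summable (\<lambda>n. (a n)\<^sup>2 / q n x)" "summable (\<lambda>n. (b n)\<^sup>2 / q n x)"
  shows "section_of (\<lambda>n. a n + b n) x = section_of a x + section_of b x"
  using sums_add[OF section_of_summable(1)[OF assms(1,2)] section_of_summable(1)[OF assms(1,3)]]
  by (simp add: section_of_def add_divide_distrib scaleR_add_left sums_iff)

lemma section_of_scale:
  assumes "good x" "summable (\<lambda>n. (a n)\<^sup>2 / q n x)"
  shows "section_of (\<lambda>n. r * a n) x = r *\<^sub>R section_of a x"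
  using sums_scaleR_right[OF section_of_summable(1)[OF assms(1,2)], of r]
  by (simp add: section_of_def sums_iff)

lemma T_add: "AE x in M. T (v + w) x = T v x + T w x"
proof -
  have "AE x in M. \<forall>n. dens (v + w) (u n) x = dens v (u n) x + dens w (u n) x \<and>
      dens (v + w) (I (u n)) x = dens v (I (u n)) x + dens w (I (u n)) x"
    using dens_add by (simp add: AE_all_countable AE_conj_iff)
  then show ?thesis using T_summable[of v] T_summable[of w]
    by eventually_elim (simp add: T_def section_of_add)
qed

lemma T_scaleR: "AE x in M. T (r *\<^sub>R v) x = r *\<^sub>R T v x"
proof -
  have "AE x in M. \<forall>n. dens (r *\<^sub>R v) (u n) x = r * dens v (u n) x \<and>
      dens (r *\<^sub>R v) (I (u n)) x = r * dens v (I (u n)) x"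
    using dens_scaleR by (simp add: AE_all_countable AE_conj_iff)
  then show ?thesis using T_summable[of v]
    by eventually_elim (simp add: T_def section_of_scale)
qed

lemma T_minus: "AE x in M. T (- v) x = - T v x"
  using T_scaleR[of "- 1" v] by simp

lemma T_diff: "AE x in M. T (v - w) x = T v x - T w x"
  using T_add[of v "- w"] T_minus[of w] by eventually_elim simp

text \<open>Multiplication by \<i> exchanges the two coefficient sequences up to sign, just as it
  exchanges real and imaginary parts in the complexification.\<close>

lemma T_I: "AE x in M. T (I v) x = cx_scale \<i> (T v x)"
proof -
  have "AE x in M. \<forall>n. dens (I v) (u n) x = - 1 * dens v (I (u n)) x \<and> dens (I v) (I (u n)) x = dens v (u n) x"
    using dens_I_left dens_I_I by (simp add: AE_all_countable AE_conj_iff)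
  then show ?thesis using T_summable[of v]
  proof eventually_elim
    case (elim x)
    then show ?case using section_of_scale[of x "\<lambda>n. dens v (I (u n)) x" "- 1"] by (simp add: T_def cx_scale_i)
  qed
qed

lemma T_scaleC: "AE x in M. T (scaleC z v) x = cx_scale z (T v x)"
  using T_add[of "Re z *\<^sub>R v" "Im z *\<^sub>R I v"] T_scaleR[of "Re z" v] T_scaleR[of "Im z" "I v"] T_I[of v]
proof eventually_elim
  case (elim x)
  then show ?case by (simp add: scaleC_decompose[of z v] cx_scale_decompose[of z])
qed

lemma T_inner: "AE x in M. inner (T v x) (T w x) = dens v w x"
  using T_norm[of v] T_norm[of w] T_norm[of "v + w"] T_add[of v w] dens_expand[of v 1 w]
  by eventually_elim (simp add: dot_norm)

lemma T_cx_inner: "AE x in M. cx_inner (T v x) (T w x) = Complex (dens v w x) (dens v (I w) x)"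
  using T_inner[of v w] T_inner[of v "I w"] T_I[of w] by eventually_elim (simp add: cx_inner_eq)

text \<open>As \<open>u n\<close> is fixed by \<open>S\<close>, the coefficients of
  \<open>S v\<close> at \<open>x\<close> are those of \<open>v\<close> at \<open>flip x\<close>;
  against \<open>I (u n)\<close> a minus sign appears because \<open>S\<close> anticommutes with
  \<open>I\<close>, and this sign is the conjugation.\<close>

lemma T_S: "AE x in M. T (S v) x = cx_cnj (T v (flip x))"
proof -
  have "AE x in M. \<forall>n. dens (S v) (u n) x = dens v (u n) (flip x)"
    using dens_S[of v "u _"] by (simp add: AE_all_countable S_u)
  moreover have "AE x in M. \<forall>n. dens (S v) (I (u n)) x = - 1 * dens v (I (u n)) (flip x)"
  proof -
    have "AE x in M. dens (S v) (I (u n)) x = - 1 * dens v (I (u n)) (flip x)" for n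
      using dens_I_left[of "S v" "u n"] dens_S[of "I v" "u n"] AE_flip[OF dens_I_left[of v "u n"]]
        dens_scaleR[of "- 1" "I (S v)" "u n"]
      by eventually_elim (simp add: S_I S_u)
    then show ?thesis by (simp add: AE_all_countable)
  qed
  ultimately show ?thesis using AE_good AE_flip[OF T_summable[of v]]
  proof eventually_elim
    case (elim x)
    have sec: "section_of a (flip x) = section_of a x" for a
      using elim(3) by (simp add: section_of_def idx_flip good_def)
    show ?case using elim section_of_scale[of "flip x" "\<lambda>n. dens v (I (u n)) (flip x)" "- 1"]
      by (simp add: T_def cx_cnj_def sec)
  qed
qed

lemma T_Q: "AE y in M. T (Q x n v) y = indicator (cyl x n) y *\<^sub>R T v y"
proof -
  have "AE y in M. \<forall>m. dens (Q x n v) (u m) y = indicator (cyl x n) y * dens v (u m) y \<and>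
      dens (Q x n v) (I (u m)) y = indicator (cyl x n) y * dens v (I (u m)) y"
    using dens_Q by (simp add: AE_all_countable AE_conj_iff)
  then show ?thesis using T_summable[of v]
    by eventually_elim (simp add: T_def section_of_scale)
qed

lemma T_u: "AE x in M. T (u n) x = (sqrt (q n x) *\<^sub>R renumber (idx x) n, 0)"
proof -
  have "AE x in M. m \<noteq> n \<longrightarrow> dens (u n) (u m) x = 0" for m
    using dens_orth[of "u n" "u m"] u_orth[of n m] by (cases "m = n") auto
  then have "AE x in M. \<forall>m. m \<noteq> n \<longrightarrow> dens (u n) (u m) x = 0" by (simp add: AE_all_countable)
  moreover have "AE x in M. \<forall>m. dens (u n) (I (u m)) x = 0"
    using dens_orth[of "u n" "I (u _)"] u_orth_I by (simp add: AE_all_countable)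
  ultimately show ?thesis using AE_good
  proof eventually_elim
    case (elim x)
    have "(\<lambda>m. (dens (u n) (u m) x / sqrt (q m x)) *\<^sub>R renumber (idx x) m) sums (sqrt (q n x) *\<^sub>R renumber (idx x) n)"
      using sums_finite[of "{n}" "\<lambda>m. (dens (u n) (u m) x / sqrt (q m x)) *\<^sub>R renumber (idx x) m"] elim
      by (simp add: good_def real_div_sqrt flip: q_def)
    then show ?case using elim by (simp add: T_def section_of_def sums_iff)
  qed
qed

lemma T_inject:
  assumes "AE x in M. T v x = T w x"
  shows "v = w"
proof -
  have "AE x in M. dens (v - w) (v - w) x = 0"
    using assms T_diff[of v w] T_norm[of "v - w"] by eventually_elim simp
  then have "(\<integral>x. dens (v - w) (v - w) x \<partial>M) = 0" by (rule integral_eq_zero_AE)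
  then show ?thesis by (simp add: dens_integral)
qed

lemma T_norm_integrable: "integrable M (\<lambda>x. (norm (T v x))\<^sup>2)"
  by (rule Bochner_Integration.integrable_cong_AE[THEN iffD2, OF _ _ T_norm[of v]]) auto

end

section \<open>Surjectivity of the transform\<close>

context cyclic_system
begin

text \<open>The Riesz vector \<open>v0\<close> of the functional \<open>F\<close> makes
  \<open>f - T v0\<close> orthogonal to the range after integration. Replacing \<open>v\<close> by
  its projections localizes this to cylinders, hence to almost every point, where the transforms of
  \<open>u n\<close> and \<open>I (u n)\<close> leave no room in the fiber.\<close>

lemma T_surj:
  assumes f [measurable]: "f \<in> borel_measurable borel" and fib: "AE x in M. f x \<in> cx (fiber (mult x))"
    and sq: "integrable M (\<lambda>x. (norm (f x))\<^sup>2)"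
  obtains v where "AE x in M. T v x = f x"
proof -
  have am_gm: "\<bar>inner (T v x) (f x)\<bar> \<le> (1/2) * ((norm (T v x))\<^sup>2 + (norm (f x))\<^sup>2)" for v x
  proof -
    have "0 \<le> (norm (T v x) - norm (f x))\<^sup>2" by simp
    then have "2 * (norm (T v x) * norm (f x)) \<le> (norm (T v x))\<^sup>2 + (norm (f x))\<^sup>2"
      unfolding power2_diff by linarith
    moreover have "a \<le> (1/2) * c" if "2 * b \<le> c" "a \<le> b" for a b c :: real using that by simp
    ultimately show ?thesis using Cauchy_Schwarz_ineq2[of "T v x" "f x"] by blast
  qed
  have int: "integrable M (\<lambda>x. inner (T v x) (f x))" for v
    by (rule Bochner_Integration.integrable_bound[of M "\<lambda>x. (1/2) * ((norm (T v x))\<^sup>2 + (norm (f x))\<^sup>2)"])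
      (use T_norm_integrable sq am_gm in \<open>auto simp del: distrib_left_numeral\<close>)
  define F where "F v = (\<integral>x. inner (T v x) (f x) \<partial>M)" for v
  have F: "linear F"
  proof (rule linearI)
    show "F (v + w) = F v + F w" for v w
    proof -
      have "F (v + w) = (\<integral>x. inner (T v x) (f x) + inner (T w x) (f x) \<partial>M)"
        unfolding F_def
      proof (rule integral_cong_AE)
        show "AE x in M. inner (T (v + w) x) (f x) = inner (T v x) (f x) + inner (T w x) (f x)"
          using T_add[of v w] by eventually_elim (simp add: inner_add_left)
      qed measurable
      then show ?thesis using int by (simp add: F_def)
    qed
    show "F (r *\<^sub>R v) = r *\<^sub>R F v" for r v
    proof -
      have "F (r *\<^sub>R v) = (\<integral>x. r * inner (T v x) (f x) \<partial>M)"
        unfolding F_def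
      proof (rule integral_cong_AE)
        show "AE x in M. inner (T (r *\<^sub>R v) x) (f x) = r * inner (T v x) (f x)"
          using T_scaleR[of r v] by eventually_elim simp
      qed measurable
      then show ?thesis by (simp add: F_def)
    qed
  qed
  \<comment> \<open>This is the bound obtained from \<open>am_gm\<close> at unit vectors;
    homogeneity extends it to all vectors.\<close>
  define C where "C = (1 + (\<integral>x. (norm (f x))\<^sup>2 \<partial>M)) / 2"
  have norm_int: "(\<integral>x. (norm (T v x))\<^sup>2 \<partial>M) = (norm v)\<^sup>2" for v
    using T_norm[of v] by (subst integral_cong_AE[OF _ _ T_norm[of v]]) (auto simp: dens_integral power2_norm_eq_inner)
  have bound: "\<bar>F v\<bar> \<le> ((norm v)\<^sup>2 + (\<integral>x. (norm (f x))\<^sup>2 \<partial>M)) / 2" for v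
  proof -
    have "\<bar>F v\<bar> \<le> (\<integral>x. \<bar>inner (T v x) (f x)\<bar> \<partial>M)" unfolding F_def by (rule integral_abs_bound)
    also have "\<dots> \<le> (\<integral>x. (1/2) * ((norm (T v x))\<^sup>2 + (norm (f x))\<^sup>2) \<partial>M)"
    proof (rule integral_mono)
      show "\<bar>inner (T v x) (f x)\<bar> \<le> (1/2) * ((norm (T v x))\<^sup>2 + (norm (f x))\<^sup>2)" for x by (rule am_gm)
    qed (use int T_norm_integrable sq in auto)
    also have "\<dots> = ((norm v)\<^sup>2 + (\<integral>x. (norm (f x))\<^sup>2 \<partial>M)) / 2"
      using T_norm_integrable sq by (simp add: norm_int)
    finally show ?thesis .
  qed
  have bound': "\<bar>F v\<bar> \<le> C * norm v" for v
  proof (cases "v = 0")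
    case True
    then show ?thesis using linear_0[OF F] by simp
  next
    case False
    have "\<bar>F v\<bar> = norm v * \<bar>F (v /\<^sub>R norm v)\<bar>" using False by (simp add: linear_scale[OF F] abs_mult)
    also have "\<dots> \<le> norm v * C" using bound[of "v /\<^sub>R norm v"] False by (intro mult_left_mono) (auto simp: C_def)
    finally show ?thesis by (simp add: mult.commute)
  qed
  obtain v0 where v0: "\<And>v. F v = inner v v0"
    using riesz_on_closed_subspace[of UNIV F C] F bound' by auto
  define h where "h x = f x - T v0 x" for x
  have h [measurable]: "h \<in> borel_measurable borel" unfolding h_def[abs_def] by measurable
  have int0: "integrable M (\<lambda>x. inner (T v x) (T v0 x))" for v
    by (rule Bochner_Integration.integrable_cong_AE[THEN iffD2, OF _ _ T_inner]) auto
  then have inth: "integrable M (\<lambda>x. inner (T v x) (h x))" for v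
    using int[of v] by (simp add: h_def inner_diff_right)
  have h0: "(\<integral>x. inner (T v x) (h x) \<partial>M) = 0" for v
  proof -
    have "(\<integral>x. inner (T v x) (T v0 x) \<partial>M) = inner v v0"
      by (subst integral_cong_AE[OF _ _ T_inner[of v v0]]) (auto simp: dens_integral)
    then show ?thesis using int[of v] int0[of v] v0[of v] by (simp add: h_def inner_diff_right F_def)
  qed
  have orth: "AE x in M. inner (T v x) (h x) = 0" for v
  proof (rule AE_eq_cyl)
    fix x n
    have "(LINT y:cyl x n|M. inner (T v y) (h y)) = (\<integral>y. inner (T (Q x n v) y) (h y) \<partial>M)"
      unfolding set_lebesgue_integral_def
    proof (rule integral_cong_AE)
      show "AE y in M. indicat_real (cyl x n) y *\<^sub>R inner (T v y) (h y) = inner (T (Q x n v) y) (h y)"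
        using T_Q[of x n v] by eventually_elim simp
    qed measurable
    then show "(LINT y:cyl x n|M. inner (T v y) (h y)) = (LINT y:cyl x n|M. 0)" by (simp add: h0)
  qed (use inth in auto)
  have "AE x in M. \<forall>n. inner (T (u n) x) (h x) = 0" "AE x in M. \<forall>n. inner (T (I (u n)) x) (h x) = 0"
    using orth by (simp_all add: AE_all_countable)
  moreover have "AE x in M. \<forall>n. T (u n) x = (sqrt (q n x) *\<^sub>R renumber (idx x) n, 0)"
    using T_u by (simp add: AE_all_countable)
  moreover have "AE x in M. \<forall>n. T (I (u n)) x = cx_scale \<i> (T (u n) x)"
    using T_I by (simp add: AE_all_countable)
  ultimately have "AE x in M. h x = 0" using AE_good fib T_fiber[of v0]
  proof eventually_elim
    case (elim x)
    have hx: "h x \<in> cx (fiber (mult x))" unfolding h_def using elim by (intro subspace_diff subspace_cx_fiber)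
    have "inner (renumber (idx x) n) (fst (h x)) = 0" "inner (renumber (idx x) n) (snd (h x)) = 0"
      if n: "n \<in> idx x" for n
      using elim(1)[rule_format, of n] elim(2)[rule_format, of n] n elim(5)
      by (auto simp: elim(3,4) cx_scale_i inner_prod_def good_def)
    then have "fst (h x) = 0" "snd (h x) = 0"
      using fiber_eq_0[of _ "idx x"] hx unfolding mult_def cx_def by (cases "h x"; force)+
    then show ?case by (simp add: prod_eq_iff)
  qed
  then have "AE x in M. T v0 x = f x" by eventually_elim (simp add: h_def)
  then show thesis by (rule that)
qed

end

section \<open>Isometries of the fibers\<close>

text \<open>Surjectivity is left out: it cannot be read off from the images of basis vectors, and
  will come from the relation \<open>J k (J k v) = - v\<close>.\<close>

definition iso_on :: "enat \<Rightarrow> (ell2 \<times> ell2 \<Rightarrow> ell2 \<times> ell2) \<Rightarrow> bool" where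
  "iso_on \<nu> A \<longleftrightarrow>
     (\<forall>v\<in>cx (fiber \<nu>). A v \<in> cx (fiber \<nu>) \<and> norm (A v) = norm v) \<and>
     (\<forall>v\<in>cx (fiber \<nu>). \<forall>w\<in>cx (fiber \<nu>). A (v + w) = A v + A w) \<and>
     (\<forall>z. \<forall>v\<in>cx (fiber \<nu>). A (cx_scale z v) = cx_scale z (A v))"

lemma cx_scale_fiber: "v \<in> cx (fiber \<nu>) \<Longrightarrow> cx_scale z v \<in> cx (fiber \<nu>)"
  by (auto simp: cx_def cx_scale_def intro!: subspace_add subspace_diff subspace_scale subspace_fiber)

lemma cx_scale_of_real: "cx_scale (complex_of_real r) v = r *\<^sub>R v"
  by (simp add: cx_scale_def prod_eq_iff)

lemma norm_cx_scale: "norm (cx_scale z (v :: ell2 \<times> ell2)) = cmod z * norm v"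
proof -
  have "(norm (cx_scale z v))\<^sup>2 = (cmod z * norm v)\<^sup>2"
  proof (cases v)
    case (Pair a b)
    show ?thesis
      by (simp add: Pair cx_scale_def power_mult_distrib cmod_power2 power2_norm_eq_inner[of "(_, _)"] inner_add inner_diff
          inner_commute[of b a]) (simp add: power2_eq_square algebra_simps)
  qed
  then show ?thesis by (simp add: power2_eq_iff_nonneg)
qed

lemma iso_on_scaleR: "iso_on \<nu> A \<Longrightarrow> v \<in> cx (fiber \<nu>) \<Longrightarrow> A (r *\<^sub>R v) = r *\<^sub>R A v"
  unfolding iso_on_def by (metis cx_scale_of_real)

lemma iso_on_diff:
  assumes "iso_on \<nu> A" "v \<in> cx (fiber \<nu>)" "w \<in> cx (fiber \<nu>)"
  shows "A (v - w) = A v - A w"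
proof -
  have "A (v + (- 1) *\<^sub>R w) = A v + A ((- 1) *\<^sub>R w)"
    using assms subspace_scale[OF subspace_cx_fiber assms(3)] unfolding iso_on_def by blast
  then show ?thesis using iso_on_scaleR[OF assms(1,3), of "- 1"] by simp
qed

lemma iso_on_inner:
  assumes "iso_on \<nu> A" "v \<in> cx (fiber \<nu>)" "w \<in> cx (fiber \<nu>)"
  shows "inner (A v) (A w) = inner v w"
proof -
  have "A v + A w = A (v + w)" "norm (A (v + w)) = norm (v + w)" "norm (A v) = norm v" "norm (A w) = norm w"
    using assms subspace_add[OF subspace_cx_fiber assms(2,3)] unfolding iso_on_def by auto
  then show ?thesis by (simp add: dot_norm)
qed

lemma iso_on_cx_inner:
  assumes "iso_on \<nu> A" "v \<in> cx (fiber \<nu>)" "w \<in> cx (fiber \<nu>)"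
  shows "cx_inner (A v) (A w) = cx_inner v w"
proof -
  have "cx_scale \<i> (A w) = A (cx_scale \<i> w)" using assms unfolding iso_on_def by simp
  then show ?thesis using assms by (simp add: cx_inner_eq iso_on_inner cx_scale_fiber)
qed

lemma iso_on_comp: "iso_on \<nu> A \<Longrightarrow> iso_on \<nu> B \<Longrightarrow> iso_on \<nu> (\<lambda>v. A (B v))"
  unfolding iso_on_def by simp

lemma cx_scale_scale: "cx_scale a (cx_scale b v) = cx_scale (a * b) v"
  by (simp add: cx_scale_def algebra_simps)

lemma iso_on_scale: "iso_on \<nu> A \<Longrightarrow> cmod a = 1 \<Longrightarrow> iso_on \<nu> (\<lambda>v. cx_scale a (A v))"
  unfolding iso_on_def by (auto simp: cx_scale_fiber norm_cx_scale cx_scale_scale mult.commute cx.scale_right_distrib)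

lemma iso_on_uminus: "iso_on \<nu> (\<lambda>v. - v)"
  unfolding iso_on_def using subspace_neg[OF subspace_cx_fiber] by (auto simp: cx_scale_def)

lemma cx_cnj_fiber: "v \<in> cx (fiber \<nu>) \<Longrightarrow> cx_cnj v \<in> cx (fiber \<nu>)"
  by (auto simp: cx_def cx_cnj_def intro: subspace_neg[OF subspace_fiber])

lemma cx_cnj_scale: "cx_cnj (cx_scale z v) = cx_scale (cnj z) (cx_cnj v)"
  by (simp add: cx_cnj_def cx_scale_def algebra_simps)

lemma cx_cnj_add: "cx_cnj (v + w) = cx_cnj v + cx_cnj w"
  by (simp add: cx_cnj_def)

lemma norm_cx_cnj [simp]: "norm (cx_cnj (v :: ell2 \<times> ell2)) = norm v"
  by (cases v) (simp add: cx_cnj_def norm_Pair)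

lemma cx_cnj_scaleR: "cx_cnj (r *\<^sub>R v) = r *\<^sub>R cx_cnj v"
  by (simp add: cx_cnj_def)

lemma iso_on_cnj: "iso_on \<nu> A \<Longrightarrow> iso_on \<nu> (\<lambda>v. cx_cnj (A (cx_cnj v)))"
  unfolding iso_on_def by (auto simp: cx_cnj_fiber cx_cnj_scale cx_cnj_add)

lemma iso_on_unitary:
  assumes "iso_on \<nu> A" "\<And>v. v \<in> cx (fiber \<nu>) \<Longrightarrow> \<exists>w\<in>cx (fiber \<nu>). A w = v"
  shows "cx_unitary_on (cx (fiber \<nu>)) A"
  using assms iso_on_cx_inner[OF assms(1)] unfolding cx_unitary_on_def iso_on_def by (auto simp: image_iff) metis

lemma iso_on_add: "iso_on \<nu> A \<Longrightarrow> v \<in> cx (fiber \<nu>) \<Longrightarrow> w \<in> cx (fiber \<nu>) \<Longrightarrow> A (v + w) = A v + A w"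
  and iso_on_cx_scale: "iso_on \<nu> A \<Longrightarrow> v \<in> cx (fiber \<nu>) \<Longrightarrow> A (cx_scale z v) = cx_scale z (A v)"
  and iso_on_norm: "iso_on \<nu> A \<Longrightarrow> v \<in> cx (fiber \<nu>) \<Longrightarrow> norm (A v) = norm v"
  and iso_on_mem: "iso_on \<nu> A \<Longrightarrow> v \<in> cx (fiber \<nu>) \<Longrightarrow> A v \<in> cx (fiber \<nu>)"
  by (simp_all add: iso_on_def)

text \<open>The set of agreement is closed under real combinations, limits and multiplication by
  \<i>, and the vectors \<open>(ebase j, 0)\<close> generate the fiber in this sense. Operator
  identities thereby reduce to countably many tests.\<close>

lemma iso_on_ext:
  assumes A: "iso_on \<nu> A" and B: "iso_on \<nu> B"
    and eq: "\<And>j. enat j < \<nu> \<Longrightarrow> A (ebase j, 0) = B (ebase j, 0)" and v: "v \<in> cx (fiber \<nu>)"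
  shows "A v = B v"
proof -
  let ?E = "{w \<in> cx (fiber \<nu>). A w = B w}"
  have sub: "subspace ?E"
  proof (rule subspaceI)
    show "0 \<in> ?E" using iso_on_scaleR[OF A, of 0 0] iso_on_scaleR[OF B, of 0 0] subspace_0[OF subspace_cx_fiber] by simp
    show "x + y \<in> ?E" if "x \<in> ?E" "y \<in> ?E" for x y
      using that by (simp add: iso_on_add[OF A] iso_on_add[OF B] subspace_add[OF subspace_cx_fiber])
    show "c *\<^sub>R x \<in> ?E" if "x \<in> ?E" for c x
      using that by (simp add: iso_on_scaleR[OF A] iso_on_scaleR[OF B] subspace_scale[OF subspace_cx_fiber])
  qed
  have lim: "w \<in> ?E" if Xw: "X \<longlonglongrightarrow> w" and XE: "\<And>n. X n \<in> ?E" for X w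
  proof -
    have w: "w \<in> cx (fiber \<nu>)" by (rule closed_sequentially[OF closed_cx_fiber _ Xw]) (use XE in simp)
    have conv: "(\<lambda>n. C (X n)) \<longlonglongrightarrow> C w" if C: "iso_on \<nu> C" for C
    proof (rule LIM_zero_cancel, rule tendsto_norm_zero_cancel)
      have "norm (C (X n) - C w) = norm (X n - w)" for n
      proof -
        have X: "X n \<in> cx (fiber \<nu>)" using XE[of n] by simp
        show ?thesis
          unfolding iso_on_diff[OF C X w, symmetric] by (intro iso_on_norm[OF C] subspace_diff subspace_cx_fiber X w)
      qed
      then show "(\<lambda>n. norm (C (X n) - C w)) \<longlonglongrightarrow> 0"
        using tendsto_norm_zero[OF LIM_zero[OF Xw]] by simp
    qed
    have "A (X n) = B (X n)" for n using XE[of n] by simp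
    then have "A w = B w" using LIMSEQ_unique[OF conv[OF A]] conv[OF B] by simp
    then show ?thesis using w by simp
  qed
  have re: "(a, 0) \<in> ?E" if a: "a \<in> fiber \<nu>" for a
  proof (rule lim)
    have "(\<lambda>n. \<Sum>j<n. seq_of a j *\<^sub>R ebase j) \<longlonglongrightarrow> a" using ell2_sums[of a] by (simp add: sums_def)
    then have "(\<lambda>n. (\<Sum>j<n. seq_of a j *\<^sub>R ebase j, 0)) \<longlonglongrightarrow> (a, 0 :: ell2)" by (intro tendsto_Pair tendsto_const)
    moreover have "(\<Sum>j<n. seq_of a j *\<^sub>R ebase j, 0 :: ell2) = (\<Sum>j<n. seq_of a j *\<^sub>R (ebase j, 0))" for n
      by (simp add: prod_eq_iff fst_sum snd_sum)
    ultimately show "(\<lambda>n. \<Sum>j<n. seq_of a j *\<^sub>R (ebase j, 0 :: ell2)) \<longlonglongrightarrow> (a, 0)" by simp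
    have "seq_of a j *\<^sub>R (ebase j, 0) \<in> ?E" for j
    proof (cases "enat j < \<nu>")
      case True
      then have "(ebase j, 0) \<in> ?E" using eq by (simp add: cx_def ebase_fiber subspace_0[OF subspace_fiber])
      then show ?thesis by (rule subspace_scale[OF sub])
    next
      case False
      then have "seq_of a j = 0" using a by (simp add: fiber_def)
      then show ?thesis using subspace_0[OF sub] by (simp add: zero_prod_def)
    qed
    then show "(\<Sum>j<n. seq_of a j *\<^sub>R (ebase j, 0)) \<in> ?E" for n by (intro subspace_sum[OF sub])
  qed
  have im: "cx_scale \<i> w \<in> ?E" if "w \<in> ?E" for w
    using that by (simp add: iso_on_cx_scale[OF A] iso_on_cx_scale[OF B] cx_scale_fiber)
  have "v = (fst v, 0) + cx_scale \<i> (snd v, 0)" by (simp add: cx_scale_i prod_eq_iff)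
  moreover have "fst v \<in> fiber \<nu>" "snd v \<in> fiber \<nu>" using v by (auto simp: cx_def)
  moreover have "(fst v, 0) + cx_scale \<i> (snd v, 0) \<in> ?E"
    using calculation by (intro subspace_add[OF sub] im re) auto
  ultimately have "v \<in> ?E" by simp
  then show ?thesis by simp
qed

section \<open>Operators defined by orthonormal families\<close>

definition fam_op :: "(nat \<Rightarrow> ell2 \<times> ell2) \<Rightarrow> ell2 \<times> ell2 \<Rightarrow> ell2 \<times> ell2" where
  "fam_op Y v = (\<Sum>j. seq_of (fst v) j *\<^sub>R Y j) + cx_scale \<i> (\<Sum>j. seq_of (snd v) j *\<^sub>R Y j)"

text \<open>Complex orthonormality in terms of the real inner product. Entries from index
  \<open>\<nu>\<close> on are forced to be zero, so that one kind of sequence serves all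
  dimensions.\<close>

definition orthonormal_family :: "enat \<Rightarrow> (nat \<Rightarrow> ell2 \<times> ell2) \<Rightarrow> bool" where
  "orthonormal_family \<nu> Y \<longleftrightarrow>
     (\<forall>i j. inner (Y i) (Y j) = (if i = j \<and> enat j < \<nu> then 1 else 0)) \<and>
     (\<forall>i j. inner (Y i) (cx_scale \<i> (Y j)) = 0)"

lemma bounded_linear_cx_scale: "bounded_linear (cx_scale z :: ell2 \<times> ell2 \<Rightarrow> _)"
proof (rule bounded_linear_intro[where K = "cmod z"])
  show "cx_scale z (r *\<^sub>R x) = r *\<^sub>R cx_scale z x" for r and x :: "ell2 \<times> ell2"
    by (simp add: cx_scale_def algebra_simps prod_eq_iff)
qed (simp_all add: cx.scale_right_distrib norm_cx_scale mult.commute)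

lemma inner_cx_scale_i: "inner (cx_scale \<i> v) (cx_scale \<i> w) = inner v (w :: ell2 \<times> ell2)"
  by (simp add: cx_scale_i inner_prod_def)

lemma inner_cx_scale_i_left: "inner (cx_scale \<i> v) w = - inner v (cx_scale \<i> (w :: ell2 \<times> ell2))"
  by (simp add: cx_scale_i inner_prod_def)

lemma fam_op_sums:
  assumes Y: "orthonormal_family \<nu> Y"
  shows "summable (\<lambda>j. seq_of a j *\<^sub>R Y j)"
    and "a \<in> fiber \<nu> \<Longrightarrow> norm (\<Sum>j. seq_of a j *\<^sub>R Y j) = norm a"
proof -
  let ?f = "\<lambda>j. seq_of a j *\<^sub>R Y j"
  have nY: "(norm (Y j))\<^sup>2 = (if enat j < \<nu> then 1 else 0)" for j
    using Y by (simp add: power2_norm_eq_inner orthonormal_family_def)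
  have nf: "(norm (?f j))\<^sup>2 = (seq_of a j)\<^sup>2 * (if enat j < \<nu> then 1 else 0)" for j
    by (simp add: power_mult_distrib nY)
  have o: "inner (?f i) (?f j) = 0" if "i \<noteq> j" for i j
    using that Y by (simp add: orthonormal_family_def)
  have sm: "summable (\<lambda>j. (norm (?f j))\<^sup>2)"
    unfolding nf by (rule summable_comparison_test'[OF summable_seq_of[of a], of 0]) auto
  have os: "summable ?f" "(norm (suminf ?f))\<^sup>2 = (\<Sum>j. (norm (?f j))\<^sup>2)"
    using orthogonal_series[of ?f] o sm by blast+
  show "summable ?f" by (rule os)
  assume a: "a \<in> fiber \<nu>"
  have seq: "(seq_of a j)\<^sup>2 * (if enat j < \<nu> then 1 else 0) = (seq_of a j)\<^sup>2" for j
    using a by (auto simp: fiber_def not_less)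
  have "(norm (suminf ?f))\<^sup>2 = (norm a)\<^sup>2" unfolding os(2) nf seq by (simp only: norm_ell2_sq)
  then show "norm (suminf ?f) = norm a" by (simp add: power2_eq_iff_nonneg)
qed

lemma inner_suminf_left:
  fixes f :: "nat \<Rightarrow> ell2 \<times> ell2"
  assumes "summable f"
  shows "(\<lambda>j. inner (f j) w) sums inner (suminf f) w"
  using bounded_linear.sums[OF bounded_linear_inner_left summable_sums[OF assms]] .

lemma fam_op_norm:
  assumes Y: "orthonormal_family \<nu> Y" and v: "v \<in> cx (fiber \<nu>)"
  shows "norm (fam_op Y v) = norm v"
proof -
  note sm = fam_op_sums[OF Y]
  let ?A = "\<lambda>a. \<Sum>j. seq_of a j *\<^sub>R Y j"
  have 1: "inner (Y i) (cx_scale \<i> (?A b)) = 0" for i b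
  proof -
    have "inner (?A b) (cx_scale \<i> (Y i)) = 0"
      using inner_suminf_left[OF sm(1)[of b], of "cx_scale \<i> (Y i)"] Y
      by (simp add: orthonormal_family_def sums_iff)
    then show ?thesis
      using inner_cx_scale_i_left[of "Y i" "?A b"] inner_commute[of "?A b" "cx_scale \<i> (Y i)"] by simp
  qed
  have 2: "inner (?A a) (cx_scale \<i> (?A b)) = 0" for a b
    using inner_suminf_left[OF sm(1)[of a], of "cx_scale \<i> (?A b)"] by (simp add: 1 sums_iff)
  then have "(norm (fam_op Y v))\<^sup>2 = (norm (?A (fst v)))\<^sup>2 + (norm (?A (snd v)))\<^sup>2"
    unfolding fam_op_def power2_norm_eq_inner
    by (simp add: inner_add_left inner_add_right inner_cx_scale_i inner_commute[of "cx_scale \<i> (?A (snd v))" "?A (fst v)"])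
  also have "\<dots> = (norm v)\<^sup>2" using v sm(2) by (cases v) (auto simp: cx_def norm_Pair)
  finally show ?thesis by (simp add: power2_eq_iff_nonneg)
qed

lemma fam_op_add:
  assumes Y: "orthonormal_family \<nu> Y"
  shows "fam_op Y (v + w) = fam_op Y v + fam_op Y w"
proof -
  have "(\<Sum>j. seq_of (a + b) j *\<^sub>R Y j) = (\<Sum>j. seq_of a j *\<^sub>R Y j) + (\<Sum>j. seq_of b j *\<^sub>R Y j)" for a b
    using suminf_add[OF fam_op_sums(1)[OF Y] fam_op_sums(1)[OF Y], of a b] by (simp add: seq_of_add scaleR_left_distrib)
  then show ?thesis by (simp add: fam_op_def cx.scale_right_distrib)
qed

lemma fam_op_scale:
  assumes Y: "orthonormal_family \<nu> Y"
  shows "fam_op Y (cx_scale z v) = cx_scale z (fam_op Y v)"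
proof -
  let ?A = "\<lambda>a. \<Sum>j. seq_of a j *\<^sub>R Y j"
  have A_sc: "?A (r *\<^sub>R a) = r *\<^sub>R ?A a" for r a
    using suminf_scaleR_right[OF fam_op_sums(1)[OF Y], of r a] by (simp add: seq_of_scaleR)
  have A_add: "?A (a + b) = ?A a + ?A b" for a b
    using suminf_add[OF fam_op_sums(1)[OF Y] fam_op_sums(1)[OF Y], of a b] by (simp add: seq_of_add scaleR_left_distrib)
  have A_diff: "?A (a - b) = ?A a - ?A b" for a b
    using A_add[of a "(- 1) *\<^sub>R b"] A_sc[of "- 1" b] by simp
  show ?thesis
    unfolding fam_op_def cx_scale_def[of z v] fst_conv snd_conv A_add A_diff A_sc
    by (simp add: cx_scale_def prod_eq_iff algebra_simps)
qed

lemma fam_op_iso_on: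
  assumes Y: "orthonormal_family \<nu> Y" and fib: "\<And>j. Y j \<in> cx (fiber \<nu>)"
  shows "iso_on \<nu> (fam_op Y)"
proof -
  have "(\<Sum>j. seq_of a j *\<^sub>R Y j) \<in> cx (fiber \<nu>)" for a
  proof (rule closed_sequentially[OF closed_cx_fiber])
    show "(\<lambda>n. \<Sum>j<n. seq_of a j *\<^sub>R Y j) \<longlonglongrightarrow> (\<Sum>j. seq_of a j *\<^sub>R Y j)"
      by (rule summable_LIMSEQ[OF fam_op_sums(1)[OF Y]])
    show "(\<Sum>j<n. seq_of a j *\<^sub>R Y j) \<in> cx (fiber \<nu>)" for n
      by (intro subspace_sum subspace_scale subspace_cx_fiber fib)
  qed
  then have "fam_op Y v \<in> cx (fiber \<nu>)" for v
    unfolding fam_op_def by (intro subspace_add subspace_cx_fiber cx_scale_fiber)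
  then show ?thesis using fam_op_norm[OF Y] fam_op_add[OF Y] fam_op_scale[OF Y] by (simp add: iso_on_def)
qed

text \<open>This is the equality case of Cauchy-Schwarz: the coefficients give
  \<open>inner (fam_op Y v) w = (norm v)\<^sup>2\<close>, while both vectors have norm
  \<open>norm v\<close>. So \<open>w\<close> is identified without completeness of the
  family.\<close>

lemma fam_op_eqI:
  assumes Y: "orthonormal_family \<nu> Y" and v: "v \<in> cx (fiber \<nu>)" and n: "norm w = norm v"
    and re: "\<And>j. inner w (Y j) = seq_of (fst v) j" and im: "\<And>j. inner w (cx_scale \<i> (Y j)) = seq_of (snd v) j"
  shows "fam_op Y v = w"
proof -
  let ?A = "\<lambda>a. \<Sum>j. seq_of a j *\<^sub>R Y j"
  have "(\<lambda>j. (seq_of (fst v) j)\<^sup>2) sums inner (?A (fst v)) w"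
    using inner_suminf_left[OF fam_op_sums(1)[OF Y], of "fst v" w] by (simp add: inner_commute re power2_eq_square)
  then have 1: "inner (?A (fst v)) w = (norm (fst v))\<^sup>2" by (simp add: norm_ell2_sq sums_iff)
  have "inner (Y j) (cx_scale \<i> w) = - seq_of (snd v) j" for j
    using im[of j] inner_cx_scale_i_left[of "Y j" w] inner_commute[of w "cx_scale \<i> (Y j)"] by simp
  then have "(\<lambda>j. - (seq_of (snd v) j)\<^sup>2) sums inner (?A (snd v)) (cx_scale \<i> w)"
    using inner_suminf_left[OF fam_op_sums(1)[OF Y], of "snd v" "cx_scale \<i> w"] by (simp add: power2_eq_square)
  then have "inner (?A (snd v)) (cx_scale \<i> w) = - (norm (snd v))\<^sup>2"
    using suminf_minus[OF summable_seq_of[of "snd v"]] by (simp add: norm_ell2_sq sums_iff)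
  then have "inner (fam_op Y v) w = (norm (fst v))\<^sup>2 + (norm (snd v))\<^sup>2"
    unfolding fam_op_def by (simp add: inner_add_left 1 inner_cx_scale_i_left)
  also have "\<dots> = (norm v)\<^sup>2" by (cases v) (simp add: norm_Pair)
  finally have "inner (fam_op Y v) w = (norm v)\<^sup>2" .
  moreover have "(norm (fam_op Y v - w))\<^sup>2 = (norm (fam_op Y v))\<^sup>2 + (norm w)\<^sup>2 - 2 * inner (fam_op Y v) w"
    by (simp add: power2_norm_eq_inner inner_diff inner_commute[of w "fam_op Y v"])
  ultimately have "(norm (fam_op Y v - w))\<^sup>2 = 0" using fam_op_norm[OF Y v] n by simp
  then show ?thesis by simp
qed

lemma seq_of_uminus: "seq_of (- x) n = - seq_of x n"
  by (simp add: uminus_ell2.rep_eq)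

lemma finite_bessel:
  fixes z :: "'k \<Rightarrow> 'b::real_inner"
  assumes K: "finite K" and z: "\<And>i j. i \<in> K \<Longrightarrow> j \<in> K \<Longrightarrow> inner (z i) (z j) = (if i = j then 1 else 0)"
  shows "(\<Sum>k\<in>K. (inner (z k) v)\<^sup>2) \<le> (norm v)\<^sup>2"
proof -
  let ?w = "\<Sum>k\<in>K. inner (z k) v *\<^sub>R z k"
  have "inner ?w v = (\<Sum>k\<in>K. (inner (z k) v)\<^sup>2)" by (simp add: inner_sum_left power2_eq_square)
  moreover have "inner ?w ?w = (\<Sum>k\<in>K. (inner (z k) v)\<^sup>2)"
  proof -
    have "inner ?w ?w = (\<Sum>i\<in>K. \<Sum>j\<in>K. inner (z i) v * (inner (z j) v * inner (z j) (z i)))"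
      by (simp add: inner_sum_left inner_sum_right sum_distrib_left mult.assoc)
    also have "\<dots> = (\<Sum>i\<in>K. \<Sum>j\<in>K. if i = j then (inner (z i) v)\<^sup>2 else 0)"
      by (intro sum.cong refl) (auto simp: z power2_eq_square)
    also have "\<dots> = (\<Sum>i\<in>K. (inner (z i) v)\<^sup>2)" using K by simp
    finally show ?thesis .
  qed
  moreover have "0 \<le> inner (v - ?w) (v - ?w)" by simp
  moreover have "inner (v - ?w) (v - ?w) = inner v v + inner ?w ?w - 2 * inner ?w v"
    by (simp add: inner_diff inner_commute[of v ?w])
  ultimately show ?thesis by (simp add: power2_norm_eq_inner)
qed

text \<open>Counting dimensions by summing the squares of all matrix entries in two ways.\<close>

lemma orthonormal_family_le:
  assumes Y: "orthonormal_family \<nu> Y" and fib: "\<And>j. Y j \<in> cx (fiber \<nu>')"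
  shows "\<nu> \<le> \<nu>'"
proof (rule ccontr)
  assume "\<not> \<nu> \<le> \<nu>'"
  then obtain m where m: "\<nu>' = enat m" "enat m < \<nu>" by (cases \<nu>') auto
  \<comment> \<open>Over the reals \<open>Y 0\<close>, ..., \<open>Y m\<close> and their multiples
    by \<i> are \<open>2 * (m + 1)\<close> orthonormal vectors in a fiber of complex dimension
    \<open>m\<close>.\<close>
  define z where "z k = (if snd k then cx_scale \<i> (Y (fst k)) else Y (fst k))" for k :: "nat \<times> bool"
  have lt: "enat j < \<nu>" if "j \<le> m" for j using that m(2) by (meson enat_ord_simps(1) le_less_trans)
  have z: "inner (z i) (z j) = (if i = j then 1 else 0)" if "i \<in> {..m} \<times> UNIV" "j \<in> {..m} \<times> UNIV" for i j
    using that Y lt by (auto simp: z_def orthonormal_family_def inner_cx_scale_i inner_cx_scale_i_left prod_eq_iff)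
  \<comment> \<open>Bessel's inequality bounds the sum belonging to one basis vector by 1, whereas
    by \<open>col\<close> each unit vector \<open>Y j\<close> contributes exactly 1; summing both
    ways gives \<open>m + 1 \<le> m\<close>.\<close>
  have le1: "(\<Sum>k\<in>{..m} \<times> UNIV. (inner (z k) (ebase i, 0))\<^sup>2) \<le> 1" for i
    using finite_bessel[of "{..m} \<times> UNIV" z "(ebase i, 0)", OF _ z] by (simp add: norm_Pair)
  have col: "(\<Sum>i<m. (inner (z (j, False)) (ebase i, 0))\<^sup>2 + (inner (z (j, True)) (ebase i, 0))\<^sup>2) = 1" if j: "j \<le> m" for j
  proof -
    obtain a b where ab: "Y j = (a, b)" by (cases "Y j")
    have "a \<in> fiber (enat m)" "b \<in> fiber (enat m)" using fib[of j] ab m(1) by (auto simp: cx_def)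
    then have sq: "(norm a)\<^sup>2 = (\<Sum>i<m. (seq_of a i)\<^sup>2)" "(norm b)\<^sup>2 = (\<Sum>i<m. (seq_of b i)\<^sup>2)"
      unfolding norm_ell2_sq by (auto simp: fiber_def intro!: suminf_finite) (meson leI)+
    have "1 = (norm (Y j))\<^sup>2" using Y lt[OF j] by (simp add: power2_norm_eq_inner orthonormal_family_def)
    also have "\<dots> = (norm a)\<^sup>2 + (norm b)\<^sup>2" by (simp add: ab norm_Pair)
    finally show ?thesis by (simp add: z_def ab cx_scale_i inner_prod_def sq sum.distrib seq_of_uminus)
  qed
  have "real (Suc m) = (\<Sum>j\<le>m. \<Sum>i<m. (inner (z (j, False)) (ebase i, 0))\<^sup>2 + (inner (z (j, True)) (ebase i, 0))\<^sup>2)"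
    by (simp add: col)
  also have "\<dots> = (\<Sum>i<m. \<Sum>j\<le>m. (inner (z (j, False)) (ebase i, 0))\<^sup>2 + (inner (z (j, True)) (ebase i, 0))\<^sup>2)"
    by (rule sum.swap)
  also have "\<dots> = (\<Sum>i<m. \<Sum>k\<in>{..m} \<times> UNIV. (inner (z k) (ebase i, 0))\<^sup>2)"
  proof (intro sum.cong refl)
    fix i
    let ?g = "\<lambda>k. (inner (z k) (ebase i, 0))\<^sup>2"
    have "(\<Sum>j\<le>m. ?g (j, False) + ?g (j, True)) = (\<Sum>j\<le>m. \<Sum>b\<in>UNIV. ?g (j, b))"
      by (simp add: UNIV_bool add.commute)
    also have "\<dots> = (\<Sum>(j, b)\<in>{..m} \<times> UNIV. ?g (j, b))" by (rule sum.cartesian_product)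
    finally show "(\<Sum>j\<le>m. ?g (j, False) + ?g (j, True)) = (\<Sum>k\<in>{..m} \<times> UNIV. ?g k)" by (simp add: case_prod_unfold)
  qed
  also have "\<dots> \<le> (\<Sum>i<m. 1)" by (intro sum_mono le1)
  finally show False by simp
qed

section \<open>The generators as weighted translations\<close>

lemma add_seq_cancel [simp]: "(x \<oplus> d) \<oplus> d = x"
  by (auto simp: add_seq_def)

lemma flip_add_seq: "flip (x \<oplus> d) = flip x \<oplus> d"
  by (auto simp: add_seq_def flip_def)

lemma add_seq_measurable [measurable]: "(\<lambda>x. x \<oplus> d) \<in> measurable borel borel"
  by (rule measurable_binseqI) (simp add: add_seq_def)

lemma vimage_add_seq_cyl: "(\<lambda>x. x \<oplus> d) -` cyl x n = cyl (x \<oplus> d) n"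
  by (auto simp: cyl_def add_seq_def)

lemma Delta_induct [consumes 1, case_names zero add]:
  assumes "d \<in> Delta" and zero: "R (\<lambda>_. False)" and add: "\<And>d k. R d \<Longrightarrow> R (d \<oplus> delta k)"
  shows "R d"
proof -
  have "finite {j. d j}" using assms(1) by (simp add: Delta_def)
  then show ?thesis
  proof (induction "{j. d j}" arbitrary: d rule: finite_induct)
    case empty
    then have "d = (\<lambda>_. False)" by auto
    then show ?case using zero by simp
  next
    case (insert k F)
    have "F = {j. (d \<oplus> delta k) j}" using insert.hyps(2,4) by (auto simp: add_seq_def delta_def)
    then have "R (d \<oplus> delta k)" by (rule insert.hyps(3))
    from add[OF this, of k] show ?case by simp
  qed
qed

section \<open>Generators and translations of the spectrum\<close>

locale standard_system = cyclic_system N S u e0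
  for N :: "nat \<Rightarrow> 'v::complex_hilbert \<Rightarrow> 'v" and S and u :: "nat \<Rightarrow> 'v" and e0 :: 'v +
  fixes J :: "nat \<Rightarrow> 'v \<Rightarrow> 'v"
  assumes J_add: "J k (v + w) = J k v + J k w" and J_scaleC: "J k (scaleC z v) = scaleC z (J k v)"
    and J_norm: "norm (J k v) = norm v" and J_J: "J k (J k v) = - v"
    and J_anti: "k \<noteq> l \<Longrightarrow> J k (J l v) = - J l (J k v)"
    and J_N_same: "J k (N k v) = - N k (J k v)" and J_N: "k \<noteq> l \<Longrightarrow> J k (N l v) = N l (J k v)"
    and S_J: "S (J k v) = J k (S v)"
begin

lemma J_linear: "linear (J k)"
  by (rule linearI) (simp_all add: J_add J_scaleC scaleR_scaleC)

lemma J_inner: "inner (J k v) (J k w) = inner v w"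
  by (rule linear_norm_preserving_inner[OF J_linear J_norm])

lemma J_Q: "J k (Q x n v) = Q (x \<oplus> delta k) n (J k v)"
proof (induction n)
  case (Suc n)
  have "J k (P n b w) = P n (if n = k then \<not> b else b) (J k w)" for b w
    using J_N[of k n w] J_N_same[of k w]
    by (simp add: P_def linear_add[OF J_linear] linear_diff[OF J_linear] linear_scale[OF J_linear] linear_neg[OF J_linear])
  then show ?case using Suc by (auto simp: add_seq_def delta_def)
qed simp

lemma distr_spec: "distr (spec v) borel (\<lambda>x. x \<oplus> delta k) = spec (J k v)"
proof (rule sym, rule spec_eqI)
  interpret finite_measure "spec v" by (rule spec)
  have m: "(\<lambda>x. x \<oplus> delta k) \<in> measurable (spec v) borel"
    by (simp add: measurable_cong_sets[OF spec(1) refl])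
  show "finite_measure (distr (spec v) borel (\<lambda>x. x \<oplus> delta k))" by (rule finite_measure_distr[OF m])
  show "measure (distr (spec v) borel (\<lambda>x. x \<oplus> delta k)) (cyl x n) = (norm (Q x n (J k v)))\<^sup>2" for x n
    using J_Q[of k "x \<oplus> delta k" n v] J_norm[of k "Q (x \<oplus> delta k) n v"]
    by (simp add: measure_distr[OF m] vimage_add_seq_cyl spec)
qed simp

lemma translate_M: "translate M (delta k) = spec (J k e0)"
  unfolding translate_def M_def by (rule distr_spec)

text \<open>The translated measure is the spectral measure of \<open>J k e0\<close>, and
  \<open>M\<close> dominates the spectral measure of every vector.\<close>

lemma AE_translate_delta:
  assumes "AE x in M. R x"
  shows "AE x in M. R (x \<oplus> delta k)"
proof -
  have "AE x in translate M (delta k). R x"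
    unfolding translate_M by (rule absolutely_continuous_AE[OF _ _ assms]) (auto simp: spec M_def e0_ac)
  then show ?thesis unfolding translate_def by (rule AE_distrD[rotated]) simp
qed

lemma AE_translate: "d \<in> Delta \<Longrightarrow> AE x in M. R x \<Longrightarrow> AE x in M. R (x \<oplus> d)"
proof (induction arbitrary: R rule: Delta_induct)
  case zero
  then show ?case by (simp add: add_seq_def)
next
  case (add d k)
  have "AE x in M. R (x \<oplus> delta k \<oplus> d)" by (rule AE_translate_delta[OF add.IH[OF add.prems]])
  moreover have "x \<oplus> delta k \<oplus> d = x \<oplus> (d \<oplus> delta k)" for x by (auto simp: add_seq_def)
  ultimately show ?case by simp
qed

text \<open>Both directions follow from \<open>AE_translate\<close>, because \<open>d\<close> is its
  own inverse.\<close>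

lemma M_quasi_invariant:
  assumes d: "d \<in> Delta"
  shows "equivalent_measures (translate M d) M"
  unfolding equivalent_measures_def absolutely_continuous_def
proof (intro conjI subsetI)
  have em: "emeasure (translate M d) A = emeasure M ((\<lambda>x. x \<oplus> d) -` A)" if "A \<in> sets borel" for A
    unfolding translate_def using that by (subst emeasure_distr) auto
  have vim: "(\<lambda>x. x \<oplus> d) -` A \<in> sets borel" if "A \<in> sets borel" for A
    using measurable_sets[OF add_seq_measurable that] by simp
  have null: "A \<in> null_sets (translate M d) \<longleftrightarrow> (\<lambda>x. x \<oplus> d) -` A \<in> null_sets M" if A: "A \<in> sets borel" for A
    unfolding null_sets_def mem_Collect_eq em[OF A] using A vim[OF A] by (simp add: translate_def)
  fix A
  show "A \<in> null_sets M" if "A \<in> null_sets (translate M d)"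
  proof -
    have A: "A \<in> sets borel" using null_setsD2[OF that] by (simp add: translate_def)
    have "AE x in M. x \<notin> (\<lambda>x. x \<oplus> d) -` A" using that null[OF A] by (intro AE_not_in) blast
    from AE_translate[OF d this] have "AE x in M. x \<notin> A" by simp
    then show ?thesis using AE_iff_null_sets[of A M] A by simp
  qed
  show "A \<in> null_sets (translate M d)" if "A \<in> null_sets M"
  proof -
    have A: "A \<in> sets borel" using null_setsD2[OF that] by simp
    have "AE x in M. x \<notin> A" using that by (rule AE_not_in)
    from AE_translate[OF d this] have "AE x in M. x \<notin> (\<lambda>x. x \<oplus> d) -` A" by simp
    then have "(\<lambda>x. x \<oplus> d) -` A \<in> null_sets M" using AE_iff_null_sets[of "(\<lambda>x. x \<oplus> d) -` A" M] vim[OF A] by simp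
    then show ?thesis using null[OF A] by blast
  qed
qed

section \<open>Radon-Nikodym weights of the translations\<close>

definition R :: "nat \<Rightarrow> binseq \<Rightarrow> real" where
  "R k x = enn2real (RN_deriv M (translate M (delta k)) x)"

definition r :: "nat \<Rightarrow> binseq \<Rightarrow> real" where "r k = sqrt_RN M (translate M (delta k))"

lemma R_measurable [measurable]: "R k \<in> borel_measurable borel"
proof -
  have "RN_deriv M (translate M (delta k)) \<in> borel_measurable borel"
    using borel_measurable_RN_deriv[of M "translate M (delta k)"] by (simp add: measurable_cong_sets[OF sets_M refl])
  then show ?thesis unfolding R_def[abs_def] by measurable
qed

lemma r_sq: "(r k x)\<^sup>2 = R k x"
  by (simp add: r_def sqrt_RN_def R_def)

lemma r_nonneg: "0 \<le> r k x"
  by (simp add: r_def sqrt_RN_def)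

lemma r_measurable [measurable]: "r k \<in> borel_measurable borel"
proof -
  have "r k = (\<lambda>x. sqrt (R k x))" by (simp add: fun_eq_iff r_def sqrt_RN_def R_def)
  then show ?thesis by simp
qed

lemma density_R: "density M (\<lambda>x. ennreal (R k x)) = translate M (delta k)"
proof -
  have acM: "absolutely_continuous M (translate M (delta k))" unfolding translate_M by (simp only: M_def e0_ac)
  have se: "sets (translate M (delta k)) = sets M" by (simp add: translate_def)
  interpret N: finite_measure "translate M (delta k)" unfolding translate_M by (rule spec)
  have fin: "AE x in M. RN_deriv M (translate M (delta k)) x \<noteq> \<infinity>"
    by (rule M.RN_deriv_finite[OF N.sigma_finite_measure_axioms acM se])
  have "density M (\<lambda>x. ennreal (R k x)) = density M (RN_deriv M (translate M (delta k)))"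
  proof (rule density_cong)
    show "AE x in M. ennreal (R k x) = RN_deriv M (translate M (delta k)) x"
      using fin by eventually_elim (simp add: R_def less_top)
  qed auto
  also have "\<dots> = translate M (delta k)" by (rule M.density_RN_deriv[OF acM se])
  finally show ?thesis .
qed

text \<open>\<open>J k\<close> is isometric and carries the projection of a cylinder to that of the
  translated cylinder; the factor \<open>R k\<close> compensates the change of measure in the
  substitution.\<close>

lemma dens_J: "AE x in M. dens (J k v) (J k w) x = R k x * dens v w (x \<oplus> delta k)"
proof (rule dens_eqI)
  have tr: "integrable (translate M (delta k)) (\<lambda>x. h (x \<oplus> delta k))"
    "(\<integral>x. h (x \<oplus> delta k) \<partial>translate M (delta k)) = (\<integral>x. h x \<partial>M)"
    if "integrable M h" for h :: "binseq \<Rightarrow> real"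
    using that unfolding translate_def by (auto simp: integrable_distr_eq integral_distr)
  have R0: "0 \<le> R k x" for x by (simp add: R_def)
  have den: "integrable M (\<lambda>x. R k x * h x)" "(\<integral>x. R k x * h x \<partial>M) = (\<integral>x. h x \<partial>translate M (delta k))"
    if "integrable (translate M (delta k)) h" for h :: "binseq \<Rightarrow> real"
  proof -
    have [measurable]: "h \<in> borel_measurable borel"
      using borel_measurable_integrable[OF that] by (simp add: translate_def)
    show "integrable M (\<lambda>x. R k x * h x)"
      using that R0 unfolding density_R[symmetric] by (subst (asm) integrable_density) auto
    show "(\<integral>x. R k x * h x \<partial>M) = (\<integral>x. h x \<partial>translate M (delta k))"
      using R0 unfolding density_R[symmetric] by (subst integral_density) auto
  qed
  show "integrable M (\<lambda>x. R k x * dens v w (x \<oplus> delta k))"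
    by (rule den(1)[OF tr(1)]) simp
  fix x n
  let ?h = "\<lambda>y. indicator (cyl (x \<oplus> delta k) n) y * dens v w y"
  have h: "integrable M ?h" using integrable_mult_indicator[of "cyl (x \<oplus> delta k) n" M "dens v w"] by simp
  have ind: "indicator (cyl (x \<oplus> delta k) n) (y \<oplus> delta k) = (indicator (cyl x n) y :: real)" for y
    by (simp add: indicator_def vimage_add_seq_cyl[symmetric])
  have "(LINT y:cyl x n|M. R k y * dens v w (y \<oplus> delta k)) = (\<integral>y. R k y * ?h (y \<oplus> delta k) \<partial>M)"
    unfolding set_lebesgue_integral_def by (intro Bochner_Integration.integral_cong refl) (simp only: ind, simp)
  also have "\<dots> = (\<integral>y. ?h y \<partial>M)" using den(2)[OF tr(1)[OF h]] tr(2)[OF h] by simp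
  also have "\<dots> = inner (Q (x \<oplus> delta k) n v) w"
    using dens_LINT[of "x \<oplus> delta k" n v w] by (simp add: set_lebesgue_integral_def)
  also have "\<dots> = inner (J k (Q (x \<oplus> delta k) n v)) (J k w)" by (simp add: J_inner)
  finally show "(LINT y:cyl x n|M. R k y * dens v w (y \<oplus> delta k)) = inner (Q x n (J k v)) (J k w)" by (simp add: J_Q)
qed

text \<open>Applying \<open>dens_J\<close> twice to the constant density of \<open>e0\<close> yields
  the product of the two derivatives, and \<open>J k (J k e0) = - e0\<close> has the same density
  1.\<close>

lemma r_r: "AE x in M. r k x * r k (x \<oplus> delta k) = 1"
proof -
  have "AE x in M. dens (J k (J k e0)) (J k (J k e0)) x = dens e0 e0 x"
    by (rule dens_cong) (simp add: J_J Q_scaleR[of _ _ "- 1", simplified])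
  then show ?thesis using dens_J[of k "J k e0" "J k e0"] AE_translate_delta[OF dens_J[of k e0 e0], of k] dens_e0
  proof eventually_elim
    case (elim x)
    then have "R k x * R k (x \<oplus> delta k) = 1" by simp
    then have "(r k x * r k (x \<oplus> delta k))\<^sup>2 = 1\<^sup>2" by (simp add: power_mult_distrib r_sq)
    then show ?case using mult_nonneg_nonneg[OF r_nonneg r_nonneg, of k x k "x \<oplus> delta k"]
      unfolding power2_eq_iff by linarith
  qed
qed

lemma r_pos: "AE x in M. 0 < r k x"
  using r_r[of k] by eventually_elim (use r_nonneg in \<open>auto simp: order_less_le\<close>)

lemma T_J_inner:
  "AE x in M. inner (T (J k v) x) (T (J k w) x) = (r k x)\<^sup>2 * inner (T v (x \<oplus> delta k)) (T w (x \<oplus> delta k))"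
  using T_inner[of "J k v" "J k w"] dens_J[of k v w] AE_translate_delta[OF T_inner[of v w], of k]
  by eventually_elim (simp add: r_sq)

text \<open>The measure is finite, so the truncated basis fields are square integrable, and the
  transform is surjective. The resulting vectors are the tests for all identities of fiber
  operators.\<close>

lemma W_ex: "\<exists>v. AE x in M. T v x = (if enat j < mult x then ebase j else 0, 0)"
proof -
  let ?f = "\<lambda>x. (if enat j < mult x then ebase j else 0, 0 :: ell2)"
  have f: "?f \<in> borel_measurable borel" by measurable
  have sq: "integrable M (\<lambda>x. (norm (?f x))\<^sup>2)"
    by (rule M.integrable_const_bound[where B = 1]) (use f in \<open>auto simp: norm_Pair\<close>)
  have "AE x in M. ?f x \<in> cx (fiber (mult x))"
    by (rule AE_I2) (auto simp: cx_def ebase_fiber subspace_0[OF subspace_fiber])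
  from T_surj[OF f this sq] show ?thesis by blast
qed

section \<open>Fiber operators of the generators\<close>

definition W :: "nat \<Rightarrow> 'v" where
  "W j = (SOME v. AE x in M. T v x = (if enat j < mult x then ebase j else 0, 0))"

lemma T_W: "AE x in M. T (W j) x = (if enat j < mult x then ebase j else 0, 0)"
  unfolding W_def by (rule someI_ex[OF W_ex])

lemma T_W_all: "AE x in M. \<forall>j. T (W j) x = (if enat j < mult x then ebase j else 0, 0)"
  using T_W by (simp add: AE_all_countable)

text \<open>The value that the fiber operator at \<open>x\<close> must take at
  \<open>(ebase j, 0)\<close>, for \<open>j\<close> below the multiplicity: this is the transform of
  \<open>W j\<close> at the translated point, and the weight is divided out.\<close>

definition Y :: "nat \<Rightarrow> binseq \<Rightarrow> nat \<Rightarrow> ell2 \<times> ell2" where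
  "Y k x j = (1 / r k x) *\<^sub>R T (J k (W j)) x"

definition B :: "nat \<Rightarrow> binseq \<Rightarrow> ell2 \<times> ell2 \<Rightarrow> ell2 \<times> ell2" where
  "B k x = fam_op (Y k x)"

lemma J_I: "J k (I v) = I (J k v)" by (rule J_scaleC)

lemma Y_inner:
  "AE x in M. \<forall>j. inner ((1 / r k x) *\<^sub>R T (J k v) x) (Y k x j) =
       inner (T v (x \<oplus> delta k)) (if enat j < mult (x \<oplus> delta k) then ebase j else 0, 0) \<and>
     inner ((1 / r k x) *\<^sub>R T (J k v) x) (cx_scale \<i> (Y k x j)) =
       inner (T v (x \<oplus> delta k)) (0, if enat j < mult (x \<oplus> delta k) then ebase j else 0)"
proof -
  have 1: "AE x in M. \<forall>j. inner (T (J k v) x) (T (J k (W j)) x) =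
      (r k x)\<^sup>2 * inner (T v (x \<oplus> delta k)) (T (W j) (x \<oplus> delta k))"
    and 2: "AE x in M. \<forall>j. inner (T (J k v) x) (T (J k (I (W j))) x) =
      (r k x)\<^sup>2 * inner (T v (x \<oplus> delta k)) (T (I (W j)) (x \<oplus> delta k))"
    using T_J_inner by (simp_all add: AE_all_countable)
  have 3: "AE x in M. \<forall>j. T (J k (I (W j))) x = cx_scale \<i> (T (J k (W j)) x)"
    and 4: "AE x in M. \<forall>j. T (I (W j)) x = cx_scale \<i> (T (W j) x)"
    using T_I by (simp_all add: AE_all_countable J_I)
  show ?thesis
    using 1 2 3 AE_translate_delta[OF 4, of k] AE_translate_delta[OF T_W_all, of k] r_pos[of k]
  proof eventually_elim
    case (elim x)
    have sc: "cx_scale \<i> (Y k x j) = (1 / r k x) *\<^sub>R cx_scale \<i> (T (J k (W j)) x)" for j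
      by (simp add: Y_def cx_scale_def algebra_simps)
    have "inner ((1 / r k x) *\<^sub>R T (J k v) x) (Y k x j) = inner (T v (x \<oplus> delta k)) (T (W j) (x \<oplus> delta k))" for j
      using elim(1,6) by (simp add: Y_def power2_eq_square)
    moreover have "inner ((1 / r k x) *\<^sub>R T (J k v) x) (cx_scale \<i> (Y k x j)) =
        inner (T v (x \<oplus> delta k)) (T (I (W j)) (x \<oplus> delta k))" for j
      using elim(2,3,6) unfolding sc by (simp add: power2_eq_square)
    ultimately show ?case using elim(4,5) by (simp add: cx_scale_i)
  qed
qed

lemma Y_orthonormal: "AE x in M. orthonormal_family (mult (x \<oplus> delta k)) (Y k x)"
proof -
  have "AE x in M. \<forall>i j. inner (Y k x i) (Y k x j) =
       inner (T (W i) (x \<oplus> delta k)) (if enat j < mult (x \<oplus> delta k) then ebase j else 0, 0) \<and>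
     inner (Y k x i) (cx_scale \<i> (Y k x j)) =
       inner (T (W i) (x \<oplus> delta k)) (0, if enat j < mult (x \<oplus> delta k) then ebase j else 0)"
    using Y_inner[of k "W _"] by (subst AE_all_countable) (simp add: Y_def)
  then show ?thesis using AE_translate_delta[OF T_W_all, of k]
    by eventually_elim (auto simp: orthonormal_family_def inner_prod_def seq_of_ebase seq_of_zero)
qed

lemma Y_fiber: "AE x in M. \<forall>j. Y k x j \<in> cx (fiber (mult x))"
proof -
  have "AE x in M. \<forall>j. T (J k (W j)) x \<in> cx (fiber (mult x))"
    using T_fiber by (simp add: AE_all_countable)
  then show ?thesis by eventually_elim (simp add: Y_def subspace_scale[OF subspace_cx_fiber])
qed

text \<open>The vectors \<open>Y k x j\<close> are an orthonormal family of size
  \<open>mult (x \<oplus> delta k)\<close> inside the fiber at \<open>x\<close>, which gives one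
  inequality; the same at the translated point gives the other.\<close>

lemma mult_translate_delta: "AE x in M. mult (x \<oplus> delta k) = mult x"
proof -
  have le: "AE x in M. mult (x \<oplus> delta k) \<le> mult x"
    using Y_orthonormal[of k] Y_fiber[of k] by eventually_elim (blast intro: orthonormal_family_le)
  show ?thesis using le AE_translate_delta[OF le, of k] by eventually_elim simp
qed

lemma mult_translate: "d \<in> Delta \<Longrightarrow> AE x in M. mult (x \<oplus> d) = mult x"
proof (induction rule: Delta_induct)
  case zero
  then show ?case by (simp add: add_seq_def)
next
  case (add d k)
  have *: "x \<oplus> (d \<oplus> delta k) = x \<oplus> delta k \<oplus> d" for x by (auto simp: add_seq_def)
  from AE_translate_delta[OF add.IH, of k] mult_translate_delta[of k] show ?case
    by eventually_elim (simp add: *)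
qed

lemma B_iso: "AE x in M. iso_on (mult x) (B k x)"
  using Y_orthonormal[of k] Y_fiber[of k] mult_translate_delta[of k]
  by eventually_elim (simp add: B_def fam_op_iso_on)

text \<open>\<open>B\<close> is built from the \<open>W j\<close> alone. For general
  \<open>v\<close>, the vector \<open>T (J k v) x\<close> without its weight has the right norm by
  \<open>T_J_inner\<close> and the right coefficients by \<open>Y_inner\<close>, and
  \<open>fam_op_eqI\<close> identifies it.\<close>

lemma T_J: "AE x in M. T (J k v) x = r k x *\<^sub>R B k x (T v (x \<oplus> delta k))"
  using Y_inner[of k v] r_pos[of k] T_J_inner[of k v v] Y_orthonormal[of k] AE_translate_delta[OF T_fiber[of v], of k]
proof eventually_elim
  case (elim x)
  let ?\<xi> = "T v (x \<oplus> delta k)" and ?\<eta> = "(1 / r k x) *\<^sub>R T (J k v) x"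
  have 0: "seq_of a j = 0" if "\<not> enat j < mult (x \<oplus> delta k)" "a \<in> fiber (mult (x \<oplus> delta k))" for a j
    using that by (auto simp: fiber_def not_less)
  have \<xi>: "fst ?\<xi> \<in> fiber (mult (x \<oplus> delta k))" "snd ?\<xi> \<in> fiber (mult (x \<oplus> delta k))"
    using elim(5) by (auto simp: cx_def)
  have "fam_op (Y k x) ?\<xi> = ?\<eta>"
  proof (rule fam_op_eqI[OF elim(4,5)])
    have "inner ?\<eta> ?\<eta> = inner ?\<xi> ?\<xi>"
      using elim(2,3) by (simp add: power2_eq_square)
    then show "norm ?\<eta> = norm ?\<xi>" by (simp only: norm_eq_sqrt_inner)
    show "inner ?\<eta> (Y k x j) = seq_of (fst ?\<xi>) j" for j
      using elim(1)[rule_format, of j] 0[OF _ \<xi>(1), of j] by (simp add: inner_prod_def)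
    show "inner ?\<eta> (cx_scale \<i> (Y k x j)) = seq_of (snd ?\<xi>) j" for j
      using elim(1)[rule_format, of j] 0[OF _ \<xi>(2), of j] by (simp add: inner_prod_def)
  qed
  then show ?case using elim(2) by (simp add: B_def)
qed

end

section \<open>The symmetries as signs on the spectrum\<close>

lemma (in cyclic_system) T_N: "AE y in M. T (N k v) y = (if y k then - 1 else 1) *\<^sub>R T v y"
proof -
  have PN: "P k b (N k w) = (if b then - 1 else 1) *\<^sub>R P k b w" for b w
    by (simp add: P_def algebra_simps)
  \<comment> \<open>Prefixes are indexed by bit lists, so that one null set serves all of them; the
    prefix is chosen afterwards, depending on \<open>y\<close>.\<close>
  let ?z = "\<lambda>xs :: bool list. \<lambda>i. xs ! i"
  have QN: "Q z (Suc k) (N k v) = (if z k then - 1 else 1) *\<^sub>R Q z (Suc k) v" for z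
    by (simp add: P_Q PN Q_scaleR linear_neg[OF Q_linear])
  have 1: "AE y in M. \<forall>xs. T (Q (?z xs) (Suc k) v) y = indicator (cyl (?z xs) (Suc k)) y *\<^sub>R T v y"
    using T_Q by (simp add: AE_all_countable del: Q.simps)
  have 2: "AE y in M. \<forall>xs. T (Q (?z xs) (Suc k) (N k v)) y = indicator (cyl (?z xs) (Suc k)) y *\<^sub>R T (N k v) y"
    using T_Q by (simp add: AE_all_countable del: Q.simps)
  have 3: "AE y in M. \<forall>xs. T ((if ?z xs k then - 1 else 1) *\<^sub>R Q (?z xs) (Suc k) v) y =
      (if ?z xs k then - 1 else 1) *\<^sub>R T (Q (?z xs) (Suc k) v) y"
    using T_scaleR by (simp add: AE_all_countable del: scaleR_minus1_left Q.simps)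
  from 1 2 3 show ?thesis
  proof eventually_elim
    case (elim y)
    define xs where "xs = map y [0..<Suc k]"
    have xs: "y \<in> cyl (?z xs) (Suc k)" "xs ! k = y k"
      by (auto simp: xs_def cyl_def nth_append simp del: upt_Suc)
    have "T (N k v) y = T (Q (?z xs) (Suc k) (N k v)) y" using elim(2) xs by (simp del: Q.simps)
    also have "\<dots> = (if y k then - 1 else 1) *\<^sub>R T (Q (?z xs) (Suc k) v) y"
      unfolding QN using elim(3)[rule_format, of xs] xs(2) by (simp del: Q.simps)
    also have "T (Q (?z xs) (Suc k) v) y = T v y" using elim(1) xs by (simp del: Q.simps)
    finally show ?case .
  qed
qed

section \<open>Signs determined by a prefix\<close>

definition sg :: "nat \<Rightarrow> binseq \<Rightarrow> real" where
  "sg k x = (\<Prod>j<k. if x j then - 1 else 1)"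

lemma sg_power: "(- 1) ^ (\<Sum>j<k. of_bool (x j)) = complex_of_real (sg k x)"
  by (induction k) (auto simp: sg_def power_add)

lemma abs_sg [simp]: "\<bar>sg k x\<bar> = 1"
  by (induction k) (auto simp: sg_def abs_mult)

lemma sg_sq [simp]: "sg k x * sg k x = 1"
  using abs_mult_self_eq[of "sg k x"] by simp

text \<open>The product runs over bits strictly below \<open>k\<close>, so translation by
  \<open>delta k\<close> itself leaves it unchanged; \<open>c_square\<close> depends on
  this.\<close>

lemma sg_delta: "sg k (x \<oplus> delta l) = (if l < k then - sg k x else sg k x)"
  by (induction k) (auto simp: sg_def add_seq_def delta_def less_Suc_eq)

lemma sg_flip: "sg k (flip x) = (- 1) ^ k * sg k x"
  by (induction k) (auto simp: sg_def add_seq_def flip_def)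

lemma sg_measurable [measurable]: "sg k \<in> borel_measurable borel"
  unfolding sg_def[abs_def] by measurable

lemma cx_basis_fiber: "enat j < \<nu> \<Longrightarrow> (ebase j, 0) \<in> cx (fiber \<nu>)"
  by (simp add: cx_def ebase_fiber subspace_0[OF subspace_fiber])

text \<open>Comparing norms shows that the positive factors agree. This strips the weights from the
  commutation and conjugation identities without proving cocycle identities for
  \<open>r\<close>.\<close>

lemma scaled_unit_eq:
  fixes p q :: "'a::real_normed_vector"
  assumes "a *\<^sub>R p = b *\<^sub>R q" "norm p = norm q" "norm q \<noteq> 0" "0 < a" "0 < b"
  shows "p = q"
proof -
  have "a * norm p = b * norm q" using arg_cong[OF assms(1), of norm] assms(4,5) by simp
  then have "a = b" using assms(2,3) by simp
  then show ?thesis using assms(1,4) by simp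
qed

section \<open>Clifford relations on the fibers\<close>

context standard_system
begin

lemma T_J_all: "AE x in M. \<forall>j. T (J k (F j)) x = r k x *\<^sub>R B k x (T (F j) (x \<oplus> delta k))" for F :: "nat \<Rightarrow> 'v"
  using T_J by (simp only: AE_all_countable simp_thms)

lemma B_square:
  "AE x in M. \<forall>v\<in>cx (fiber (mult x)). B k x (B k (x \<oplus> delta k) v) = - v"
proof -
  have 1: "AE x in M. \<forall>j. T (J k (J k (W j))) x = r k x *\<^sub>R B k x (T (J k (W j)) (x \<oplus> delta k))" by (rule T_J_all)
  have 2: "AE x in M. \<forall>j. T (J k (W j)) x = r k x *\<^sub>R B k x (T (W j) (x \<oplus> delta k))" by (rule T_J_all)
  have 3: "AE x in M. \<forall>j. T (- W j) x = - T (W j) x"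
    using T_minus by (simp only: AE_all_countable simp_thms)
  show ?thesis
    using 1 AE_translate_delta[OF 2, of k] 3 T_W_all B_iso[of k] AE_translate_delta[OF B_iso[of k], of k]
      mult_translate_delta[of k] r_r[of k]
  proof eventually_elim
    case (elim x)
    have iso: "iso_on (mult x) (B k x)" "iso_on (mult x) (B k (x \<oplus> delta k))" using elim by simp_all
    have eq: "B k x (B k (x \<oplus> delta k) (ebase j, 0)) = - (ebase j, 0)" if j: "enat j < mult x" for j
    proof -
      have W: "T (W j) x = (ebase j, 0)" using elim(4) j by simp
      have "- (ebase j, 0) = T (J k (J k (W j))) x" unfolding J_J using elim(3) W by simp
      also have "\<dots> = r k x *\<^sub>R B k x (r k (x \<oplus> delta k) *\<^sub>R B k (x \<oplus> delta k) (ebase j, 0))"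
        using elim(1,2) W by simp
      also have "\<dots> = (r k x * r k (x \<oplus> delta k)) *\<^sub>R B k x (B k (x \<oplus> delta k) (ebase j, 0))"
        by (simp add: iso_on_scaleR[OF iso(1) iso_on_mem[OF iso(2) cx_basis_fiber[OF j]]])
      finally show ?thesis using elim(8) by simp
    qed
    show ?case
      using iso_on_ext[OF iso_on_comp[OF iso] iso_on_uminus eq] by blast
  qed
qed

lemma B_anti:
  assumes "k \<noteq> l"
  shows "AE x in M. \<forall>v\<in>cx (fiber (mult x)). B k x (B l (x \<oplus> delta k) v) = - B l x (B k (x \<oplus> delta l) v)"
proof -
  have TJJ: "AE x in M. \<forall>j. enat j < mult x \<longrightarrow>
    T (J k (J l (W j))) x = (r k x * r l (x \<oplus> delta k)) *\<^sub>R B k x (B l (x \<oplus> delta k) (ebase j, 0))" for k l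
  proof -
    have 1: "AE x in M. \<forall>j. T (J k (J l (W j))) x = r k x *\<^sub>R B k x (T (J l (W j)) (x \<oplus> delta k))" by (rule T_J_all)
    have 2: "AE x in M. \<forall>j. T (J l (W j)) x = r l x *\<^sub>R B l x (T (W j) (x \<oplus> delta l))" by (rule T_J_all)
    show ?thesis
      using 1 AE_translate_delta[OF 2, of k] AE_translate_delta[OF AE_translate_delta[OF T_W_all, of l], of k]
        B_iso[of k] AE_translate_delta[OF B_iso[of l], of k] mult_translate_delta[of k]
        AE_translate_delta[OF mult_translate_delta[of l], of k]
    proof eventually_elim
      case (elim x)
      have iso: "iso_on (mult x) (B k x)" "iso_on (mult x) (B l (x \<oplus> delta k))" using elim by simp_all
      show ?case
      proof (intro allI impI)
        fix j assume j: "enat j < mult x"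
        have "T (W j) (x \<oplus> delta k \<oplus> delta l) = (ebase j, 0)" using elim(3,6,7) j by simp
        then have "T (J k (J l (W j))) x = r k x *\<^sub>R B k x (r l (x \<oplus> delta k) *\<^sub>R B l (x \<oplus> delta k) (ebase j, 0))"
          using elim(1,2) by simp
        then show "T (J k (J l (W j))) x = (r k x * r l (x \<oplus> delta k)) *\<^sub>R B k x (B l (x \<oplus> delta k) (ebase j, 0))"
          by (simp add: iso_on_scaleR[OF iso(1) iso_on_mem[OF iso(2) cx_basis_fiber[OF j]]])
      qed
    qed
  qed
  have 3: "AE x in M. \<forall>j. T (- J l (J k (W j))) x = - T (J l (J k (W j))) x"
    using T_minus by (simp only: AE_all_countable simp_thms)
  have Bk: "AE x in M. iso_on (mult x) (B k (x \<oplus> delta l))" for k l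
    using AE_translate_delta[OF B_iso[of k], of l] mult_translate_delta[of l] by eventually_elim simp
  show ?thesis
    using TJJ[of k l] TJJ[of l k] 3 B_iso[of k] B_iso[of l] Bk[of k l] Bk[of l k] r_pos[of k] r_pos[of l]
      AE_translate_delta[OF r_pos[of k], of l] AE_translate_delta[OF r_pos[of l], of k]
  proof eventually_elim
    case (elim x)
    note iso = iso_on_comp[OF elim(4,7)] iso_on_comp[OF elim(5,6)]
    have eq: "B k x (B l (x \<oplus> delta k) (ebase j, 0)) = - B l x (B k (x \<oplus> delta l) (ebase j, 0))"
      if j: "enat j < mult x" for j
    proof (rule scaled_unit_eq)
      have "T (J k (J l (W j))) x = - T (J l (J k (W j))) x" unfolding J_anti[OF assms] using elim(3) by simp
      then show "(r k x * r l (x \<oplus> delta k)) *\<^sub>R B k x (B l (x \<oplus> delta k) (ebase j, 0)) =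
        (r l x * r k (x \<oplus> delta l)) *\<^sub>R (- B l x (B k (x \<oplus> delta l) (ebase j, 0)))"
        using elim(1,2) j by simp
      show "norm (B k x (B l (x \<oplus> delta k) (ebase j, 0))) = norm (- B l x (B k (x \<oplus> delta l) (ebase j, 0)))"
        using iso_on_norm[OF iso(1) cx_basis_fiber[OF j]] iso_on_norm[OF iso(2) cx_basis_fiber[OF j]] by simp
      show "norm (- B l x (B k (x \<oplus> delta l) (ebase j, 0))) \<noteq> 0"
        using iso_on_norm[OF iso(2) cx_basis_fiber[OF j]] by (simp add: norm_Pair)
    qed (use elim in auto)
    have "iso_on (mult x) (\<lambda>v. - B l x (B k (x \<oplus> delta l) v))"
      by (rule iso_on_comp[OF iso_on_uminus iso(2)])
    from iso_on_ext[OF iso(1) this eq] show ?case by blast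
  qed
qed

lemma B_conj:
  "AE x in M. \<forall>v\<in>cx (fiber (mult x)). cx_cnj (B k x (cx_cnj v)) = B k (flip x) v"
proof -
  have 1: "AE x in M. \<forall>j. T (J k (W j)) x = r k x *\<^sub>R B k x (T (W j) (x \<oplus> delta k))" by (rule T_J_all)
  have 2: "AE x in M. \<forall>j. T (J k (S (W j))) x = r k x *\<^sub>R B k x (T (S (W j)) (x \<oplus> delta k))" by (rule T_J_all)
  have 3: "AE x in M. \<forall>j. T (S (J k (W j))) x = cx_cnj (T (J k (W j)) (flip x))"
    using T_S by (simp only: AE_all_countable simp_thms)
  have 4: "AE x in M. \<forall>j. T (S (W j)) x = cx_cnj (T (W j) (flip x))"
    using T_S by (simp only: AE_all_countable simp_thms)
  \<comment> \<open>\<open>T_S\<close> places the operator at \<open>flip x\<close> between the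
    conjugations, so this form comes first; flipping the almost everywhere statement gives the
    desired one.\<close>
  have "AE x in M. \<forall>v\<in>cx (fiber (mult x)). cx_cnj (B k (flip x) (cx_cnj v)) = B k x v"
    using AE_flip[OF 1] 2 3 AE_translate_delta[OF 4, of k] AE_translate_delta[OF AE_flip[OF T_W_all], of k]
      B_iso[of k] AE_flip[OF B_iso[of k]] r_pos[of k] AE_flip[OF r_pos[of k]] mult_translate_delta[of k]
  proof eventually_elim
    case (elim x)
    note iso = iso_on_cnj[OF elim(7)[unfolded mult_flip]] elim(6)
    have eq: "cx_cnj (B k (flip x) (cx_cnj (ebase j, 0))) = B k x (ebase j, 0)"
      if j: "enat j < mult x" for j
    proof (rule scaled_unit_eq)
      have W: "T (W j) (flip x \<oplus> delta k) = (ebase j, 0)" using elim(5,10) j mult_flip[of "x \<oplus> delta k"] by (simp add: flip_add_seq)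
      have c0: "cx_cnj (ebase j, 0) = (ebase j, 0)" by (simp add: cx_cnj_def)
      have "cx_cnj (T (J k (W j)) (flip x)) = T (J k (S (W j))) x" using elim(3) by (simp add: S_J)
      then show "r k (flip x) *\<^sub>R cx_cnj (B k (flip x) (cx_cnj (ebase j, 0))) = r k x *\<^sub>R B k x (ebase j, 0)"
        using elim(1,2,4) W by (simp add: c0 flip_add_seq cx_cnj_scaleR)
      show "norm (cx_cnj (B k (flip x) (cx_cnj (ebase j, 0)))) = norm (B k x (ebase j, 0))"
        using iso_on_norm[OF iso(1) cx_basis_fiber[OF j]] iso_on_norm[OF iso(2) cx_basis_fiber[OF j]] by simp
      show "norm (B k x (ebase j, 0)) \<noteq> 0"
        using iso_on_norm[OF iso(2) cx_basis_fiber[OF j]] by (simp add: norm_Pair)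
    qed (use elim in auto)
    show ?case using iso_on_ext[OF iso eq] by blast
  qed
  from AE_flip[OF this] show ?thesis by (simp add: mult_flip)
qed

section \<open>Unitary fiber operators at every point\<close>

definition regular :: "nat \<Rightarrow> binseq \<Rightarrow> bool" where
  "regular k x \<longleftrightarrow> iso_on (mult x) (B k x) \<and> (\<forall>v\<in>cx (fiber (mult x)). \<exists>w\<in>cx (fiber (mult x)). B k x w = v)"

lemma AE_regular: "AE x in M. regular k x"
  using B_square[of k] B_iso[of k] AE_translate_delta[OF B_iso[of k], of k] mult_translate_delta[of k]
proof eventually_elim
  case (elim x)
  \<comment> \<open>By \<open>B_square\<close> a preimage of \<open>v\<close> is the operator at the
    translated point applied to \<open>- v\<close>.\<close>
  have "\<exists>w\<in>cx (fiber (mult x)). B k x w = v" if v: "v \<in> cx (fiber (mult x))" for v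
  proof
    have v': "- v \<in> cx (fiber (mult x))" using v by (rule subspace_neg[OF subspace_cx_fiber])
    show "B k x (B k (x \<oplus> delta k) (- v)) = v" using elim(1) v' by simp
    show "B k (x \<oplus> delta k) (- v) \<in> cx (fiber (mult x))" using iso_on_mem elim(3,4) v' by metis
  qed
  then show ?case using elim(2) by (simp add: regular_def)
qed

text \<open>The points where \<open>regular\<close> fails are not known to form a measurable set, so
  a null set containing them is fixed; its measurability enters that of \<open>c k\<close>.\<close>

definition exceptional :: "nat \<Rightarrow> binseq set" where
  "exceptional k = (SOME Z. Z \<in> null_sets M \<and> (\<forall>x. x \<notin> Z \<longrightarrow> regular k x))"

lemma exceptional: "exceptional k \<in> null_sets M" "x \<notin> exceptional k \<Longrightarrow> regular k x"
proof -
  obtain Z where "{x \<in> space M. \<not> regular k x} \<subseteq> Z" "Z \<in> null_sets M"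
    using AE_regular[of k] by (auto elim!: AE_E simp: null_sets_def)
  then have "\<exists>Z. Z \<in> null_sets M \<and> (\<forall>x. x \<notin> Z \<longrightarrow> regular k x)" by auto
  from someI_ex[OF this] show "exceptional k \<in> null_sets M" "x \<notin> exceptional k \<Longrightarrow> regular k x"
    unfolding exceptional_def by auto
qed

lemma AE_exceptional: "AE x in M. x \<notin> exceptional k"
  using exceptional(1) by (rule AE_not_in)

text \<open>On a null set the operator is the identity, so that it is unitary at every point.\<close>

definition c :: "nat \<Rightarrow> binseq \<Rightarrow> ell2 \<times> ell2 \<Rightarrow> ell2 \<times> ell2" where
  "c k x v = (if x \<in> exceptional k then v else cx_scale (\<i> * complex_of_real (sg k x)) (B k x v))"

lemma cmod_sg: "cmod (\<i> * complex_of_real (sg k x)) = 1"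
  by (simp add: norm_mult)

lemma c_iso: "iso_on (mult x) (c k x)"
proof (cases "x \<in> exceptional k")
  case True
  then show ?thesis by (simp add: iso_on_def c_def)
next
  case False
  then have "iso_on (mult x) (\<lambda>v. cx_scale (\<i> * complex_of_real (sg k x)) (B k x v))"
    using exceptional(2)[OF False] cmod_sg by (intro iso_on_scale) (auto simp: regular_def)
  then show ?thesis using False by (simp add: c_def iso_on_def)
qed

lemma c_unitary_on: "cx_unitary_on (cx (fiber (mult x))) (c k x)"
proof (rule iso_on_unitary[OF c_iso])
  fix v assume v: "v \<in> cx (fiber (mult x))"
  show "\<exists>w\<in>cx (fiber (mult x)). c k x w = v"
  proof (cases "x \<in> exceptional k")
    case True
    then show ?thesis using v by (auto simp: c_def)
  next
    case False
    let ?a = "\<i> * complex_of_real (sg k x)"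
    have a: "?a \<noteq> 0" using cmod_sg[of k x] by auto
    obtain w where w: "w \<in> cx (fiber (mult x))" "B k x w = cx_scale (1 / ?a) v"
      using exceptional(2)[OF False] cx_scale_fiber[OF v] unfolding regular_def by blast
    have "c k x w = v" using False a by (simp add: c_def w(2) cx_scale_scale)
    then show ?thesis using w(1) by blast
  qed
qed

lemma AE_c: "AE x in M. \<forall>v. c k x v = cx_scale (\<i> * complex_of_real (sg k x)) (B k x v)"
  using AE_exceptional[of k] by eventually_elim (simp add: c_def)

lemma AE_c_translate: "AE x in M. \<forall>v. c k (x \<oplus> delta l) v = cx_scale (\<i> * complex_of_real (sg k (x \<oplus> delta l))) (B k (x \<oplus> delta l) v)"
  using AE_translate_delta[OF AE_c] .

lemma AE_iso_translate: "AE x in M. iso_on (mult x) (B k (x \<oplus> delta l))"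
  using AE_translate_delta[OF B_iso[of k], of l] mult_translate_delta[of l] by eventually_elim simp

text \<open>The two factors \<i> multiply to \<open>- 1\<close>, which cancels the sign in
  \<open>B_square\<close>; the sign functions, moved past a translation, take care of the sign in
  \<open>B_anti\<close>.\<close>

lemma c_comp:
  "AE x in M. \<forall>v\<in>cx (fiber (mult x)). c k x (c l (x \<oplus> delta k) v) =
     - (sg k x * sg l (x \<oplus> delta k)) *\<^sub>R B k x (B l (x \<oplus> delta k) v)"
  using AE_c[of k] AE_c_translate[of l k] B_iso[of k] AE_iso_translate[of l k]
proof eventually_elim
  case (elim x)
  show ?case
  proof
    fix v assume v: "v \<in> cx (fiber (mult x))"
    have "c k x (c l (x \<oplus> delta k) v) = cx_scale (\<i> * complex_of_real (sg k x))
        (cx_scale (\<i> * complex_of_real (sg l (x \<oplus> delta k))) (B k x (B l (x \<oplus> delta k) v)))"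
      using elim(1,2) iso_on_cx_scale[OF elim(3) iso_on_mem[OF elim(4) v]] by (simp del: split_paired_All)
    also have "\<dots> = cx_scale (complex_of_real (- (sg k x * sg l (x \<oplus> delta k)))) (B k x (B l (x \<oplus> delta k) v))"
      by (simp add: cx_scale_scale algebra_simps)
    finally show "c k x (c l (x \<oplus> delta k) v) = - (sg k x * sg l (x \<oplus> delta k)) *\<^sub>R B k x (B l (x \<oplus> delta k) v)"
      unfolding cx_scale_of_real .
  qed
qed

lemma c_square: "AE x in M. \<forall>v\<in>cx (fiber (mult x)). c k x (c k (x \<oplus> delta k) v) = v"
  using c_comp[of k k] B_square[of k] by eventually_elim (simp add: sg_delta)

text \<open>The operator at the translated point is a right inverse of the isometry
  \<open>c k x\<close>, hence its adjoint.\<close>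

lemma c_adjoint':
  "AE x in M. \<forall>v\<in>cx (fiber (mult x)). \<forall>w\<in>cx (fiber (mult x)). cx_inner (c k x v) w = cx_inner v (c k (x \<oplus> delta k) w)"
  using c_square[of k] mult_translate_delta[of k]
proof eventually_elim
  case (elim x)
  show ?case
  proof (intro ballI)
    fix v w assume v: "v \<in> cx (fiber (mult x))" and w: "w \<in> cx (fiber (mult x))"
    have "c k (x \<oplus> delta k) w \<in> cx (fiber (mult x))" using iso_on_mem[OF c_iso[of "x \<oplus> delta k" k]] elim(2) w by simp
    from iso_on_cx_inner[OF c_iso[of x k] v this] show "cx_inner (c k x v) w = cx_inner v (c k (x \<oplus> delta k) w)"
      using elim(1) w by simp
  qed
qed

text \<open>Of the two sign functions only the one with the larger index notices the other
  translation, so exactly one extra sign appears and cancels that of \<open>B_anti\<close>.\<close>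

lemma c_commute':
  "AE x in M. \<forall>v\<in>cx (fiber (mult x)). c k x (c l (x \<oplus> delta k) v) = c l x (c k (x \<oplus> delta l) v)"
proof (cases "k = l")
  case False
  show ?thesis using c_comp[of k l] c_comp[of l k] B_anti[OF False]
    by eventually_elim (use False in \<open>auto simp: sg_delta\<close>)
qed simp

text \<open>Conjugation turns \<i> into \<open>- \<i>\<close>, and the flip changes all
  \<open>k\<close> bits entering \<open>sg k\<close>; together they give the exponent
  \<open>Suc k\<close>.\<close>

lemma c_conj':
  "AE x in M. \<forall>v\<in>cx (fiber (mult x)). cx_cnj (c k x (cx_cnj v)) = cx_scale ((- 1) ^ Suc k) (c k (flip x) v)"
  using AE_c[of k] AE_flip[OF AE_c[of k]] B_conj[of k]
proof eventually_elim
  case (elim x)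
  show ?case
  proof
    fix v assume v: "v \<in> cx (fiber (mult x))"
    have "cx_cnj (c k x (cx_cnj v)) = cx_scale (- \<i> * complex_of_real (sg k x)) (B k (flip x) v)"
      using elim(1,3) v by (simp add: cx_cnj_scale del: split_paired_All)
    moreover have "(- 1) ^ Suc k * (\<i> * complex_of_real (sg k (flip x))) = - \<i> * complex_of_real (sg k x)"
    proof -
      have "((- 1) ^ k * (- 1) ^ k :: complex) = 1" by (simp flip: power_mult_distrib)
      then show ?thesis by (simp add: sg_flip algebra_simps)
    qed
    ultimately show "cx_cnj (c k x (cx_cnj v)) = cx_scale ((- 1) ^ Suc k) (c k (flip x) v)"
      using elim(2) by (simp only: cx_scale_scale)
  qed
qed

end

section \<open>The equivalence\<close>

lemma cx_scale_i_of_real: "cx_scale (\<i> * complex_of_real a) v = a *\<^sub>R cx_scale \<i> v"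
  by (simp add: cx_scale_def)

lemma cx_scale_scaleR: "cx_scale z (a *\<^sub>R v) = a *\<^sub>R cx_scale z v"
  by (simp add: cx_scale_def algebra_simps)

section \<open>Measurability of pointwise operations\<close>

lemma measurable_fst_snd:
  assumes "f \<in> borel_measurable N'"
  shows "(\<lambda>x. fst (f x :: ell2 \<times> ell2)) \<in> borel_measurable N'" "(\<lambda>x. snd (f x)) \<in> borel_measurable N'"
  by (rule measurable_compose[OF assms], intro borel_measurable_continuous_onI continuous_intros)+

lemma measurable_cx_scale:
  assumes "f \<in> borel_measurable N'"
  shows "(\<lambda>x. cx_scale z (f x :: ell2 \<times> ell2)) \<in> borel_measurable N'"
  by (rule measurable_compose[OF assms])
    (intro borel_measurable_continuous_onI linear_continuous_on bounded_linear_cx_scale)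

lemma measurable_cx_cnj:
  assumes "f \<in> borel_measurable N'"
  shows "(\<lambda>x. cx_cnj (f x :: ell2 \<times> ell2)) \<in> borel_measurable N'"
  unfolding cx_cnj_def using measurable_fst_snd[OF assms] by (intro borel_measurable_Pair borel_measurable_uminus)

lemma measurable_cx_inner:
  assumes "f \<in> borel_measurable N'" "g \<in> borel_measurable N'"
  shows "(\<lambda>x. cx_inner (f x :: ell2 \<times> ell2) (g x)) \<in> borel_measurable N'"
  using measurable_fst_snd[OF assms(1)] measurable_fst_snd[OF assms(2)]
  unfolding cx_inner_def Complex_eq by measurable

lemma unitary_rep_hilbert_type:
  fixes \<pi> :: "'h::real_inner clifford \<Rightarrow> 'v::complex_hilbert \<Rightarrow> 'v"
  assumes "unitary_rep hilbert_type \<pi>"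
  shows "\<pi> a (v + w) = \<pi> a v + \<pi> a w" "\<pi> a (scaleC z v) = scaleC z (\<pi> a v)"
    "\<pi> 1 v = v" "\<pi> (a * b) v = \<pi> a (\<pi> b v)" "\<pi> (a + b) v = \<pi> a v + \<pi> b v"
    "\<pi> (r *\<^sub>R a) v = scaleC (complex_of_real r) (\<pi> a v)" "norm (\<pi> (gen h) v) = norm h * norm v"
  using assms
  by (simp_all add: unitary_rep_def semilinear_map_def hilbert_type_def Nrm_def norm_eq_sqrt_inner inner_eq_Re_cinner)

context standard_system
begin

lemma measurable_M: "f \<in> borel_measurable M \<longleftrightarrow> f \<in> borel_measurable borel"
  by (simp add: measurable_cong_sets[OF sets_M refl])

abbreviation U :: "binseq \<Rightarrow> ell2 set" where "U x \<equiv> fiber (mult x)"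

abbreviation D :: "(binseq \<Rightarrow> ell2 \<times> ell2) hilbert_model" where "D \<equiv> direct_integral M U"

lemma Y_measurable [measurable]: "(\<lambda>x. Y k x j) \<in> borel_measurable borel"
  unfolding Y_def by measurable

text \<open>\<open>fam_op\<close> is a series in measurable coordinates and measurable fields
  \<open>Y\<close>; this is the benefit of defining \<open>B\<close> by a formula instead of
  choosing an operator at each point.\<close>

lemma c_measurable': "measurable_operator_family M U (c k)"
  unfolding measurable_operator_family_def
proof (intro ballI impI)
  fix f :: "binseq \<Rightarrow> ell2 \<times> ell2" assume "f \<in> borel_measurable M"
  then have f [measurable]: "f \<in> borel_measurable borel" by simp
  have coord [measurable]: "(\<lambda>a. seq_of a j) \<in> borel_measurable borel" for j
    by (intro borel_measurable_continuous_onI linear_continuous_on bounded_linear_seq_of)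
  have im [measurable]: "(\<lambda>v :: ell2 \<times> ell2. cx_scale \<i> v) \<in> borel_measurable borel"
    by (intro borel_measurable_continuous_onI linear_continuous_on bounded_linear_cx_scale)
  have [measurable]: "exceptional k \<in> sets borel" using null_setsD2[OF exceptional(1)[of k]] by simp
  have [measurable]: "(\<lambda>x. fst (f x)) \<in> borel_measurable borel" "(\<lambda>x. snd (f x)) \<in> borel_measurable borel"
    by (rule measurable_compose[OF f], intro borel_measurable_continuous_onI continuous_intros)+
  have [measurable]: "(\<lambda>x. \<Sum>j. seq_of (fst (f x)) j *\<^sub>R Y k x j) \<in> borel_measurable borel"
    "(\<lambda>x. \<Sum>j. seq_of (snd (f x)) j *\<^sub>R Y k x j) \<in> borel_measurable borel"
    by (intro borel_measurable_suminf borel_measurable_scaleR measurable_compose[OF _ coord] Y_measurable; measurable)+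
  have [measurable]: "(\<lambda>x. B k x (f x)) \<in> borel_measurable borel"
    unfolding B_def fam_op_def by (intro borel_measurable_add measurable_compose[OF _ im]; measurable)
  have "c k x (f x) = (if x \<in> exceptional k then f x else sg k x *\<^sub>R cx_scale \<i> (B k x (f x)))" for x
    by (simp add: c_def cx_scale_i_of_real)
  then show "(\<lambda>x. c k x (f x)) \<in> borel_measurable M" by simp
qed

lemma flip_measure_M: "flip_measure M = M"
  unfolding flip_measure_def by (rule distr_flip)

section \<open>The data and operators of the standard form\<close>

lemma standard_form: "standard_form_data M U c"
proof
  show "sets M = sets borel" by simp
  show "equivalent_measures (translate M d) M" if "d \<in> Delta" for d by (rule M_quasi_invariant[OF that])
  show "equivalent_measures (flip_measure M) M"
    unfolding flip_measure_M by (simp add: equivalent_measures_def absolutely_continuous_def)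
  show "measurable_hilbert_family M U"
    unfolding measurable_hilbert_family_def
  proof (intro conjI allI exI)
    show "subspace (U x)" "closed (U x)" for x by (rule subspace_fiber closed_fiber)+
    show "(\<lambda>x. if enat n < mult x then ebase n else 0) \<in> borel_measurable M" for n by measurable
    show "closure (span (range (\<lambda>n. if enat n < mult x then ebase n else 0))) = U x" for x
      by (rule fiber_eq_closure_span[symmetric])
  qed
  show "U x \<noteq> {0}" for x
  proof -
    have "ebase 0 \<in> U x" by (rule ebase_fiber[OF mult_pos])
    moreover have "ebase 0 \<noteq> 0" using norm_ebase[of 0] by (metis norm_zero zero_neq_one)
    ultimately show ?thesis by blast
  qed
  show "AE x in M. U (x \<oplus> d) = U x" if "d \<in> Delta" for d
    using mult_translate[OF that] by eventually_elim simp
  show "AE x in M. U (flip x) = U x" by (simp add: mult_flip)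
  show "(\<lambda>x. cx_dim (cx (U x))) \<in> measurable M (count_space UNIV)"
  proof -
    have "(\<lambda>x. cx_dim (cx (U x))) \<in> measurable borel (count_space UNIV)"
      by (rule measurable_compose[OF mult_measurable, of "\<lambda>n. cx_dim (cx (fiber n))"]) simp
    then show ?thesis by (simp add: measurable_cong_sets[OF sets_M refl])
  qed
  show "cx_dim (cx (U (flip x))) = cx_dim (cx (U x))" for x by (simp add: mult_flip)
qed (use M.sigma_finite_measure_axioms c_measurable' c_unitary_on c_adjoint' c_commute' c_conj'
      in \<open>simp_all add: sigma_finite_measure_def\<close>)

text \<open>The constants in \<open>c k\<close> cancel, \<open>- \<i>\<close> against \<i> and
  \<open>sg k\<close> against itself. The second generator is recovered from \<open>J k\<close> and
  \<open>N k\<close>; its additional sign is the value of \<open>N k\<close> at the translated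
  point, where bit \<open>k\<close> has changed.\<close>

lemma J_std_eq:
  assumes "AE x in M. T v x = f x"
  shows "AE x in M. J_std M c k f x = T (J k v) x"
    and "AE x in M. J'_std M c k f x = T (- I (J k (N k v))) x"
proof -
  have step: "AE x in M. \<forall>v\<in>cx (U x). c k x (r k x *\<^sub>R v) = (sg k x * r k x) *\<^sub>R cx_scale \<i> (B k x v)"
    using AE_c[of k] B_iso[of k]
  proof eventually_elim
    case (elim x)
    show ?case
    proof
      fix v assume v: "v \<in> cx (U x)"
      show "c k x (r k x *\<^sub>R v) = (sg k x * r k x) *\<^sub>R cx_scale \<i> (B k x v)"
        using elim(1) iso_on_scaleR[OF elim(2) v, of "r k x"]
        by (simp add: cx_scale_i_of_real cx_scale_scaleR del: split_paired_All)
    qed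
  qed
  have pw: "(- 1) ^ (\<Sum>j\<le>k. of_bool (x j)) = complex_of_real (if x k then - sg k x else sg k x)" for x
  proof -
    have "(- 1) ^ (\<Sum>j\<le>k. of_bool (x j)) = (- 1) ^ (\<Sum>j<k. of_bool (x j)) * ((- 1) ^ of_bool (x k) :: complex)"
      by (simp add: lessThan_Suc_atMost[symmetric] power_add)
    then show ?thesis unfolding sg_power by (cases "x k") simp_all
  qed
  have sc: "cx_scale z (a *\<^sub>R cx_scale \<i> v) = cx_scale (z * complex_of_real a * \<i>) v" for z a and v :: "ell2 \<times> ell2"
  proof -
    have "a *\<^sub>R cx_scale \<i> v = cx_scale (complex_of_real a * \<i>) v" by (simp add: cx_scale_def)
    then show ?thesis by (simp only: cx_scale_scale mult.assoc)
  qed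
  have fib: "AE x in M. T v (x \<oplus> delta k) \<in> cx (U x)"
    using AE_translate_delta[OF T_fiber[of v], of k] mult_translate_delta[of k] by eventually_elim simp
  show "AE x in M. J_std M c k f x = T (J k v) x"
    using step T_J[of k v] fib AE_translate_delta[OF assms, of k]
  proof eventually_elim
    case (elim x)
    have "J_std M c k f x = cx_scale (- \<i> * complex_of_real (sg k x) * complex_of_real (sg k x * r k x) * \<i>) (B k x (T v (x \<oplus> delta k)))"
    proof -
      have "J_std M c k f x = cx_scale (- \<i> * complex_of_real (sg k x)) (c k x (r k x *\<^sub>R T v (x \<oplus> delta k)))"
        unfolding J_std_def sg_power r_def using elim(4) by simp
      then show ?thesis using elim(1,3) by (simp only: sc)
    qed
    also have "- \<i> * complex_of_real (sg k x) * complex_of_real (sg k x * r k x) * \<i> =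
        complex_of_real ((sg k x * sg k x) * r k x)"
      by (simp add: algebra_simps del: sg_sq)
    finally show ?case using elim(2) by (simp add: cx_scale_of_real)
  qed
  have N: "AE x in M. T (- I (J k (N k v))) x = - cx_scale \<i> (T (J k (N k v)) x)"
    using T_minus[of "I (J k (N k v))"] T_I[of "J k (N k v)"] by eventually_elim simp
  show "AE x in M. J'_std M c k f x = T (- I (J k (N k v))) x"
    using step N T_J[of k "N k v"] AE_translate_delta[OF T_N[of k v], of k] fib AE_translate_delta[OF assms, of k] B_iso[of k]
  proof eventually_elim
    case (elim x)
    let ?\<epsilon> = "if x k then - 1 else 1 :: real"
    have TN: "T (N k v) (x \<oplus> delta k) = (- ?\<epsilon>) *\<^sub>R T v (x \<oplus> delta k)"
      using elim(4) by (simp add: add_seq_def delta_def)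
    have "T (J k (N k v)) x = r k x *\<^sub>R ((- ?\<epsilon>) *\<^sub>R B k x (T v (x \<oplus> delta k)))"
      unfolding elim(3) TN by (simp only: iso_on_scaleR[OF elim(7,5)])
    then have R: "T (- I (J k (N k v))) x = cx_scale (\<i> * complex_of_real (?\<epsilon> * r k x)) (B k x (T v (x \<oplus> delta k)))"
      unfolding elim(2) by (auto simp: cx_scale_def prod_eq_iff)
    have "J'_std M c k f x = cx_scale (complex_of_real (if x k then - sg k x else sg k x) * complex_of_real (sg k x * r k x) * \<i>)
        (B k x (T v (x \<oplus> delta k)))"
    proof -
      have "J'_std M c k f x = cx_scale (complex_of_real (if x k then - sg k x else sg k x)) (c k x (r k x *\<^sub>R T v (x \<oplus> delta k)))"
        unfolding J'_std_def pw r_def using elim(6) by simp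
      then show ?thesis using elim(1,5) by (simp only: sc)
    qed
    also have "complex_of_real (if x k then - sg k x else sg k x) * complex_of_real (sg k x * r k x) * \<i> =
        \<i> * complex_of_real (?\<epsilon> * ((sg k x * sg k x) * r k x))"
      by (simp add: algebra_simps del: sg_sq)
    finally show ?case unfolding R by simp
  qed
qed

text \<open>The measure is exactly flip-invariant, so the Radon-Nikodym factor is 1 almost
  everywhere.\<close>

lemma S_std_eq:
  assumes "AE x in M. T v x = f x"
  shows "AE x in M. S_std M f x = T (S v) x"
proof -
  have "AE x in M. 1 = RN_deriv M M x"
    by (rule M.RN_deriv_unique) (auto simp: density_1)
  then show ?thesis using T_S[of v] AE_flip[OF assms]
    by eventually_elim (simp add: S_std_def sqrt_RN_def flip_measure_M)
qed

section \<open>The direct integral as the image of the transform\<close>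

lemma Carr_D: "f \<in> Carr D \<longleftrightarrow> f \<in> borel_measurable borel \<and> (AE x in M. f x \<in> cx (U x)) \<and> integrable M (\<lambda>x. (norm (f x))\<^sup>2)"
  by (simp add: direct_integral_def measurable_M)

lemma T_Carr: "T v \<in> Carr D"
  unfolding Carr_D by (intro conjI T_measurable T_fiber T_norm_integrable)

definition Ti :: "(binseq \<Rightarrow> ell2 \<times> ell2) \<Rightarrow> 'v" where
  "Ti f = (SOME v. AE x in M. T v x = f x)"

lemma T_Ti:
  assumes "f \<in> Carr D"
  shows "AE x in M. T (Ti f) x = f x"
proof -
  from assms have f: "f \<in> borel_measurable borel" "AE x in M. f x \<in> cx (U x)" "integrable M (\<lambda>x. (norm (f x))\<^sup>2)"
    by (simp_all only: Carr_D)
  obtain v where "AE x in M. T v x = f x" by (rule T_surj[OF f])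
  then show ?thesis unfolding Ti_def by (rule someI)
qed

lemma Ti_eqI:
  assumes "AE x in M. T v x = f x"
  shows "Ti f = v"
proof (rule T_inject)
  have "AE x in M. T (Ti f) x = f x" unfolding Ti_def by (rule someI[of "\<lambda>v. AE x in M. T v x = f x"]) (rule assms)
  then show "AE x in M. T (Ti f) x = T v x" using assms by eventually_elim simp
qed

lemma Ti_T: "Ti (T v) = v"
  by (rule Ti_eqI) simp

lemma Eqv_D: "Eqv D f g \<longleftrightarrow> (AE x in M. f x = g x)"
  by (simp add: direct_integral_def)

lemma Ti_cong: "f \<in> Carr D \<Longrightarrow> Eqv D f g \<Longrightarrow> Ti f = Ti g"
proof -
  assume f: "f \<in> Carr D" and fg: "Eqv D f g"
  have "AE x in M. T (Ti f) x = g x" using T_Ti[OF f] fg[unfolded Eqv_D] by eventually_elim simp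
  then show "Ti f = Ti g" by (rule Ti_eqI[symmetric])
qed

lemma Ti_Add:
  assumes "f \<in> Carr D" "g \<in> Carr D"
  shows "Ti (Add D f g) = Ti f + Ti g"
proof (rule Ti_eqI)
  show "AE x in M. T (Ti f + Ti g) x = Add D f g x"
    using T_add[of "Ti f" "Ti g"] T_Ti[OF assms(1)] T_Ti[OF assms(2)]
    by eventually_elim (simp add: direct_integral_def)
qed

lemma Ti_Scl:
  assumes "f \<in> Carr D"
  shows "Ti (Scl D z f) = scaleC z (Ti f)"
proof (rule Ti_eqI)
  show "AE x in M. T (scaleC z (Ti f)) x = Scl D z f x"
    using T_scaleC[of z "Ti f"] T_Ti[OF assms] by eventually_elim (simp add: direct_integral_def)
qed

lemma T_Ip: "Ip D (T v) (T w) = cinner v w"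
proof -
  have "Ip D (T v) (T w) = (\<integral>x. cx_inner (T v x) (T w x) \<partial>M)" by (simp add: direct_integral_def)
  also have "\<dots> = (\<integral>x. complex_of_real (dens v w x) + \<i> * complex_of_real (dens v (I w) x) \<partial>M)"
  proof (rule integral_cong_AE)
    show "AE x in M. cx_inner (T v x) (T w x) = complex_of_real (dens v w x) + \<i> * complex_of_real (dens v (I w) x)"
      using T_cx_inner[of v w] by eventually_elim (simp add: Complex_eq)
    show "(\<lambda>x. cx_inner (T v x) (T w x)) \<in> borel_measurable M"
      unfolding measurable_M by (intro measurable_cx_inner T_measurable)
  qed measurable
  also have "\<dots> = complex_of_real (inner v w) + \<i> * complex_of_real (inner v (I w))"
    by (simp add: dens_integral)
  finally show ?thesis by (simp add: cinner_eq[of v w] Complex_eq)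
qed

lemma Ip_D_cong:
  assumes "f \<in> Carr D" "g \<in> Carr D" "Eqv D f f'" "f' \<in> Carr D"
  shows "Ip D f f = Ip D f' f'"
  unfolding direct_integral_def hilbert_model.simps
proof (rule integral_cong_AE)
  have [measurable]: "f \<in> borel_measurable borel" "f' \<in> borel_measurable borel" using assms by (auto simp: Carr_D)
  show "(\<lambda>x. cx_inner (f x) (f x)) \<in> borel_measurable M" "(\<lambda>x. cx_inner (f' x) (f' x)) \<in> borel_measurable M"
    unfolding measurable_M by (intro measurable_cx_inner; measurable)+
  show "AE x in M. cx_inner (f x) (f x) = cx_inner (f' x) (f' x)"
    using assms(3)[unfolded Eqv_D] by eventually_elim simp
qed

lemma Nrm_T: "Nrm D (T v) = norm v"
  by (simp add: Nrm_def T_Ip norm_eq_sqrt_inner inner_eq_Re_cinner)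

lemma Nrm_D: "f \<in> Carr D \<Longrightarrow> Nrm D f = norm (Ti f)"
  using Ip_D_cong[of "T (Ti f)" "T (Ti f)" f] T_Ti[of f] T_Carr Nrm_T[of "Ti f"]
  by (simp add: Nrm_def Eqv_D)

text \<open>\<open>F\<close> has to agree with the transported operator only almost everywhere, so
  that both the transported representation and the explicit formula \<open>S_std\<close> are
  covered.\<close>

lemma transported_semilinear:
  assumes A: "\<And>v w. A (v + w) = A v + A w" "\<And>z v. A (scaleC z v) = scaleC (\<sigma> z) (A v)"
    and F: "\<And>f. f \<in> Carr D \<Longrightarrow> F f \<in> Carr D" "\<And>f. f \<in> Carr D \<Longrightarrow> AE x in M. F f x = T (A (Ti f)) x"
    and closed: "\<And>f g. f \<in> Carr D \<Longrightarrow> g \<in> Carr D \<Longrightarrow> Add D f g \<in> Carr D" "\<And>z f. f \<in> Carr D \<Longrightarrow> Scl D z f \<in> Carr D"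
  shows "semilinear_map \<sigma> D D F"
  unfolding semilinear_map_def
proof (intro conjI ballI allI impI)
  fix f g assume f: "f \<in> Carr D" and g: "g \<in> Carr D"
  show "F f \<in> Carr D" by (rule F(1)[OF f])
  show "Eqv D (F f) (F g)" if "Eqv D f g"
    unfolding Eqv_D using F(2)[OF f] F(2)[OF g] by eventually_elim (simp add: Ti_cong[OF f that])
  show "Eqv D (F (Add D f g)) (Add D (F f) (F g))"
    unfolding Eqv_D using F(2)[OF closed(1)[OF f g]] F(2)[OF f] F(2)[OF g] T_add[of "A (Ti f)" "A (Ti g)"]
    by eventually_elim (simp add: Ti_Add[OF f g] A(1), simp add: direct_integral_def)
  show "Eqv D (F (Scl D z f)) (Scl D (\<sigma> z) (F f))" for z
    unfolding Eqv_D using F(2)[OF closed(2)[OF f, of z]] F(2)[OF f] T_scaleC[of "\<sigma> z" "A (Ti f)"]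
    by eventually_elim (simp add: Ti_Scl[OF f] A(2), simp add: direct_integral_def)
qed

lemma Carr_D_AE_cong:
  assumes f: "f \<in> Carr D" and g [measurable]: "g \<in> borel_measurable borel" and fg: "AE x in M. g x = f x"
  shows "g \<in> Carr D"
  unfolding Carr_D
proof (intro conjI)
  have [measurable]: "f \<in> borel_measurable borel" using f by (simp add: Carr_D)
  show "AE x in M. g x \<in> cx (U x)" using f[unfolded Carr_D] fg by (auto elim: eventually_elim2)
  have "AE x in M. (norm (g x))\<^sup>2 = (norm (f x))\<^sup>2" using fg by eventually_elim simp
  then show "integrable M (\<lambda>x. (norm (g x))\<^sup>2)"
    using f by (subst integrable_cong_AE[where g = "\<lambda>x. (norm (f x))\<^sup>2"]) (auto simp: Carr_D)
qed (rule g)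

lemma Add_Carr: "f \<in> Carr D \<Longrightarrow> g \<in> Carr D \<Longrightarrow> Add D f g \<in> Carr D"
proof (rule Carr_D_AE_cong[OF T_Carr])
  assume f: "f \<in> Carr D" and g: "g \<in> Carr D"
  show "Add D f g \<in> borel_measurable borel" using f g borel_measurable_add[of f borel g] unfolding Carr_D by (simp add: direct_integral_def)
  show "AE x in M. Add D f g x = T (Ti f + Ti g) x"
    using T_add[of "Ti f" "Ti g"] T_Ti[OF f] T_Ti[OF g] by eventually_elim (simp add: direct_integral_def)
qed

lemma Scl_Carr: "f \<in> Carr D \<Longrightarrow> Scl D z f \<in> Carr D"
proof (rule Carr_D_AE_cong[OF T_Carr])
  assume f: "f \<in> Carr D"
  show "Scl D z f \<in> borel_measurable borel"
    using f measurable_cx_scale[of f borel z] unfolding Carr_D by (simp add: direct_integral_def)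
  show "AE x in M. Scl D z f x = T (scaleC z (Ti f)) x"
    using T_scaleC[of z "Ti f"] T_Ti[OF f] by eventually_elim (simp add: direct_integral_def)
qed

lemma T_unitary_map: "unitary_map hilbert_type D T"
  unfolding unitary_map_def semilinear_map_def
proof (intro conjI ballI allI impI)
  fix v w :: 'v
  show "T v \<in> Carr D" by (rule T_Carr)
  show "Eqv D (T v) (T w)" if "Eqv hilbert_type v w" using that by (simp add: hilbert_type_def Eqv_D)
  show "Eqv D (T (Add hilbert_type v w)) (Add D (T v) (T w))"
    using T_add[of v w] by (simp add: hilbert_type_def direct_integral_def)
  show "Eqv D (T (Scl hilbert_type z v)) (Scl D (id z) (T v))" for z
    using T_scaleC[of z v] by (simp add: hilbert_type_def direct_integral_def)
  show "Ip D (T v) (T w) = Ip hilbert_type v w" by (simp add: T_Ip) (simp add: hilbert_type_def)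
next
  fix f assume "f \<in> Carr D"
  then show "\<exists>v\<in>Carr hilbert_type. Eqv D (T v) f"
    using T_Ti by (auto simp: hilbert_type_def Eqv_D)
qed

lemma S_std_Carr: "f \<in> Carr D \<Longrightarrow> S_std M f \<in> Carr D"
proof (rule Carr_D_AE_cong[OF T_Carr])
  assume f: "f \<in> Carr D"
  then have [measurable]: "f \<in> borel_measurable borel" by (simp add: Carr_D)
  have [measurable]: "RN_deriv M M \<in> borel_measurable borel"
    using borel_measurable_RN_deriv[of M M] by (simp add: measurable_cong_sets[OF sets_M refl])
  show "S_std M f \<in> borel_measurable borel"
    unfolding S_std_def[abs_def] sqrt_RN_def flip_measure_M by (intro measurable_cx_cnj) measurable
  show "AE x in M. S_std M f x = T (S (Ti f)) x" by (rule S_std_eq[OF T_Ti[OF f]])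
qed

section \<open>Transport of the representation\<close>

lemma standard_form_equivalence:
  fixes \<pi> :: "'h::real_inner clifford \<Rightarrow> 'v \<Rightarrow> 'v"
  assumes rep: "unitary_rep hilbert_type \<pi>"
    and J: "\<And>k v. \<pi> (gen (e k)) v = J k v"
    and J': "\<And>k v. \<pi> (gen (e' k)) v = - I (J k (N k v))"
    and S_J': "\<And>k v. S (\<pi> (gen (e' k)) v) = \<pi> (gen (e' k)) (S v)"
  shows "\<exists>\<mu> (U :: binseq \<Rightarrow> ell2 set) c \<rho>. in_standard_form e e' \<mu> U c \<rho> \<and>
    unitarily_equivalent hilbert_type \<pi> (direct_integral \<mu> U) \<rho>"
proof -
  define \<rho> where "\<rho> a f = T (\<pi> a (Ti f))" for a f
  note \<pi> = unitary_rep_hilbert_type[OF rep]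
  have Ti_\<rho>: "Ti (\<rho> a f) = \<pi> a (Ti f)" for a f unfolding \<rho>_def by (rule Ti_T)
  have rep': "unitary_rep D \<rho>"
    unfolding unitary_rep_def
  proof (intro conjI allI ballI)
    fix a b r h f assume f: "f \<in> Carr D"
    show "Eqv D (\<rho> 1 f) f" using T_Ti[OF f] by (simp add: \<rho>_def \<pi> Eqv_D)
    show "Eqv D (\<rho> (a * b) f) (\<rho> a (\<rho> b f))" by (simp add: \<rho>_def \<pi> Eqv_D Ti_T)
    show "Eqv D (\<rho> (a + b) f) (Add D (\<rho> a f) (\<rho> b f))"
      using T_add[of "\<pi> a (Ti f)" "\<pi> b (Ti f)"] by (simp add: \<rho>_def \<pi> direct_integral_def)
    show "Eqv D (\<rho> (r *\<^sub>R a) f) (Scl D (complex_of_real r) (\<rho> a f))"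
      using T_scaleC[of "complex_of_real r" "\<pi> a (Ti f)"] by (simp add: \<rho>_def \<pi> direct_integral_def)
    show "Nrm D (\<rho> (gen h) f) = norm h * Nrm D f"
      by (simp add: \<rho>_def Nrm_T \<pi> Nrm_D[OF f])
  next
    fix a
    show "semilinear_map id D D (\<rho> a)"
      by (rule transported_semilinear[of "\<pi> a"]) (auto simp: \<pi> \<rho>_def T_Carr Add_Carr Scl_Carr)
  qed
  have gen_e: "AE x in M. \<rho> (gen (e k)) f x = J_std M c k f x" if "f \<in> Carr D" for k f
    using J_std_eq(1)[OF T_Ti[OF that], of k] by eventually_elim (simp add: \<rho>_def J)
  have gen_e': "AE x in M. \<rho> (gen (e' k)) f x = J'_std M c k f x" if "f \<in> Carr D" for k f
    using J_std_eq(2)[OF T_Ti[OF that], of k] by eventually_elim (simp add: \<rho>_def J')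
  have real: "invariant_real_structure e e' D \<rho> (S_std M)"
    unfolding invariant_real_structure_def
  proof (intro conjI ballI allI)
    show "semilinear_map cnj D D (S_std M)"
    proof (rule transported_semilinear[of S])
      show "AE x in M. S_std M f x = T (S (Ti f)) x" if "f \<in> Carr D" for f by (rule S_std_eq[OF T_Ti[OF that]])
    qed (auto simp: S_add S_scaleC S_std_Carr Add_Carr Scl_Carr)
    fix f assume f: "f \<in> Carr D"
    have Ti_S: "Ti (S_std M g) = S (Ti g)" if "g \<in> Carr D" for g
    proof (rule Ti_eqI)
      show "AE x in M. T (S (Ti g)) x = S_std M g x"
        using S_std_eq[OF T_Ti[OF that]] by eventually_elim simp
    qed
    show "Nrm D (S_std M f) = Nrm D f"
      by (simp add: Nrm_D S_std_Carr f Ti_S S_norm)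
    show "Eqv D (S_std M (S_std M f)) f"
      using S_std_eq[OF T_Ti[OF S_std_Carr[OF f]]] T_Ti[OF f] unfolding Eqv_D Ti_S[OF f] S_S by eventually_elim simp
    have comm: "Eqv D (S_std M (\<rho> a f)) (\<rho> a (S_std M f))" if "\<And>v. S (\<pi> a v) = \<pi> a (S v)" for a
    proof -
      have "AE x in M. S_std M (\<rho> a f) x = T (S (\<pi> a (Ti f))) x"
        by (rule S_std_eq) (simp add: \<rho>_def)
      then show ?thesis unfolding Eqv_D by eventually_elim (simp add: \<rho>_def Ti_S[OF f] that)
    qed
    show "Eqv D (S_std M (\<rho> (gen (e k)) f)) (\<rho> (gen (e k)) (S_std M f))" for k
      by (rule comm) (simp add: J S_J)
    show "Eqv D (S_std M (\<rho> (gen (e' k)) f)) (\<rho> (gen (e' k)) (S_std M f))" for k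
      by (rule comm) (rule S_J')
  qed
  have "in_standard_form e e' M U c \<rho>"
    unfolding in_standard_form_def using standard_form rep' gen_e gen_e' real by blast
  moreover have "unitarily_equivalent hilbert_type \<pi> D \<rho>"
    unfolding unitarily_equivalent_def
    by (intro exI[of _ T] conjI T_unitary_map) (simp add: \<rho>_def Ti_T Eqv_D)
  ultimately show ?thesis by blast
qed

end

theorem theorem3p8:
  fixes e e' :: "nat \<Rightarrow> 'h::real_inner"
    and \<pi> :: "'h clifford \<Rightarrow> 'v::complex_hilbert \<Rightarrow> 'v"
  assumes H_infinite_dim: "\<not> (\<exists>B. finite B \<and> span B = (UNIV :: 'h set))"
    and H_separable: "separable_space (euclidean :: 'h topology)"
    and basis: "enumerated_onb e e'"
    and V_separable: "separable_space (euclidean :: 'v topology)"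
    and rep: "unitary_rep hilbert_type \<pi>"
    and real_structure: "\<exists>S. invariant_real_structure e e' hilbert_type \<pi> S"
  shows "\<exists>\<mu> (U :: binseq \<Rightarrow> ell2 set) c \<rho>.
           in_standard_form e e' \<mu> U c \<rho> \<and>
           unitarily_equivalent hilbert_type \<pi> (direct_integral \<mu> U) \<rho>"
proof -
  note \<pi> = unitary_rep_hilbert_type[OF rep]
  obtain S where S: "\<And>v w. S (v + w) = S v + S w" "\<And>z v. S (scaleC z v) = scaleC (cnj z) (S v)"
    "\<And>v. norm (S v) = norm v" "\<And>v. S (S v) = v"
    "\<And>k v. S (\<pi> (gen (e k)) v) = \<pi> (gen (e k)) (S v)" "\<And>k v. S (\<pi> (gen (e' k)) v) = \<pi> (gen (e' k)) (S v)"
    using real_structure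
    by (auto simp: invariant_real_structure_def semilinear_map_def hilbert_type_def Nrm_def norm_eq_sqrt_inner inner_eq_Re_cinner)
  have onb: "inner (e i) (e j) = (if i = j then 1 else 0)" "inner (e' i) (e' j) = (if i = j then 1 else 0)"
    "inner (e i) (e' j) = 0" for i j
    using basis by (auto simp: enumerated_onb_def)
  have onb': "inner (e' j) (e i) = 0" for i j
    using onb(3)[of i j] by (simp add: inner_commute[of "e' j" "e i"])
  define J J' where "J k = \<pi> (gen (e k))" and "J' k = \<pi> (gen (e' k))" for k
  have scm: "scaleC (complex_of_real r) v = r *\<^sub>R v" for r and v :: 'v by (simp add: scaleR_scaleC)
  have sq: "\<pi> (gen h) (\<pi> (gen h) v) = - v" if "inner h h = 1" for h v
  proof -
    have "\<pi> (gen h) (\<pi> (gen h) v) = \<pi> ((- (inner h h)) *\<^sub>R 1) v" by (simp only: \<pi>(4)[symmetric] gen_mult_self)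
    then show ?thesis using that by (simp only: \<pi>(3,6) scm) simp
  qed
  \<comment> \<open>Polarization of the Clifford relation: the square of \<open>gen (h + k)\<close>
    is evaluated in two ways.\<close>
  have anti: "\<pi> (gen h) (\<pi> (gen k) v) = - \<pi> (gen k) (\<pi> (gen h) v)" if "inner h k = 0" for h k v
  proof -
    have "gen (h + k) * gen (h + k) = gen h * gen h + gen k * gen k"
      using that by (simp only: gen_mult_self) (simp add: inner_add inner_commute[of k h] scaleR_diff_left)
    moreover have "gen (h + k) * gen (h + k) = gen h * gen h + gen h * gen k + gen k * gen h + gen k * gen k"
      by (simp add: gen_add algebra_simps)
    ultimately have "gen h * gen k + gen k * gen h = (0 :: real) *\<^sub>R 1" by (simp add: algebra_simps)
    then have "\<pi> (gen h) (\<pi> (gen k) v) + \<pi> (gen k) (\<pi> (gen h) v) = 0"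
      by (metis \<pi>(4,5,6) scm scaleR_zero_left)
    then show ?thesis by (simp add: eq_neg_iff_add_eq_0)
  qed
  have nrm: "norm (J k v) = norm v" "norm (J' k v) = norm v" for k v
  proof -
    have "norm (e k) = 1" "norm (e' k) = 1" by (simp_all add: norm_eq_sqrt_inner onb)
    then show "norm (J k v) = norm v" "norm (J' k v) = norm v" by (simp_all add: J_def J'_def \<pi>(7))
  qed
  have J: "J k (v + w) = J k v + J k w" "J k (scaleC z v) = scaleC z (J k v)"
    "J' k (v + w) = J' k v + J' k w" "J' k (scaleC z v) = scaleC z (J' k v)" for k v w z
    by (simp_all add: J_def J'_def \<pi>)
  have Jm: "J k (- v) = - J k v" "J' k (- v) = - J' k v" for k v
    using J(2)[of k "complex_of_real (- 1)" v] J(4)[of k "complex_of_real (- 1)" v] by (simp_all only: scm) simp_all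
  have JJ: "J k (J k v) = - v" "J' k (J' k v) = - v" for k v
    unfolding J_def J'_def by (rule sq, simp add: onb)+
  have an: "k \<noteq> l \<Longrightarrow> J k (J l v) = - J l (J k v)" "k \<noteq> l \<Longrightarrow> J' k (J' l v) = - J' l (J' k v)"
    "J' l (J k v) = - J k (J' l v)" for k l v
    unfolding J_def J'_def by (rule anti, simp add: onb onb')+
  have Im: "scaleC \<i> (- v) = - scaleC \<i> v" for v :: 'v by (rule linear_neg[OF linear_scaleC])
  \<comment> \<open>The product of two anticommuting operators of square \<open>- 1\<close> again
    has square \<open>- 1\<close>; the factor \<open>- \<i>\<close> makes it an involution and, as
    \<open>S\<close> is antilinear, makes \<open>S\<close> anticommute with it.\<close>
  define N where "N k v = - scaleC \<i> (J k (J' k v))" for k v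
  have SJ: "S (J k v) = J k (S v)" "S (J' k v) = J' k (S v)" for k v
    by (simp_all add: J_def J'_def S)
  have Sm: "S (- v) = - S v" for v using S(2)[of "complex_of_real (- 1)" v] by (simp only: scm complex_cnj_complex_of_real) simp
  have Smi: "S (scaleC \<i> v) = - scaleC \<i> (S v)" for v
    using scaleC_decompose[of "- \<i>" "S v"] by (simp add: S(2))
  have N_add: "N k (v + w) = N k v + N k w" for k v w
    by (simp add: N_def J scaleC_add_right)
  have N_sc: "N k (scaleC z v) = scaleC z (N k v)" for k z v
  proof -
    have "scaleC \<i> (scaleC z w) = scaleC z (scaleC \<i> w)" for w :: 'v by (simp add: scaleC_scaleC mult.commute)
    then show ?thesis by (simp add: N_def J linear_neg[OF linear_scaleC])
  qed
  interpret real_spectral N S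
  proof
    fix k l v w z r
    show "N k (v + w) = N k v + N k w" by (rule N_add)
    show "N k (r *\<^sub>R v) = r *\<^sub>R N k v" by (simp add: N_sc scaleR_scaleC)
    show "N k (N k v) = v" by (simp add: N_def J Jm JJ an(3) Im scaleC_i_i)
    show "norm (N k v) = norm v" by (simp add: N_def nrm)
    show "N k (N l v) = N l (N k v)"
    proof (cases "k = l")
      case False
      \<comment> \<open>Each of the two operators of index \<open>l\<close> passes two of index
        \<open>k\<close>, and the four signs cancel.\<close>
      have "J k (J' k (J l (J' l v))) = J l (J' l (J k (J' k v)))"
        using False by (simp add: an(3) Jm an(2)[of k l] an(1)[of k l])
      then show ?thesis by (simp add: N_def J Jm Im)
    qed simp
    show "N k (scaleC z v) = scaleC z (N k v)" by (rule N_sc)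
    show "S (v + w) = S v + S w" "S (scaleC z v) = scaleC (cnj z) (S v)" "norm (S v) = norm v" "S (S v) = v" by (rule S)+
    show "S (N k v) = - N k (S v)" by (simp add: N_def Sm Smi SJ)
    show "\<exists>D :: 'v set. countable D \<and> closure D = UNIV"
      using V_separable by (auto simp: separable_space_def euclidean_closure_of)
  qed
  obtain u e0 where "cyclic_system N S u e0" using cyclic_system_ex by blast
  then interpret cyclic_system N S u e0 .
  interpret standard_system N S u e0 J
  proof
    fix k l v w z
    show "J k (N k v) = - N k (J k v)" by (simp add: N_def J Jm an(3) Im)
    show "J k (N l v) = N l (J k v)" if "k \<noteq> l" using that by (simp add: N_def J Jm an(3) an(1)[of k l] Im)
    show "J k (J l v) = - J l (J k v)" if "k \<noteq> l" using that by (rule an(1))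
  qed (simp_all add: J nrm JJ SJ)
  show ?thesis
  proof (rule standard_form_equivalence[OF rep])
    show "\<pi> (gen (e k)) v = J k v" for k v by (simp add: J_def)
    \<comment> \<open>\<open>J k (N k v)\<close> is \<i> times \<open>J' k v\<close>, because
      \<open>J k\<close> has square \<open>- 1\<close>.\<close>
    show "\<pi> (gen (e' k)) v = - scaleC \<i> (J k (N k v))" for k v
      by (simp add: N_def J Jm JJ Im scaleC_i_i flip: J'_def)
    show "S (\<pi> (gen (e' k)) v) = \<pi> (gen (e' k)) (S v)" for k v by (rule S)
  qed
qed

end
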